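(* Let $\left((F,\nu,N),[\,,]_{F,h},(\rho,\eta)\right)$ be a generalized Lie algebroid with $F$ of rank $p$, and let $(E,\pi,M)$ be an interior differential system (IDS) of it, of rank $r$. Suppose $\{\Theta^{r+1},\dots,\Theta^p\}$ is a basis of the $\mathcal F(M)$-module $\Gamma(E^0,\pi^0,M)$, where $E^0$ is the annihilator subbundle of $E$. Then the IDS $(E,\pi,M)$ is involutive if and only if there exist $\Omega^\alpha_\beta\in\Lambda^1(h^*F,h^*\nu,M)$, $\alpha,\beta\in\{r+1,\dots,p\}$, such that for all $\alpha\in\{r+1,\dots,p\}$ $$d^{h^*F}\Theta^\alpha=\sum_{\beta=r+1}^p\Omega^\alpha_\beta\wedge\Theta^\beta\in\mathcal I\big(\Gamma(E^0,\pi^0,M)\big),$$ where $\mathcal I(\Gamma(E^0,\pi^0,M))$ is the ideal of the exterior algebra $\Lambda(h^*F,h^*\nu,M)$ generated by $\Gamma(E^0,\pi^0,M)$.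
   Context: All manifolds, maps, bundles and sections are smooth; $\mathcal F(N)=C^\infty(N,\mathbb R)$; $\Gamma(F,\nu,N)$ is the $\mathcal F(N)$-module of sections of a vector bundle $(F,\nu,N)$. For a vector bundle morphism $(\varphi,\varphi_0)$ from $(E,\pi,M)$ to $(E',\pi',M')$ with $\varphi_0:M\to M'$ a diffeomorphism, $\Gamma(\varphi,\varphi_0):\Gamma(E,\pi,M)\to\Gamma(E',\pi',M')$ is defined by $(\Gamma(\varphi,\varphi_0)u)(y)=\varphi(u(\varphi_0^{-1}(y)))$. Generalized Lie algebroid: let $h:M\to N$ and $\eta:N\to M$ be diffeomorphisms, $(F,\nu,N)$ a vector bundle, $(\rho,\eta)$ a vector bundle morphism from $(F,\nu,N)$ to $(TM,\tau_M,M)$, and $[\,,]_{F,h}:\Gamma(F,\nu,N)\times\Gamma(F,\nu,N)\to\Gamma(F,\nu,N)$ an operation. Write $a(z)=\Gamma(Th\circ\rho,h\circ\eta)(z)$, a vector field on $N$, for $z\in\Gamma(F,\nu,N)$. The triple $((F,\nu,N),[\,,]_{F,h},(\rho,\eta))$ is a generalized Lie algebroid if: (1) $[u,fv]_{F,h}=f[u,v]_{F,h}+(a(u)f)\,v$ for all $u,v\in\Gamma(F,\nu,N)$, $f\in\mathcal F(N)$; (2) $(\Gamma(F,\nu,N),[\,,]_{F,h})$ is a real Lie algebra; (3) $a:\Gamma(F,\nu,N)\to\Gamma(TN,\tau_N,N)$ is a morphism of Lie algebras (for the usual bracket of vector fields). Pull-back Lie algebroid: let $(h^*F,h^*\nu,M)$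 be the pull-back of $F$ by $h$. Since $h$ is a diffeomorphism, $z\mapsto z\circ h$ is a bijection $\Gamma(F,\nu,N)\to\Gamma(h^*F,h^*\nu,M)$. The pull-back bundle is a Lie algebroid over $M$ with bracket $[z\circ h,w\circ h]_{h^*F}=[z,w]_{F,h}\circ h$ and anchor $\overset{h^*F}{\rho}$ determined by $\overset{h^*F}{\rho}(z\circ h)=\Gamma(\rho,\eta)(z)$, equivalently the vector field on $M$ that is $h$-related to $a(z)$. (In a local frame $t_\alpha$ of $F$ with $[t_\alpha,t_\beta]_{F,h}=L_{\alpha\beta}^\gamma t_\gamma$, $T_\alpha=t_\alpha\circ h$ and $\Gamma(\rho,\eta)(t_\alpha)=(\rho^i_\alpha\circ h)\partial/\partial x^i$: $[T_\alpha,T_\beta]_{h^*F}=(L^\gamma_{\alpha\beta}\circ h)T_\gamma$, $[T_\alpha,fT_\beta]_{h^*F}=f(L^\gamma_{\alpha\beta}\circ h)T_\gamma+(\rho^i_\alpha\circ h)\frac{\partial f}{\partial x^i}T_\beta$.) $\Lambda^q(h^*F,h^*\nu,M)$ is the $\mathcal F(M)$-module of alternating $\mathcal F(M)$-multilinear maps $\Gamma(h^*F,h^*\nu,M)^q\to\mathcal F(M)$ ($\Lambda^0=\mathcal F(M)$), $\Lambda=\bigoplus_q\Lambda^q$ with the usual exterior product (shuffle-sum convention, so for 1-forms $(\omega\wedge\theta)(U,V)=\omega(U)\theta(V)-\omega(V)\theta(U)$), and $d^{h^*F}$ is the usual Lie algebroid exterior differential, $$d^{h^*F}\omega(Z_0,\dots,Z_q)=\sum_i(-1)^i\overset{h^*F}{\rho}(Z_i)\big(\omega(Z_0,\dots,\hat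 Z_i,\dots,Z_q)\big)+\sum_{i<j}(-1)^{i+j}\omega\big([Z_i,Z_j]_{h^*F},Z_0,\dots,\hat Z_i,\dots,\hat Z_j,\dots,Z_q\big).$$ An interior differential system (IDS) of the generalized Lie algebroid is a vector subbundle $(E,\pi,M)$ of $(h^*F,h^*\nu,M)$. Its annihilator subbundle $(E^0,\pi^0,M)$ of the dual bundle of $h^*F$ is determined by $\Gamma(E^0,\pi^0,M)=\{\Omega:\Omega(S)=0\ \forall S\in\Gamma(E,\pi,M)\}$. The IDS is involutive if $[S,T]_{h^*F}\in\Gamma(E,\pi,M)$ for all $S,T\in\Gamma(E,\pi,M)$. *)

theory Defs
  imports "HOL-Analysis.Analysis" "HOL-Algebra.Ideal"
begin

section \<open>Smooth functions on open subsets of Euclidean n-space\<close>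

text \<open>
  \<open>R^n\<close> is the library's \<^const>\<open>Euclidean_space\<close>: functions \<open>nat \<Rightarrow> real\<close> vanishing at all
  indices \<open>\<ge> n\<close>.  The dimension is thus a natural number (0 included) and not a type.
  A function is of class \<open>C^(k+1)\<close> iff it is continuous and its partial derivatives exist and are
  of class \<open>C^k\<close>.  The set \<open>S\<close> is always an open subset of \<open>R^n\<close> below.
\<close>

primrec Ck_on :: "nat \<Rightarrow> nat \<Rightarrow> (nat \<Rightarrow> real) set \<Rightarrow> ((nat \<Rightarrow> real) \<Rightarrow> real) \<Rightarrow> bool" where
  "Ck_on 0 n S f = continuous_on S f"
| "Ck_on (Suc k) n S f = (continuous_on S f \<and>
     (\<forall>i<n. \<exists>g. (\<forall>x\<in>S. ((\<lambda>t. f (x(i := t))) has_real_derivative g x) (at (x i))) \<and> Ck_on k n S g))"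

definition Csmooth_on :: "nat \<Rightarrow> (nat \<Rightarrow> real) set \<Rightarrow> ((nat \<Rightarrow> real) \<Rightarrow> real) \<Rightarrow> bool" where
  "Csmooth_on n S f \<longleftrightarrow> (\<forall>k. Ck_on k n S f)"


section \<open>Smooth manifolds\<close>

text \<open>
  A manifold is a set with an atlas; its topology is the one induced by the atlas.
  A chart is a pair of its domain and its coordinate map.
\<close>

record 'a manifold =
  points :: "'a set"
  mdim :: nat
  charts :: "('a set \<times> ('a \<Rightarrow> nat \<Rightarrow> real)) set"

definition mtop :: "'a manifold \<Rightarrow> 'a topology" where
  "mtop M = topology (\<lambda>A. A \<subseteq> points M \<and>
     (\<forall>(U, \<phi>)\<in>charts M. openin (Euclidean_space (mdim M)) (\<phi> ` (A \<inter> U))))"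

definition smooth_manifold :: "'a manifold \<Rightarrow> bool" where
  "smooth_manifold M \<longleftrightarrow>
     points M = (\<Union>(U, \<phi>)\<in>charts M. U) \<and>
     (\<forall>(U, \<phi>)\<in>charts M. inj_on \<phi> U \<and> openin (Euclidean_space (mdim M)) (\<phi> ` U)) \<and>
     (\<forall>(U, \<phi>)\<in>charts M. \<forall>(V, \<psi>)\<in>charts M.
        openin (Euclidean_space (mdim M)) (\<phi> ` (U \<inter> V)) \<and>
        (\<forall>i<mdim M. Csmooth_on (mdim M) (\<phi> ` (U \<inter> V)) (\<lambda>x. \<psi> (inv_into U \<phi> x) i))) \<and>
     Hausdorff_space (mtop M) \<and> second_countable (mtop M)"

definition smooth_map :: "'a manifold \<Rightarrow> 'b manifold \<Rightarrow> ('a \<Rightarrow> 'b) \<Rightarrow> bool" where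
  "smooth_map M M' f \<longleftrightarrow>
     f \<in> points M \<rightarrow> points M' \<and> continuous_map (mtop M) (mtop M') f \<and>
     (\<forall>(U, \<phi>)\<in>charts M. \<forall>(V, \<psi>)\<in>charts M'. \<forall>i<mdim M'.
        Csmooth_on (mdim M) (\<phi> ` {x \<in> U. f x \<in> V}) (\<lambda>x. \<psi> (f (inv_into U \<phi> x)) i))"

definition diffeomorphism :: "'a manifold \<Rightarrow> 'b manifold \<Rightarrow> ('a \<Rightarrow> 'b) \<Rightarrow> bool" where
  "diffeomorphism M M' f \<longleftrightarrow>
     bij_betw f (points M) (points M') \<and> smooth_map M M' f \<and> smooth_map M' M (inv_into (points M) f)"

definition smooth_fun_on :: "'a manifold \<Rightarrow> 'a set \<Rightarrow> ('a \<Rightarrow> real) \<Rightarrow> bool" where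
  "smooth_fun_on M A f \<longleftrightarrow>
     (\<forall>(U, \<phi>)\<in>charts M. Csmooth_on (mdim M) (\<phi> ` (A \<inter> U)) (\<lambda>x. f (inv_into U \<phi> x)))"

definition smooth_near :: "'a manifold \<Rightarrow> 'a \<Rightarrow> ('a \<Rightarrow> real) \<Rightarrow> bool" where
  "smooth_near M p f \<longleftrightarrow> (\<exists>A. openin (mtop M) A \<and> p \<in> A \<and> smooth_fun_on M A f)"

text \<open>
  Functions, sections and forms are taken \<^const>\<open>extensional\<close> (\<^const>\<open>undefined\<close> outside their
  domain), so that equality in HOL is equality on the domain.
\<close>

definition smooth_functions :: "'a manifold \<Rightarrow> ('a \<Rightarrow> real) set" where
  "smooth_functions M = {f \<in> extensional (points M). smooth_fun_on M (points M) f}"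


section \<open>Vector bundles\<close>

text \<open>
  A vector bundle is given by its fibrewise linear structure and a bundle atlas: a member
  \<open>(U, \<tau>)\<close> of \<open>trivs\<close> is a trivialization over the open set \<open>U\<close>, \<open>\<tau>\<close> being its fibre component,
  so that \<open>e \<mapsto> (bproj e, \<tau> e)\<close> maps the part over \<open>U\<close> onto \<open>U \<times> R^frank\<close>.
\<close>

record ('e, 'b) vbundle =
  tot :: "'e set"
  base :: "'b manifold"
  bproj :: "'e \<Rightarrow> 'b"
  frank :: nat
  fzero :: "'b \<Rightarrow> 'e"
  fadd :: "'e \<Rightarrow> 'e \<Rightarrow> 'e"
  fscale :: "real \<Rightarrow> 'e \<Rightarrow> 'e"
  trivs :: "('b set \<times> ('e \<Rightarrow> nat \<Rightarrow> real)) set"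

definition fibre :: "('e, 'b) vbundle \<Rightarrow> 'b \<Rightarrow> 'e set" where
  "fibre B x = {e \<in> tot B. bproj B e = x}"

definition smooth_transition ::
  "('e, 'b) vbundle \<Rightarrow> 'b set \<Rightarrow> ('e \<Rightarrow> nat \<Rightarrow> real) \<Rightarrow> 'b set \<Rightarrow> ('e \<Rightarrow> nat \<Rightarrow> real) \<Rightarrow> bool" where
  "smooth_transition B U \<tau> V \<sigma> \<longleftrightarrow>
     (\<exists>g. (\<forall>i<frank B. \<forall>j<frank B. smooth_fun_on (base B) (U \<inter> V) (g i j)) \<and>
          (\<forall>x\<in>U \<inter> V. \<forall>e\<in>fibre B x. \<forall>i<frank B. \<sigma> e i = (\<Sum>j<frank B. g i j x * \<tau> e j)))"

text \<open>A local trivialization compatible with the bundle atlas, not necessarily a member of it.\<close>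

definition local_triv :: "('e, 'b) vbundle \<Rightarrow> 'b set \<Rightarrow> ('e \<Rightarrow> nat \<Rightarrow> real) \<Rightarrow> bool" where
  "local_triv B V \<tau> \<longleftrightarrow>
     openin (mtop (base B)) V \<and>
     (\<forall>x\<in>V. bij_betw \<tau> (fibre B x) (topspace (Euclidean_space (frank B))) \<and>
        (\<forall>i. \<tau> (fzero B x) i = 0) \<and>
        (\<forall>e\<in>fibre B x. \<forall>e'\<in>fibre B x. \<forall>i. \<tau> (fadd B e e') i = \<tau> e i + \<tau> e' i) \<and>
        (\<forall>e\<in>fibre B x. \<forall>c i. \<tau> (fscale B c e) i = c * \<tau> e i)) \<and>
     (\<forall>(U, \<sigma>)\<in>trivs B. smooth_transition B U \<sigma> V \<tau> \<and> smooth_transition B V \<tau> U \<sigma>)"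

text \<open>
  The vector space axioms in the fibres are transported from \<open>R^frank\<close> by the linear bijections
  \<open>\<tau>\<close>, so only closure has to be required.
\<close>

definition vector_bundle :: "('e, 'b) vbundle \<Rightarrow> bool" where
  "vector_bundle B \<longleftrightarrow>
     smooth_manifold (base B) \<and>
     bproj B \<in> tot B \<rightarrow> points (base B) \<and>
     (\<forall>x\<in>points (base B). fzero B x \<in> fibre B x \<and>
        (\<forall>e\<in>fibre B x. \<forall>e'\<in>fibre B x. fadd B e e' \<in> fibre B x) \<and>
        (\<forall>e\<in>fibre B x. \<forall>c. fscale B c e \<in> fibre B x)) \<and>
     points (base B) = (\<Union>(U, \<tau>)\<in>trivs B. U) \<and>
     (\<forall>(U, \<tau>)\<in>trivs B. local_triv B U \<tau>)"

definition join :: "nat \<Rightarrow> (nat \<Rightarrow> real) \<Rightarrow> (nat \<Rightarrow> real) \<Rightarrow> nat \<Rightarrow> real" where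
  "join n x y = (\<lambda>i. if i < n then x i else y (i - n))"

definition total_space :: "('e, 'b) vbundle \<Rightarrow> 'e manifold" where
  "total_space B = \<lparr>points = tot B, mdim = mdim (base B) + frank B,
     charts = (\<Union>(U, \<phi>)\<in>charts (base B). \<Union>(V, \<tau>)\<in>trivs B.
       {({e \<in> tot B. bproj B e \<in> U \<inter> V}, \<lambda>e. join (mdim (base B)) (\<phi> (bproj B e)) (\<tau> e))})\<rparr>"

definition vb_morphism ::
  "('e, 'b) vbundle \<Rightarrow> ('f, 'c) vbundle \<Rightarrow> ('e \<Rightarrow> 'f) \<Rightarrow> ('b \<Rightarrow> 'c) \<Rightarrow> bool" where
  "vb_morphism B B' \<phi> \<phi>0 \<longleftrightarrow>
     smooth_map (base B) (base B') \<phi>0 \<and> smooth_map (total_space B) (total_space B') \<phi> \<and>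
     (\<forall>e\<in>tot B. bproj B' (\<phi> e) = \<phi>0 (bproj B e)) \<and>
     (\<forall>x\<in>points (base B). \<forall>e\<in>fibre B x. \<forall>e'\<in>fibre B x. \<phi> (fadd B e e') = fadd B' (\<phi> e) (\<phi> e')) \<and>
     (\<forall>e\<in>tot B. \<forall>c. \<phi> (fscale B c e) = fscale B' c (\<phi> e))"

definition sections :: "('e, 'b) vbundle \<Rightarrow> ('b \<Rightarrow> 'e) set" where
  "sections B = {s \<in> extensional (points (base B)).
     smooth_map (base B) (total_space B) s \<and> (\<forall>x\<in>points (base B). bproj B (s x) = x)}"

definition sec_zero :: "('e, 'b) vbundle \<Rightarrow> 'b \<Rightarrow> 'e" where
  "sec_zero B = (\<lambda>x\<in>points (base B). fzero B x)"

definition sec_add :: "('e, 'b) vbundle \<Rightarrow> ('b \<Rightarrow> 'e) \<Rightarrow> ('b \<Rightarrow> 'e) \<Rightarrow> 'b \<Rightarrow> 'e" where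
  "sec_add B s t = (\<lambda>x\<in>points (base B). fadd B (s x) (t x))"

definition sec_scale :: "('e, 'b) vbundle \<Rightarrow> ('b \<Rightarrow> real) \<Rightarrow> ('b \<Rightarrow> 'e) \<Rightarrow> 'b \<Rightarrow> 'e" where
  "sec_scale B f s = (\<lambda>x\<in>points (base B). fscale B (f x) (s x))"

text \<open>The map \<open>\<Gamma>(\<phi>, \<phi>0)\<close> on sections, from a bundle over \<open>M\<close> to a bundle over \<open>M'\<close>.\<close>

definition sec_map ::
  "'b manifold \<Rightarrow> 'c manifold \<Rightarrow> ('e \<Rightarrow> 'f) \<Rightarrow> ('b \<Rightarrow> 'c) \<Rightarrow> ('b \<Rightarrow> 'e) \<Rightarrow> 'c \<Rightarrow> 'f" where
  "sec_map M M' \<phi> \<phi>0 u = (\<lambda>y\<in>points M'. \<phi> (u (inv_into (points M) \<phi>0 y)))"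

text \<open>
  A subbundle of rank \<open>r\<close> is a subset of the total space which near every point is the subset
  \<open>U \<times> (R^r \<times> 0)\<close> of \<open>U \<times> R^frank\<close> in a suitable local trivialization.
\<close>

definition subbundle :: "('e, 'b) vbundle \<Rightarrow> nat \<Rightarrow> 'e set \<Rightarrow> bool" where
  "subbundle B r E \<longleftrightarrow>
     E \<subseteq> tot B \<and> r \<le> frank B \<and>
     (\<forall>x\<in>points (base B). \<exists>V \<tau>. x \<in> V \<and> local_triv B V \<tau> \<and>
        (\<forall>y\<in>V. E \<inter> fibre B y = {e \<in> fibre B y. \<forall>i\<ge>r. \<tau> e i = 0}))"

definition sections_in :: "('e, 'b) vbundle \<Rightarrow> 'e set \<Rightarrow> ('b \<Rightarrow> 'e) set" where
  "sections_in B E = {s \<in> sections B. \<forall>x\<in>points (base B). s x \<in> E}"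


section \<open>Tangent bundle\<close>

text \<open>
  Tangent vectors are derivations of germs of smooth functions.  A derivation is a function on all
  functions; it is constrained to be \<open>0\<close> on functions that are not smooth near the base point.
\<close>

type_synonym 'a deriv = "('a \<Rightarrow> real) \<Rightarrow> real"

definition tangent_space :: "'a manifold \<Rightarrow> 'a \<Rightarrow> 'a deriv set" where
  "tangent_space M p = {v.
     (\<forall>f g. smooth_near M p f \<longrightarrow> smooth_near M p g \<longrightarrow>
        v (\<lambda>x. f x + g x) = v f + v g \<and>
        v (\<lambda>x. f x * g x) = v f * g p + f p * v g) \<and>
     (\<forall>f c. smooth_near M p f \<longrightarrow> v (\<lambda>x. c * f x) = c * v f) \<and>
     (\<forall>f g A. openin (mtop M) A \<longrightarrow> p \<in> A \<longrightarrow> (\<forall>x\<in>A. f x = g x) \<longrightarrow> v f = v g) \<and>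
     (\<forall>f. \<not> smooth_near M p f \<longrightarrow> v f = 0)}"

definition tangent_bundle :: "'a manifold \<Rightarrow> ('a \<times> 'a deriv, 'a) vbundle" where
  "tangent_bundle M = \<lparr>
     tot = (SIGMA p:points M. tangent_space M p),
     base = M,
     bproj = fst,
     frank = mdim M,
     fzero = (\<lambda>p. (p, \<lambda>f. 0)),
     fadd = (\<lambda>(p, v) (q, w). (p, \<lambda>f. v f + w f)),
     fscale = (\<lambda>c (p, v). (p, \<lambda>f. c * v f)),
     trivs = (\<lambda>(U, \<phi>). (U, \<lambda>(p, v) i. if i < mdim M then v (\<lambda>q. \<phi> q i) else 0)) ` charts M\<rparr>"

definition tangent_map ::
  "'a manifold \<Rightarrow> 'b manifold \<Rightarrow> ('a \<Rightarrow> 'b) \<Rightarrow> 'a \<times> 'a deriv \<Rightarrow> 'b \<times> 'b deriv" where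
  "tangent_map M M' h =
     (\<lambda>(p, v). (h p, \<lambda>f. if smooth_near M' (h p) f then v (\<lambda>x. f (h x)) else 0))"

definition vf_apply :: "'a manifold \<Rightarrow> ('a \<Rightarrow> 'a \<times> 'a deriv) \<Rightarrow> ('a \<Rightarrow> real) \<Rightarrow> 'a \<Rightarrow> real" where
  "vf_apply M X f = (\<lambda>p\<in>points M. snd (X p) f)"

definition vf_bracket ::
  "'a manifold \<Rightarrow> ('a \<Rightarrow> 'a \<times> 'a deriv) \<Rightarrow> ('a \<Rightarrow> 'a \<times> 'a deriv) \<Rightarrow> 'a \<Rightarrow> 'a \<times> 'a deriv" where
  "vf_bracket M X Y = (\<lambda>p\<in>points M. (p, \<lambda>f. if smooth_near M p f
     then snd (X p) (\<lambda>q. snd (Y q) f) - snd (Y p) (\<lambda>q. snd (X q) f) else 0))"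


section \<open>Generalized Lie algebroids\<close>

definition real_lie_bracket ::
  "('e, 'b) vbundle \<Rightarrow> (('b \<Rightarrow> 'e) \<Rightarrow> ('b \<Rightarrow> 'e) \<Rightarrow> 'b \<Rightarrow> 'e) \<Rightarrow> bool" where
  "real_lie_bracket B br \<longleftrightarrow>
     (\<forall>u\<in>sections B. \<forall>v\<in>sections B. br u v \<in> sections B) \<and>
     (\<forall>u\<in>sections B. \<forall>v\<in>sections B. \<forall>w\<in>sections B. \<forall>c.
        br (sec_add B u v) w = sec_add B (br u w) (br v w) \<and>
        br w (sec_add B u v) = sec_add B (br w u) (br w v) \<and>
        br (sec_scale B (\<lambda>_. c) u) v = sec_scale B (\<lambda>_. c) (br u v) \<and>
        br u (sec_scale B (\<lambda>_. c) v) = sec_scale B (\<lambda>_. c) (br u v)) \<and>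
     (\<forall>u\<in>sections B. br u u = sec_zero B) \<and>
     (\<forall>u\<in>sections B. \<forall>v\<in>sections B. \<forall>w\<in>sections B.
        sec_add B (br u (br v w)) (sec_add B (br v (br w u)) (br w (br u v))) = sec_zero B)"

definition lie_morphism_to_vf ::
  "('e, 'b) vbundle \<Rightarrow> (('b \<Rightarrow> 'e) \<Rightarrow> ('b \<Rightarrow> 'e) \<Rightarrow> 'b \<Rightarrow> 'e) \<Rightarrow>
   (('b \<Rightarrow> 'e) \<Rightarrow> 'b \<Rightarrow> 'b \<times> 'b deriv) \<Rightarrow> bool" where
  "lie_morphism_to_vf B br a \<longleftrightarrow>
     (\<forall>u\<in>sections B. a u \<in> sections (tangent_bundle (base B))) \<and>
     (\<forall>u\<in>sections B. \<forall>v\<in>sections B. \<forall>c.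
        a (sec_add B u v) = sec_add (tangent_bundle (base B)) (a u) (a v) \<and>
        a (sec_scale B (\<lambda>_. c) u) = sec_scale (tangent_bundle (base B)) (\<lambda>_. c) (a u) \<and>
        a (br u v) = vf_bracket (base B) (a u) (a v))"

text \<open>The map \<open>a = \<Gamma>(Th \<circ> \<rho>, h \<circ> \<eta>)\<close>; the manifold \<open>N\<close> is the base of \<open>F\<close>.\<close>

definition anchor_N ::
  "'m manifold \<Rightarrow> ('m \<Rightarrow> 'n) \<Rightarrow> ('n \<Rightarrow> 'm) \<Rightarrow> ('f, 'n) vbundle \<Rightarrow> ('f \<Rightarrow> 'm \<times> 'm deriv) \<Rightarrow>
   ('n \<Rightarrow> 'f) \<Rightarrow> 'n \<Rightarrow> 'n \<times> 'n deriv" where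
  "anchor_N M h \<eta> F \<rho> = sec_map (base F) (base F) (tangent_map M (base F) h \<circ> \<rho>) (h \<circ> \<eta>)"

locale generalized_lie_algebroid =
  fixes M :: "'m manifold" and h :: "'m \<Rightarrow> 'n" and \<eta> :: "'n \<Rightarrow> 'm"
    and F :: "('f, 'n) vbundle"
    and br :: "('n \<Rightarrow> 'f) \<Rightarrow> ('n \<Rightarrow> 'f) \<Rightarrow> 'n \<Rightarrow> 'f"
    and \<rho> :: "'f \<Rightarrow> 'm \<times> 'm deriv"
  assumes manifold_M: "smooth_manifold M"
    and bundle_F: "vector_bundle F"
    and diffeo_h: "diffeomorphism M (base F) h"
    and diffeo_eta: "diffeomorphism (base F) M \<eta>"
    and morphism_rho: "vb_morphism F (tangent_bundle M) \<rho> \<eta>"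
    and leibniz: "\<And>u v f. u \<in> sections F \<Longrightarrow> v \<in> sections F \<Longrightarrow> f \<in> smooth_functions (base F) \<Longrightarrow>
      br u (sec_scale F f v) =
        sec_add F (sec_scale F f (br u v))
          (sec_scale F (vf_apply (base F) (anchor_N M h \<eta> F \<rho> u) f) v)"
    and lie_algebra: "real_lie_bracket F br"
    and lie_morphism: "lie_morphism_to_vf F br (anchor_N M h \<eta> F \<rho>)"


section \<open>The pull-back Lie algebroid\<close>

definition pullback_bundle ::
  "'m manifold \<Rightarrow> ('m \<Rightarrow> 'n) \<Rightarrow> ('f, 'n) vbundle \<Rightarrow> ('m \<times> 'f, 'm) vbundle" where
  "pullback_bundle M h F = \<lparr>
     tot = {(x, e). x \<in> points M \<and> e \<in> tot F \<and> bproj F e = h x},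
     base = M,
     bproj = fst,
     frank = frank F,
     fzero = (\<lambda>x. (x, fzero F (h x))),
     fadd = (\<lambda>(x, e) (y, e'). (x, fadd F e e')),
     fscale = (\<lambda>c (x, e). (x, fscale F c e)),
     trivs = (\<lambda>(U, \<tau>). ({x \<in> points M. h x \<in> U}, \<lambda>(x, e). \<tau> e)) ` trivs F\<rparr>"

text \<open>
  The section \<open>z \<circ> h\<close> of the pull-back bundle is \<open>x \<mapsto> (x, z (h x))\<close>; \<open>unpull\<close> is the inverse
  of \<open>z \<mapsto> z \<circ> h\<close>.
\<close>

definition pull_sec :: "'m manifold \<Rightarrow> ('m \<Rightarrow> 'n) \<Rightarrow> ('n \<Rightarrow> 'f) \<Rightarrow> 'm \<Rightarrow> 'm \<times> 'f" where
  "pull_sec M h z = (\<lambda>x\<in>points M. (x, z (h x)))"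

definition unpull ::
  "'m manifold \<Rightarrow> ('m \<Rightarrow> 'n) \<Rightarrow> ('f, 'n) vbundle \<Rightarrow> ('m \<Rightarrow> 'm \<times> 'f) \<Rightarrow> 'n \<Rightarrow> 'f" where
  "unpull M h F Z = (\<lambda>y\<in>points (base F). snd (Z (inv_into (points M) h y)))"

definition pb_bracket ::
  "'m manifold \<Rightarrow> ('m \<Rightarrow> 'n) \<Rightarrow> ('f, 'n) vbundle \<Rightarrow> (('n \<Rightarrow> 'f) \<Rightarrow> ('n \<Rightarrow> 'f) \<Rightarrow> 'n \<Rightarrow> 'f) \<Rightarrow>
   ('m \<Rightarrow> 'm \<times> 'f) \<Rightarrow> ('m \<Rightarrow> 'm \<times> 'f) \<Rightarrow> 'm \<Rightarrow> 'm \<times> 'f" where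
  "pb_bracket M h F br Z W = pull_sec M h (br (unpull M h F Z) (unpull M h F W))"

definition pb_anchor ::
  "'m manifold \<Rightarrow> ('m \<Rightarrow> 'n) \<Rightarrow> ('n \<Rightarrow> 'm) \<Rightarrow> ('f, 'n) vbundle \<Rightarrow> ('f \<Rightarrow> 'm \<times> 'm deriv) \<Rightarrow>
   ('m \<Rightarrow> 'm \<times> 'f) \<Rightarrow> 'm \<Rightarrow> 'm \<times> 'm deriv" where
  "pb_anchor M h \<eta> F \<rho> Z = sec_map (base F) M \<rho> \<eta> (unpull M h F Z)"


section \<open>Exterior algebra\<close>

type_synonym ('e, 'b) form = "('b \<Rightarrow> 'e) list \<Rightarrow> 'b \<Rightarrow> real"

definition tuples :: "('e, 'b) vbundle \<Rightarrow> nat \<Rightarrow> ('b \<Rightarrow> 'e) list set" where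
  "tuples B q = {Zs. length Zs = q \<and> set Zs \<subseteq> sections B}"

definition forms :: "('e, 'b) vbundle \<Rightarrow> nat \<Rightarrow> ('e, 'b) form set" where
  "forms B q = {\<omega> \<in> extensional (tuples B q).
     (\<forall>Zs\<in>tuples B q. \<omega> Zs \<in> smooth_functions (base B)) \<and>
     (\<forall>Zs\<in>tuples B q. \<forall>i<q. \<forall>Z\<in>sections B. \<forall>W\<in>sections B.
        \<forall>f\<in>smooth_functions (base B). \<forall>g\<in>smooth_functions (base B).
        \<omega> (Zs[i := sec_add B (sec_scale B f Z) (sec_scale B g W)]) =
          (\<lambda>x\<in>points (base B). f x * \<omega> (Zs[i := Z]) x + g x * \<omega> (Zs[i := W]) x)) \<and>
     (\<forall>Zs\<in>tuples B q. \<forall>i j. i < j \<longrightarrow> j < q \<longrightarrow> Zs ! i = Zs ! j \<longrightarrow>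
        \<omega> Zs = (\<lambda>x\<in>points (base B). 0))}"

definition form_zero :: "('e, 'b) vbundle \<Rightarrow> nat \<Rightarrow> ('e, 'b) form" where
  "form_zero B q = (\<lambda>Zs\<in>tuples B q. \<lambda>x\<in>points (base B). 0)"

definition form_sum :: "('e, 'b) vbundle \<Rightarrow> nat \<Rightarrow> 'i set \<Rightarrow> ('i \<Rightarrow> ('e, 'b) form) \<Rightarrow> ('e, 'b) form" where
  "form_sum B q I \<omega> = (\<lambda>Zs\<in>tuples B q. \<lambda>x\<in>points (base B). \<Sum>i\<in>I. \<omega> i Zs x)"

definition form_scale :: "('e, 'b) vbundle \<Rightarrow> nat \<Rightarrow> ('b \<Rightarrow> real) \<Rightarrow> ('e, 'b) form \<Rightarrow> ('e, 'b) form" where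
  "form_scale B q f \<omega> = (\<lambda>Zs\<in>tuples B q. \<lambda>x\<in>points (base B). f x * \<omega> Zs x)"

text \<open>
  A \<open>(q,s)\<close>-shuffle is given by the set \<open>A\<close> of the positions of the arguments of the first factor;
  its sign is determined by the number of inversions.
\<close>

definition shuffle_sign :: "nat \<Rightarrow> nat set \<Rightarrow> real" where
  "shuffle_sign n A = (-1) ^ card {(i, j). i \<in> A \<and> j \<in> {..<n} - A \<and> j < i}"

definition wedge ::
  "('e, 'b) vbundle \<Rightarrow> nat \<Rightarrow> nat \<Rightarrow> ('e, 'b) form \<Rightarrow> ('e, 'b) form \<Rightarrow> ('e, 'b) form" where
  "wedge B q s \<omega> \<theta> = (\<lambda>Zs\<in>tuples B (q + s). \<lambda>x\<in>points (base B).
     \<Sum>A | A \<subseteq> {..<q + s} \<and> card A = q.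
       shuffle_sign (q + s) A * \<omega> (nths Zs A) x * \<theta> (nths Zs (- A)) x)"

text \<open>The direct sum of the \<open>forms B q\<close>: an element is the family of its homogeneous components.\<close>

definition exterior_algebra :: "('e, 'b) vbundle \<Rightarrow> (nat \<Rightarrow> ('e, 'b) form) ring" where
  "exterior_algebra B = \<lparr>
     carrier = {\<omega>. (\<forall>q. \<omega> q \<in> forms B q) \<and> finite {q. \<omega> q \<noteq> form_zero B q}},
     mult = (\<lambda>\<omega> \<theta> k. form_sum B k {..k} (\<lambda>i. wedge B i (k - i) (\<omega> i) (\<theta> (k - i)))),
     one = (\<lambda>q. if q = 0 then (\<lambda>Zs\<in>tuples B 0. \<lambda>x\<in>points (base B). 1) else form_zero B q),
     zero = form_zero B,
     add = (\<lambda>\<omega> \<theta> q. \<lambda>Zs\<in>tuples B q. \<lambda>x\<in>points (base B). \<omega> q Zs x + \<theta> q Zs x)\<rparr>"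

definition homogeneous :: "('e, 'b) vbundle \<Rightarrow> nat \<Rightarrow> ('e, 'b) form \<Rightarrow> nat \<Rightarrow> ('e, 'b) form" where
  "homogeneous B q \<omega> = (\<lambda>k. if k = q then \<omega> else form_zero B k)"

text \<open>
  The exterior differential of a \<open>q\<close>-form with respect to an anchor \<open>a\<close> and a bracket \<open>br\<close> on the
  sections of \<open>B\<close>.
\<close>

definition ext_diff ::
  "('e, 'b) vbundle \<Rightarrow> (('b \<Rightarrow> 'e) \<Rightarrow> 'b \<Rightarrow> 'b \<times> 'b deriv) \<Rightarrow>
   (('b \<Rightarrow> 'e) \<Rightarrow> ('b \<Rightarrow> 'e) \<Rightarrow> 'b \<Rightarrow> 'e) \<Rightarrow> nat \<Rightarrow> ('e, 'b) form \<Rightarrow> ('e, 'b) form" where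
  "ext_diff B a br q \<omega> = (\<lambda>Zs\<in>tuples B (Suc q). \<lambda>x\<in>points (base B).
     (\<Sum>i\<le>q. (-1) ^ i * vf_apply (base B) (a (Zs ! i)) (\<omega> (nths Zs (- {i}))) x) +
     (\<Sum>j\<le>q. \<Sum>i<j. (-1) ^ (i + j) * \<omega> (br (Zs ! i) (Zs ! j) # nths Zs (- {i, j})) x))"


section \<open>Interior differential systems\<close>

definition interior_differential_system ::
  "'m manifold \<Rightarrow> ('m \<Rightarrow> 'n) \<Rightarrow> ('f, 'n) vbundle \<Rightarrow> nat \<Rightarrow> ('m \<times> 'f) set \<Rightarrow> bool" where
  "interior_differential_system M h F r E \<longleftrightarrow> subbundle (pullback_bundle M h F) r E"

definition annihilator_sections :: "('e, 'b) vbundle \<Rightarrow> 'e set \<Rightarrow> ('e, 'b) form set" where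
  "annihilator_sections B E =
     {\<Omega> \<in> forms B 1. \<forall>S\<in>sections_in B E. \<Omega> [S] = (\<lambda>x\<in>points (base B). 0)}"

definition module_basis ::
  "('e, 'b) vbundle \<Rightarrow> nat \<Rightarrow> ('e, 'b) form set \<Rightarrow> 'i set \<Rightarrow> ('i \<Rightarrow> ('e, 'b) form) \<Rightarrow> bool" where
  "module_basis B q S I \<Theta> \<longleftrightarrow>
     (\<forall>\<alpha>\<in>I. \<Theta> \<alpha> \<in> S) \<and>
     (\<forall>\<omega>\<in>S. \<exists>c. (\<forall>\<alpha>\<in>I. c \<alpha> \<in> smooth_functions (base B)) \<and>
        \<omega> = form_sum B q I (\<lambda>\<alpha>. form_scale B q (c \<alpha>) (\<Theta> \<alpha>))) \<and>
     (\<forall>c. (\<forall>\<alpha>\<in>I. c \<alpha> \<in> smooth_functions (base B)) \<longrightarrow>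
        form_sum B q I (\<lambda>\<alpha>. form_scale B q (c \<alpha>) (\<Theta> \<alpha>)) = form_zero B q \<longrightarrow>
        (\<forall>\<alpha>\<in>I. c \<alpha> = (\<lambda>x\<in>points (base B). 0)))"

definition involutive ::
  "('e, 'b) vbundle \<Rightarrow> (('b \<Rightarrow> 'e) \<Rightarrow> ('b \<Rightarrow> 'e) \<Rightarrow> 'b \<Rightarrow> 'e) \<Rightarrow> 'e set \<Rightarrow> bool" where
  "involutive B br E \<longleftrightarrow>
     (\<forall>S\<in>sections_in B E. \<forall>T\<in>sections_in B E. br S T \<in> sections_in B E)"

end

theory Submission
  imports Defs "Jordan_Normal_Form.Determinant"
begin

text \<open>
  Write \<open>d\<Theta>(Z, W) = Z(\<Theta> W) - W(\<Theta> Z) - \<Theta>[Z, W]\<close>.  On sections of \<open>E\<close> it reduces to \<open>- \<Theta>[Z, W]\<close>,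
  and a section lies in \<open>E\<close> iff all \<open>\<Theta>\<^sub>\<alpha>\<close> vanish on it (bump functions extend local coframes of the
  annihilator to global ones).  This gives the direction from the structure equations to
  involutivity.  Conversely, near every point there are sections \<open>S\<^sub>\<beta>\<close> with \<open>\<Theta>\<^sub>\<alpha>(S\<^sub>\<beta>) = \<delta>\<^sub>\<alpha>\<^sub>\<beta>\<close>, and
  \<open>Z - \<Sum>\<^sub>\<beta> \<Theta>\<^sub>\<beta>(Z) S\<^sub>\<beta>\<close> lies in \<open>E\<close>.  Expanding \<open>d\<Theta>\<^sub>\<alpha> = 0\<close> on such sections shows that
  \<open>\<Omega>\<^sub>\<alpha>\<^sub>\<beta>(Z) = d\<Theta>\<^sub>\<alpha>(Z, S\<^sub>\<beta>) - 1/2 \<Sum>\<^sub>\<gamma> \<Theta>\<^sub>\<gamma>(Z) d\<Theta>\<^sub>\<alpha>(S\<^sub>\<gamma>, S\<^sub>\<beta>)\<close> solves the equations locally; the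
  equations are affine in \<open>\<Omega>\<close>, so a partition of unity glues the local solutions.

  The expansion needs \<open>d\<Theta>\<close> to be bilinear over functions.  This is not immediate, because the
  anchor evaluates a section at a displaced point; it follows from the Leibniz rule and
  skew symmetry, which force the anchor to vanish wherever the displacement is nontrivial.
\<close>

section \<open>Calculus of functions of class \<open>C^k\<close>\<close>

text \<open>Involutivity speaks of global sections, whereas the sections
  \<open>S\<^sub>\<beta>\<close> are dual to the forms only near one point. The projection of
  \<open>Z\<close> along them is therefore multiplied by a bump function. This does not disturb the
  computation at the point of interest, because every term there is evaluated through a functional
  that is linear over functions and so sees only the value 1 of the bump. The factor 1/2 has its
  origin in skew symmetry: expanding d\<Theta>(Z, W) produces the double sum of \<Theta>_\<beta>(Z)
  \<Theta>_\<gamma>(W) d\<Theta>(S_\<beta>, S_\<gamma>) once, whereas a correction placed inside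
  \<Omega> is counted twice by the wedge product. Pulling back along \<open>h\<close> and its
  inverse composes smooth functions with smooth maps. As C^k is defined by separate partial
  derivatives, the chain rule for this has to be won from their continuity. Positive rank is assumed
  wherever the anchor is studied, since facts about it are extracted from a section with one
  component equal to 1.\<close>

lemma openin_Euclidean_space_iff:
  "openin (Euclidean_space n) S \<longleftrightarrow> (\<exists>T. open T \<and> S = T \<inter> topspace (Euclidean_space n))"
  by (auto simp: Euclidean_space_def openin_subtopology euclidean_product_topology)

lemma continuous_on_upd: "continuous_on S (\<lambda>t. (x :: nat \<Rightarrow> real)(i := t))"
proof (rule continuous_on_coordinatewise_then_product)
  show "continuous_on S (\<lambda>t. (x(i := t)) j)" for j by (cases "j = i") auto
qed

text \<open>The condition \<open>i < n\<close> keeps \<open>x(i := t)\<close> in R^n, where all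
  coordinates from index \<open>n\<close> on are 0. Partial derivatives at points of an open
  \<open>S\<close> thus depend only on the values on \<open>S\<close>.\<close>

lemma eventually_upd_in:
  assumes "openin (Euclidean_space n) S" "x \<in> S" "i < n"
  shows "eventually (\<lambda>t. x(i := t) \<in> S) (nhds (x i))"
proof -
  obtain T where T: "open T" "S = T \<inter> topspace (Euclidean_space n)"
    using assms(1) openin_Euclidean_space_iff by auto
  have "open ((\<lambda>t. x(i := t)) -` T)"
    using continuous_on_upd[of UNIV x i] T(1) by (simp add: continuous_on_open_vimage)
  moreover have "x i \<in> (\<lambda>t. x(i := t)) -` T" using assms(2) T by simp
  ultimately have "eventually (\<lambda>t. t \<in> (\<lambda>t. x(i := t)) -` T) (nhds (x i))"
    using eventually_nhds by blast
  then show ?thesis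
    by (rule eventually_mono) (use assms(2,3) T(2) in \<open>auto simp: topspace_Euclidean_space\<close>)
qed

section \<open>Functions of class C^k: locality and algebra\<close>

lemma Ck_on_continuous: "Ck_on k n S f \<Longrightarrow> continuous_on S f"
  by (cases k) auto

text \<open>Collects the partial derivatives in one family \<open>g\<close>, so that the choice
  hidden in the existential quantifier of \<open>Ck_on (Suc k)\<close> is made once, in
  \<open>Ck_on_Suc_partials\<close>.\<close>

definition Ck_partials ::
  "nat \<Rightarrow> nat \<Rightarrow> (nat \<Rightarrow> real) set \<Rightarrow> ((nat \<Rightarrow> real) \<Rightarrow> real) \<Rightarrow> (nat \<Rightarrow> (nat \<Rightarrow> real) \<Rightarrow> real) \<Rightarrow> bool" where
  "Ck_partials k n S f g \<longleftrightarrow> continuous_on S f \<and>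
     (\<forall>i<n. \<forall>x\<in>S. ((\<lambda>t. f (x(i := t))) has_real_derivative g i x) (at (x i))) \<and> (\<forall>i<n. Ck_on k n S (g i))"

lemma Ck_partialsD:
  assumes "Ck_partials k n S f g"
  shows "continuous_on S f"
    and "\<And>i x. i < n \<Longrightarrow> x \<in> S \<Longrightarrow> ((\<lambda>t. f (x(i := t))) has_real_derivative g i x) (at (x i))"
    and "\<And>i. i < n \<Longrightarrow> Ck_on k n S (g i)"
  using assms unfolding Ck_partials_def by blast+

lemma Ck_on_SucI:
  assumes "continuous_on S f"
    and "\<And>i x. i < n \<Longrightarrow> x \<in> S \<Longrightarrow> ((\<lambda>t. f (x(i := t))) has_real_derivative g i x) (at (x i))"
    and "\<And>i. i < n \<Longrightarrow> Ck_on k n S (g i)"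
  shows "Ck_on (Suc k) n S f"
  using assms by auto

lemma Ck_on_Suc_partials:
  assumes "Ck_on (Suc k) n S f"
  obtains g where "Ck_partials k n S f g"
proof -
  have "\<forall>i. \<exists>g. i < n \<longrightarrow> (\<forall>x\<in>S. ((\<lambda>t. f (x(i := t))) has_real_derivative g x) (at (x i))) \<and> Ck_on k n S g"
    using assms by auto
  then obtain g where "\<forall>i. i < n \<longrightarrow> (\<forall>x\<in>S. ((\<lambda>t. f (x(i := t))) has_real_derivative g i x) (at (x i))) \<and> Ck_on k n S (g i)"
    by metis
  then show thesis using that[of g] assms by (simp add: Ck_partials_def)
qed

lemma Ck_on_subset: "Ck_on k n S f \<Longrightarrow> T \<subseteq> S \<Longrightarrow> Ck_on k n T f"
proof (induction k arbitrary: f)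
  case 0
  then show ?case by (auto intro: continuous_on_subset)
next
  case (Suc k)
  obtain g where "Ck_partials k n S f g" by (rule Ck_on_Suc_partials[OF Suc.prems(1)])
  note g = Ck_partialsD[OF this]
  show ?case
    by (rule Ck_on_SucI[OF continuous_on_subset[OF g(1) Suc.prems(2)] g(2)[OF _ subsetD[OF Suc.prems(2)]]
          Suc.IH[OF g(3) Suc.prems(2)]])
qed

lemma Ck_on_lower: "Ck_on (Suc k) n S f \<Longrightarrow> Ck_on k n S f"
proof (induction k arbitrary: f)
  case (Suc k)
  obtain g where "Ck_partials (Suc k) n S f g" by (rule Ck_on_Suc_partials[OF Suc.prems(1)])
  note g = Ck_partialsD[OF this]
  show ?case
    by (rule Ck_on_SucI[OF g(1,2) Suc.IH[OF g(3)]])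
qed auto

lemma Ck_on_cong:
  assumes "openin (Euclidean_space n) S" "\<And>x. x \<in> S \<Longrightarrow> f x = g x" "Ck_on k n S f"
  shows "Ck_on k n S g"
proof (cases k)
  case 0
  then show ?thesis using assms(2,3) by (auto cong: continuous_on_cong)
next
  case (Suc l)
  obtain d where "Ck_partials l n S f d" by (rule Ck_on_Suc_partials[OF assms(3)[unfolded Suc]])
  note d = Ck_partialsD[OF this]
  show ?thesis unfolding Suc
  proof (rule Ck_on_SucI[where g = d])
    show "continuous_on S g" using d(1) assms(2) by (auto cong: continuous_on_cong)
    fix i x assume ix: "i < n" "x \<in> S"
    have "eventually (\<lambda>t. f (x(i := t)) = g (x(i := t))) (nhds (x i))"
      using eventually_upd_in[OF assms(1) ix(2,1)] by (rule eventually_mono) (rule assms(2))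
    from DERIV_cong_ev[OF refl this refl] show "((\<lambda>t. g (x(i := t))) has_real_derivative d i x) (at (x i))"
      using d(2)[OF ix] by blast
  qed (rule d(3))
qed

lemma continuous_on_local:
  assumes "\<And>x. x \<in> S \<Longrightarrow> \<exists>T. openin (Euclidean_space n) T \<and> x \<in> T \<and> continuous_on T f"
    and "openin (Euclidean_space n) S"
  shows "continuous_on S (f :: _ \<Rightarrow> real)"
  unfolding continuous_on_eq_continuous_within
proof
  fix x assume x: "x \<in> S"
  then obtain T where T: "openin (Euclidean_space n) T" "x \<in> T" "continuous_on T f" using assms by blast
  then obtain T' where T': "open T'" "T = T' \<inter> topspace (Euclidean_space n)"
    using openin_Euclidean_space_iff by blast
  have "S \<subseteq> topspace (Euclidean_space n)" using assms(2) openin_subset by blast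
  then have "at x within S = at x within (S \<inter> T)"
    using T T' by (intro at_within_nhd[of x T']) auto
  moreover have "continuous (at x within T) f" using T continuous_on_eq_continuous_within by blast
  ultimately show "continuous (at x within S) f"
    unfolding continuous_within by (metis Int_lower2 tendsto_within_subset)
qed

lemma Ck_on_local:
  assumes "openin (Euclidean_space n) S"
    and "\<And>x. x \<in> S \<Longrightarrow> \<exists>T. openin (Euclidean_space n) T \<and> x \<in> T \<and> Ck_on k n T f"
  shows "Ck_on k n S f"
  using assms(2)
proof (induction k arbitrary: f)
  case 0
  then show ?case using continuous_on_local[OF _ assms(1)] by simp
next
  case (Suc k)
  \<comment> \<open>Each neighbourhood comes with its own choice of partial derivatives. Uniqueness
    of derivatives identifies all of them with \<open>deriv\<close>, so they can be patched
    together.\<close>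
  define d where "d i x = deriv (\<lambda>t. f (x(i := t))) (x i)" for i x
  have loc: "\<exists>T. openin (Euclidean_space n) T \<and> x \<in> T \<and> continuous_on T f \<and>
     (\<forall>i<n. \<forall>x\<in>T. ((\<lambda>t. f (x(i := t))) has_real_derivative d i x) (at (x i))) \<and> (\<forall>i<n. Ck_on k n T (d i))"
    if x: "x \<in> S" for x
  proof -
    obtain T where T: "openin (Euclidean_space n) T" "x \<in> T" "Ck_on (Suc k) n T f" using Suc.prems x by blast
    obtain g where "Ck_partials k n T f g" by (rule Ck_on_Suc_partials[OF T(3)])
    note g = Ck_partialsD[OF this]
    have eq: "g i x = d i x" if "i < n" "x \<in> T" for i x
      using DERIV_imp_deriv[OF g(2)[OF that]] by (simp add: d_def)
    show ?thesis
    proof (intro exI[of _ T] conjI allI impI ballI)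
      fix i assume "i < n"
      then show "Ck_on k n T (d i)"
        using Ck_on_cong[OF T(1) eq g(3)] by blast
    qed (use T g eq in auto)
  qed
  show ?case
  proof (rule Ck_on_SucI[where g = d])
    show "continuous_on S f" by (rule continuous_on_local[OF _ assms(1)]) (meson loc)
    fix i assume i: "i < n"
    show "Ck_on k n S (d i)" by (rule Suc.IH) (meson loc i)
    fix x assume x: "x \<in> S"
    show "((\<lambda>t. f (x(i := t))) has_real_derivative d i x) (at (x i))" using loc[OF x] i x by auto
  qed
qed

lemma Ck_on_const: "Ck_on k n S (\<lambda>x. c)"
proof (induction k arbitrary: c)
  case (Suc k)
  show ?case by (rule Ck_on_SucI[where g = "\<lambda>i x. 0"]) (auto intro: Suc)
qed auto

lemma Ck_on_add: "Ck_on k n S f \<Longrightarrow> Ck_on k n S g \<Longrightarrow> Ck_on k n S (\<lambda>x. f x + g x)"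
proof (induction k arbitrary: f g)
  case (Suc k)
  obtain a where "Ck_partials k n S f a" by (rule Ck_on_Suc_partials[OF Suc.prems(1)])
  note a = Ck_partialsD[OF this]
  obtain b where "Ck_partials k n S g b" by (rule Ck_on_Suc_partials[OF Suc.prems(2)])
  note b = Ck_partialsD[OF this]
  show ?case
    by (intro Ck_on_SucI[where g = "\<lambda>i x. a i x + b i x"] Suc.IH continuous_intros a b DERIV_add)
qed (auto intro: continuous_intros)

lemma Ck_on_mult: "Ck_on k n S f \<Longrightarrow> Ck_on k n S g \<Longrightarrow> Ck_on k n S (\<lambda>x. f x * g x)"
proof (induction k arbitrary: f g)
  case (Suc k)
  obtain a where "Ck_partials k n S f a" by (rule Ck_on_Suc_partials[OF Suc.prems(1)])
  note a = Ck_partialsD[OF this]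
  obtain b where "Ck_partials k n S g b" by (rule Ck_on_Suc_partials[OF Suc.prems(2)])
  note b = Ck_partialsD[OF this]
  show ?case
  proof (rule Ck_on_SucI[where g = "\<lambda>i x. a i x * g x + b i x * f x"])
    fix i x assume ix: "i < n" "x \<in> S"
    show "((\<lambda>t. f (x(i := t)) * g (x(i := t))) has_real_derivative a i x * g x + b i x * f x) (at (x i))"
      using DERIV_mult[OF a(2)[OF ix] b(2)[OF ix]] by simp
  qed (auto intro!: continuous_intros a b Ck_on_add Suc.IH Ck_on_lower[OF Suc.prems(1)] Ck_on_lower[OF Suc.prems(2)])
qed (auto intro: continuous_intros)

lemma Ck_on_sum: "(\<And>i. i \<in> I \<Longrightarrow> Ck_on k n S (f i)) \<Longrightarrow> Ck_on k n S (\<lambda>x. \<Sum>i\<in>I. f i x)"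
  by (induction I rule: infinite_finite_induct) (auto intro: Ck_on_const Ck_on_add)

lemma Ck_on_inverse:
  "Ck_on k n S f \<Longrightarrow> (\<And>x. x \<in> S \<Longrightarrow> f x \<noteq> 0) \<Longrightarrow> Ck_on k n S (\<lambda>x. inverse (f x))"
proof (induction k arbitrary: f)
  case (Suc k)
  obtain a where "Ck_partials k n S f a" by (rule Ck_on_Suc_partials[OF Suc.prems(1)])
  note a = Ck_partialsD[OF this]
  show ?case
  proof (rule Ck_on_SucI[where g = "\<lambda>i x. (-1) * (inverse (f x) * (a i x * inverse (f x)))"])
    fix i x assume ix: "i < n" "x \<in> S"
    show "((\<lambda>t. inverse (f (x(i := t)))) has_real_derivative (-1) * (inverse (f x) * (a i x * inverse (f x)))) (at (x i))"
      using DERIV_inverse'[OF a(2)[OF ix]] Suc.prems(2)[OF ix(2)] by (simp add: mult.assoc)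
  next
    fix i assume i: "i < n"
    show "Ck_on k n S (\<lambda>x. (-1) * (inverse (f x) * (a i x * inverse (f x))))"
      by (intro Ck_on_mult Ck_on_const Suc.IH Ck_on_lower[OF Suc.prems(1)] a(3) i Suc.prems(2))
  qed (use a(1) Suc.prems(2) in \<open>auto intro!: continuous_intros\<close>)
qed (auto intro!: continuous_intros)

section \<open>The chain rule in several variables\<close>

lemma Euclidean_box:
  assumes "openin (Euclidean_space n) S" "y \<in> S"
  obtains e where "e > 0" "\<And>z. (\<And>i. i < n \<Longrightarrow> \<bar>z i - y i\<bar> < e) \<Longrightarrow> z \<in> topspace (Euclidean_space n) \<Longrightarrow> z \<in> S"
proof -
  obtain T where T: "open T" "S = T \<inter> topspace (Euclidean_space n)"
    using assms(1) openin_Euclidean_space_iff by blast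
  have "openin (powertop_real UNIV) T" "y \<in> T" using T assms(2) by (auto simp: euclidean_product_topology)
  then obtain X where X: "y \<in> (\<Pi>\<^sub>E i\<in>UNIV. X i)" "\<And>i. open (X i)" "finite {i. X i \<noteq> UNIV}" "(\<Pi>\<^sub>E i\<in>UNIV. X i) \<subseteq> T"
    using product_topology_open_contains_basis[of "\<lambda>i. euclidean" UNIV T] by (simp, meson)
  have "\<exists>e>0. \<forall>t. \<bar>t - y i\<bar> < e \<longrightarrow> t \<in> X i" for i
  proof -
    have "y i \<in> X i" using X(1) by auto
    then obtain e where "e > 0" "\<And>t. dist t (y i) < e \<Longrightarrow> t \<in> X i"
      using X(2)[of i] unfolding open_dist by blast
    then show ?thesis by (auto simp: dist_real_def)
  qed
  then obtain e where e: "\<And>i. e i > 0" "\<And>i t. \<bar>t - y i\<bar> < e i \<Longrightarrow> t \<in> X i" by metis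
  \<comment> \<open>The element 1 keeps the set nonempty when \<open>n = 0\<close>.\<close>
  define d where "d = Min (insert 1 (e ` {..<n}))"
  show thesis
  proof
    show "d > 0" using e by (auto simp: d_def)
    fix z assume z: "\<And>i. i < n \<Longrightarrow> \<bar>z i - y i\<bar> < d" "z \<in> topspace (Euclidean_space n)"
    have "z i \<in> X i" for i
    proof (cases "i < n")
      case True
      then have "d \<le> e i" by (simp add: d_def)
      then show ?thesis using e(2) z(1)[OF True] by fastforce
    next
      case False
      then show ?thesis using z(2) T(2) assms(2) e(1)[of i] e(2)[of "z i" i] by (auto simp: topspace_Euclidean_space)
    qed
    then show "z \<in> S" using X(4) T(2) z(2) by (auto simp: PiE_def extensional_def)
  qed
qed

text \<open>The increment of \<open>f\<close> along \<open>F\<close> is split into increments in one coordinate each, to which the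
  mean value theorem applies.\<close>

lemma DERIV_chain_coordinates:
  fixes F :: "real \<Rightarrow> nat \<Rightarrow> real"
  assumes T: "openin (Euclidean_space m) T" "F t0 \<in> T"
    and F: "\<And>t i. m \<le> i \<Longrightarrow> F t i = 0"
    and dF: "\<And>i. i < m \<Longrightarrow> ((\<lambda>t. F t i) has_real_derivative d i) (at t0)"
    and df: "\<And>i x. i < m \<Longrightarrow> x \<in> T \<Longrightarrow> ((\<lambda>t. f (x(i := t))) has_real_derivative g i x) (at (x i))"
    and cg: "\<And>i. i < m \<Longrightarrow> continuous_on T (g i)"
  shows "((\<lambda>t. f (F t)) has_real_derivative (\<Sum>i<m. g i (F t0) * d i)) (at t0)"
proof -
  define y where "y = F t0"
  obtain e where e: "e > 0" "\<And>z. (\<And>i. i < m \<Longrightarrow> \<bar>z i - y i\<bar> < e) \<Longrightarrow> z \<in> topspace (Euclidean_space m) \<Longrightarrow> z \<in> T"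
    using Euclidean_box[OF T[folded y_def]] by blast
  \<comment> \<open>\<open>H j t\<close> passes from \<open>y\<close> at \<open>j = 0\<close> to
    \<open>F t\<close> at \<open>j = m\<close> and changes one coordinate per step.\<close>
  define H where "H j t = (\<lambda>i. if i < j then F t i else y i)" for j t
  have contF: "((\<lambda>t. F t i) \<longlongrightarrow> y i) (at t0)" for i
    using DERIV_isCont[OF dF[of i]] F[of i] by (cases "i < m") (auto simp: isCont_def y_def)
  have near: "eventually (\<lambda>t. \<forall>i\<in>{..<m}. \<bar>F t i - y i\<bar> < e) (at t0)"
    using contF e(1) unfolding tendsto_iff dist_real_def by (intro eventually_ball_finite) auto
  have mvt: "\<exists>s. (\<bar>s - y j\<bar> \<le> \<bar>F t j - y j\<bar>) \<and>
      f (H (Suc j) t) - f (H j t) = g j ((H j t)(j := s)) * (F t j - y j)"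
    if t: "\<forall>i\<in>{..<m}. \<bar>F t i - y i\<bar> < e" and j: "j < m" for t j
  proof -
    have inT: "(H j t)(j := s) \<in> T" if "\<bar>s - y j\<bar> \<le> \<bar>F t j - y j\<bar>" for s
      using that t j e(1) F[of _ t] F[of _ t0]
      by (intro e(2)) (force simp: H_def topspace_Euclidean_space y_def)+
    have D: "((\<lambda>t'. f ((H j t)(j := t'))) has_real_derivative g j ((H j t)(j := s))) (at s)"
      if "\<bar>s - y j\<bar> \<le> \<bar>F t j - y j\<bar>" for s
      using df[OF j inT[OF that]] by simp
    have H1: "H (Suc j) t = (H j t)(j := F t j)" and H0: "H j t = (H j t)(j := y j)"
      by (auto simp: H_def fun_eq_iff less_Suc_eq)
    consider "F t j = y j" | "F t j < y j" | "y j < F t j" by linarith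
    then show ?thesis
    proof cases
      case 1
      then show ?thesis using H0 H1 by (intro exI[of _ "y j"]) simp
    next
      case 2
      obtain s where s: "F t j < s" "s < y j"
        "f ((H j t)(j := y j)) - f ((H j t)(j := F t j)) = (y j - F t j) * g j ((H j t)(j := s))"
        using MVT2[OF 2, of "\<lambda>s. f ((H j t)(j := s))" "\<lambda>s. g j ((H j t)(j := s))"] D by auto
      then show ?thesis using H0 H1 by (intro exI[of _ s]) (auto simp: algebra_simps)
    next
      case 3
      obtain s where s: "y j < s" "s < F t j"
        "f ((H j t)(j := F t j)) - f ((H j t)(j := y j)) = (F t j - y j) * g j ((H j t)(j := s))"
        using MVT2[OF 3, of "\<lambda>s. f ((H j t)(j := s))" "\<lambda>s. g j ((H j t)(j := s))"] D by auto
      then show ?thesis using H0 H1 by (intro exI[of _ s]) (auto simp: algebra_simps)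
    qed
  qed
  \<comment> \<open>The intermediate points of the mean value theorem. The default
    \<open>y j\<close> makes the bound \<open>s1\<close> hold for every \<open>t\<close> and
    \<open>j\<close>, also where \<open>F t\<close> is too far from \<open>y\<close>.\<close>
  define s where "s j t = (if (\<forall>i\<in>{..<m}. \<bar>F t i - y i\<bar> < e) \<and> j < m
     then (SOME s. (\<bar>s - y j\<bar> \<le> \<bar>F t j - y j\<bar>) \<and>
      f (H (Suc j) t) - f (H j t) = g j ((H j t)(j := s)) * (F t j - y j)) else y j)" for j t
  have s1: "\<bar>s j t - y j\<bar> \<le> \<bar>F t j - y j\<bar>" for j t
    using someI_ex[OF mvt[of t j]] by (auto simp: s_def)
  have s2: "f (H (Suc j) t) - f (H j t) = g j ((H j t)(j := s j t)) * (F t j - y j)"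
    if "\<forall>i\<in>{..<m}. \<bar>F t i - y i\<bar> < e" "j < m" for j t
    using someI_ex[OF mvt[OF that]] that by (auto simp: s_def)
  have lims: "((\<lambda>t. s j t) \<longlongrightarrow> y j) (at t0)" for j
  proof -
    have "((\<lambda>t. F t j - y j) \<longlongrightarrow> 0) (at t0)" using tendsto_diff[OF contF[of j] tendsto_const[of "y j"]] by simp
    from tendsto_rabs_zero[OF this] have "((\<lambda>t. s j t - y j) \<longlongrightarrow> 0) (at t0)"
      by (rule Lim_null_comparison[rotated]) (simp add: s1)
    then show ?thesis by (rule LIM_zero_cancel)
  qed
  have limpt: "((\<lambda>t. (H j t)(j := s j t)) \<longlongrightarrow> y) (at t0)" for j
  proof -
    have "((\<lambda>t. ((H j t)(j := s j t)) i) \<longlongrightarrow> y i) (at t0)" for i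
      using lims[of j] contF[of i] by (cases "i = j"; cases "i < j") (auto simp: H_def)
    then have "limitin (powertop_real UNIV) (\<lambda>t. (H j t)(j := s j t)) y (at t0)"
      unfolding limitin_componentwise by simp
    then show ?thesis by (simp add: euclidean_product_topology)
  qed
  have inT: "eventually (\<lambda>t. (H j t)(j := s j t) \<in> T) (at t0)" if j: "j < m" for j
    using near
  proof (rule eventually_mono)
    fix t assume t: "\<forall>i\<in>{..<m}. \<bar>F t i - y i\<bar> < e"
    have "\<bar>s j t - y j\<bar> < e" using s1[of j t] bspec[OF t, of j] j by simp
    then show "(H j t)(j := s j t) \<in> T"
      using t j e(1) F[of _ t] F[of _ t0]
      by (intro e(2)) (force simp: H_def topspace_Euclidean_space y_def)+
  qed
  \<comment> \<open>Continuity of the partial derivatives enters here: the intermediate points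
    converge to \<open>y\<close>, hence so do the derivatives taken at them.\<close>
  have limg: "((\<lambda>t. g j ((H j t)(j := s j t))) \<longlongrightarrow> g j y) (at t0)" if j: "j < m" for j
    using continuous_on_tendsto_compose[OF cg[OF j] limpt[of j] _ inT[OF j]] T(2) y_def by simp
  have "((\<lambda>t. \<Sum>j<m. g j ((H j t)(j := s j t)) * ((F t j - F t0 j) / (t - t0))) \<longlongrightarrow> (\<Sum>j<m. g j y * d j)) (at t0)"
    using dF by (intro tendsto_sum tendsto_mult limg) (auto simp: has_field_derivative_iff)
  moreover have "eventually (\<lambda>t. (\<Sum>j<m. g j ((H j t)(j := s j t)) * ((F t j - F t0 j) / (t - t0))) = (f (F t) - f (F t0)) / (t - t0)) (at t0)"
    using near
  proof (rule eventually_mono)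
    fix t assume t: "\<forall>i\<in>{..<m}. \<bar>F t i - y i\<bar> < e"
    have "H m t = F t" "H 0 t = F t0" using F by (auto simp: H_def y_def fun_eq_iff)
    then have "f (F t) - f (F t0) = (\<Sum>j<m. f (H (Suc j) t) - f (H j t))"
      using sum_lessThan_telescope[of "\<lambda>j. f (H j t)" m] by simp
    also have "\<dots> = (\<Sum>j<m. g j ((H j t)(j := s j t)) * (F t j - F t0 j))"
      by (intro sum.cong refl) (simp add: s2[OF t] y_def)
    finally show "(\<Sum>j<m. g j ((H j t)(j := s j t)) * ((F t j - F t0 j) / (t - t0))) = (f (F t) - f (F t0)) / (t - t0)"
      by (simp add: sum_divide_distrib)
  qed
  ultimately show ?thesis
    unfolding has_field_derivative_iff y_def by (rule Lim_transform_eventually)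
qed

text \<open>The induction runs over all \<open>f\<close> with \<open>F\<close> fixed, because the
  chain rule leads to composites of the partial derivatives of \<open>f\<close> with the same
  \<open>F\<close>.\<close>

lemma Ck_on_compose:
  assumes S: "openin (Euclidean_space n) S" and T: "openin (Euclidean_space m) T"
    and F: "\<And>x. x \<in> S \<Longrightarrow> F x \<in> T"
  shows "(\<And>i. i < m \<Longrightarrow> Ck_on k n S (\<lambda>x. F x i)) \<Longrightarrow> Ck_on k m T f \<Longrightarrow> Ck_on k n S (\<lambda>x. f (F x))"
proof (induction k arbitrary: f)
  case 0
  have "continuous_on S (\<lambda>x. F x i)" for i
  proof (cases "i < m")
    case True
    then show ?thesis using 0(1) by simp
  next
    case False
    have "T \<subseteq> topspace (Euclidean_space m)" using T openin_subset by blast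
    then have "F x i = 0" if "x \<in> S" for x using F[OF that] False by (auto simp: topspace_Euclidean_space)
    then show ?thesis by (simp cong: continuous_on_cong)
  qed
  then have "continuous_on S F" by (rule continuous_on_coordinatewise_then_product)
  then show ?case using 0(2) F by (auto intro!: continuous_on_compose2[of T f])
next
  case (Suc k)
  obtain g where "Ck_partials k m T f g" by (rule Ck_on_Suc_partials[OF Suc.prems(2)])
  note g = Ck_partialsD[OF this]
  have "\<forall>j. \<exists>D. j < m \<longrightarrow> Ck_partials k n S (\<lambda>x. F x j) D"
    using Ck_on_Suc_partials[OF Suc.prems(1)] by metis
  then obtain D where "\<And>j. j < m \<Longrightarrow> Ck_partials k n S (\<lambda>x. F x j) (D j)" by metis
  note D = Ck_partialsD[OF this]
  have Tsub: "T \<subseteq> topspace (Euclidean_space m)" using T openin_subset by blast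
  have low: "\<And>i. i < m \<Longrightarrow> Ck_on k n S (\<lambda>x. F x i)" using Suc.prems(1) Ck_on_lower by blast
  show ?case
  proof (rule Ck_on_SucI[where g = "\<lambda>i x. \<Sum>j<m. g j (F x) * D j i x"])
    have "continuous_on S (\<lambda>x. F x i)" for i
    proof (cases "i < m")
      case False
      then have "F x i = 0" if "x \<in> S" for x using F[OF that] Tsub by (auto simp: topspace_Euclidean_space)
      then show ?thesis by (simp cong: continuous_on_cong)
    qed (rule D)
    then have "continuous_on S F" by (rule continuous_on_coordinatewise_then_product)
    then show "continuous_on S (\<lambda>x. f (F x))" using g(1) F by (auto intro!: continuous_on_compose2[of T f])
    fix i assume i: "i < n"
    show "Ck_on k n S (\<lambda>x. \<Sum>j<m. g j (F x) * D j i x)"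
      using i by (intro Ck_on_sum Ck_on_mult D) (auto intro!: Suc.IH low g)
    fix x assume x: "x \<in> S"
    have ev: "eventually (\<lambda>t. x(i := t) \<in> S) (nhds (x i))" using eventually_upd_in[OF S x i] .
    \<comment> \<open>\<open>DERIV_chain_coordinates\<close> wants a curve that lies in R^m for all
      \<open>t\<close>. Cutting off the coordinates from \<open>m\<close> on provides one even where
      \<open>x(i := t)\<close> leaves \<open>S\<close>.\<close>
    define F' where "F' t = (\<lambda>j. if j < m then F (x(i := t)) j else 0)" for t
    have F'eq: "F' t = F (x(i := t))" if "x(i := t) \<in> S" for t
      using F[OF that] Tsub by (auto simp: F'_def topspace_Euclidean_space fun_eq_iff)
    have F'0: "F' (x i) = F x" using F'eq[of "x i"] x by simp
    have "((\<lambda>t. f (F' t)) has_real_derivative (\<Sum>j<m. g j (F' (x i)) * D j i x)) (at (x i))"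
    proof (rule DERIV_chain_coordinates[OF T])
      show "F' (x i) \<in> T" using F'0 F x by simp
      show "((\<lambda>t. F' t j) has_real_derivative D j i x) (at (x i))" if "j < m" for j
        using D(2)[OF that i x] that by (simp add: F'_def)
      show "F' t j = 0" if "m \<le> j" for t j using that by (simp add: F'_def)
    qed (fact g(2) Ck_on_continuous[OF g(3)])+
    moreover have "eventually (\<lambda>t. f (F' t) = f (F (x(i := t)))) (nhds (x i))"
      using ev by (rule eventually_mono) (simp add: F'eq)
    ultimately show "((\<lambda>t. f (F (x(i := t)))) has_real_derivative (\<Sum>j<m. g j (F x) * D j i x)) (at (x i))"
      using DERIV_cong_ev[OF refl, of "\<lambda>t. f (F' t)" "\<lambda>t. f (F (x(i := t)))" "x i"] F'0 by auto
  qed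
qed

section \<open>Smooth cutoff functions of one variable\<close>

text \<open>\<open>flat 0\<close> is Cauchy's function exp(-1/t). The powers of 1/t are included
  because the derivative of \<open>flat m\<close> is a combination of \<open>flat (m + 2)\<close>
  and \<open>flat (Suc m)\<close>; an induction on the order of differentiability can then run over
  all \<open>m\<close>.\<close>

definition flat :: "nat \<Rightarrow> real \<Rightarrow> real" where
  "flat m t = (if t > 0 then exp (- inverse t) * inverse t ^ m else 0)"

lemma tendsto_flat_at_right: "(flat m \<longlongrightarrow> 0) (at_right 0)"
proof -
  have "((\<lambda>x::real. x ^ m / exp x) \<longlongrightarrow> 0) at_top" by (rule tendsto_power_div_exp_0)
  then have "((\<lambda>x::real. inverse x ^ m / exp (inverse x)) \<longlongrightarrow> 0) (at_right 0)"
    by (rule filterlim_compose[OF _ filterlim_inverse_at_top_right])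
  moreover have "eventually (\<lambda>x::real. inverse x ^ m / exp (inverse x) = flat m x) (at_right 0)"
    using eventually_at_right_less by (rule eventually_mono) (simp add: flat_def exp_minus field_simps)
  ultimately show ?thesis by (rule Lim_transform_eventually)
qed

lemma tendsto_flat: "(flat m \<longlongrightarrow> 0) (at 0)"
proof -
  have "(flat m \<longlongrightarrow> 0) (at_left 0)"
    by (rule Lim_transform_eventually[OF tendsto_const])
      (auto simp: flat_def eventually_at_filter intro!: always_eventually)
  then show ?thesis using tendsto_flat_at_right filterlim_split_at by blast
qed

lemma DERIV_flat: "(flat m has_real_derivative flat (m + 2) t - m * flat (Suc m) t) (at t)"
proof -
  consider "t > 0" | "t < 0" | "t = 0" by linarith
  then show ?thesis
  proof cases
    case 1
    have "((\<lambda>t. exp (- inverse t) * inverse t ^ m) has_real_derivative flat (m + 2) t - m * flat (Suc m) t) (at t)"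
      using 1 by (auto intro!: derivative_eq_intros simp: flat_def algebra_simps power2_eq_square)
        (cases m; simp add: algebra_simps)
    moreover have "eventually (\<lambda>s. exp (- inverse s) * inverse s ^ m = flat m s) (nhds t)"
      using eventually_nhds_in_open[of "{0<..}" t] 1 by (auto elim!: eventually_mono simp: flat_def)
    ultimately show ?thesis using DERIV_cong_ev[OF refl, of "\<lambda>s. exp (- inverse s) * inverse s ^ m" "flat m" t] by metis
  next
    case 2
    have "eventually (\<lambda>s. 0 = flat m s) (nhds t)"
      using eventually_nhds_in_open[of "{..<0}" t] 2 by (auto elim!: eventually_mono simp: flat_def)
    then have "(flat m has_real_derivative 0) (at t)"
      using DERIV_cong_ev[OF refl, of "\<lambda>s. 0" "flat m" t] by (metis DERIV_const)
    then show ?thesis using 2 by (simp add: flat_def)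
  next
    case 3
    \<comment> \<open>The difference quotient at 0 is \<open>flat (Suc m)\<close>, which tends to
      0.\<close>
    have "(flat m has_real_derivative 0) (at 0)"
      unfolding has_field_derivative_iff
    proof (rule Lim_transform_eventually[OF tendsto_flat[of "Suc m"]])
      show "eventually (\<lambda>s. flat (Suc m) s = (flat m s - flat m 0) / (s - 0)) (at 0)"
        by (auto simp: flat_def field_simps intro!: always_eventually)
    qed
    then show ?thesis using 3 by (simp add: flat_def)
  qed
qed

lemma Ck_on_flat: "Ck_on k n S u \<Longrightarrow> Ck_on k n S (\<lambda>x. flat m (u x))"
proof (induction k arbitrary: m)
  case 0
  have "continuous_on UNIV (flat m)" by (meson DERIV_flat DERIV_isCont continuous_at_imp_continuous_on)
  then show ?case using 0 by (auto intro: continuous_on_compose2)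
next
  case (Suc k)
  obtain a where "Ck_partials k n S u a" by (rule Ck_on_Suc_partials[OF Suc.prems(1)])
  note a = Ck_partialsD[OF this]
  note low = Ck_on_lower[OF Suc.prems]
  show ?case
  proof (rule Ck_on_SucI[where g = "\<lambda>i x. (flat (m + 2) (u x) + (- real m) * flat (Suc m) (u x)) * a i x"])
    have "continuous_on UNIV (flat m)" by (meson DERIV_flat DERIV_isCont continuous_at_imp_continuous_on)
    then show "continuous_on S (\<lambda>x. flat m (u x))" using a(1) by (auto intro: continuous_on_compose2)
    fix i x assume ix: "i < n" "x \<in> S"
    show "((\<lambda>t. flat m (u (x(i := t)))) has_real_derivative
       (flat (m + 2) (u x) + (- real m) * flat (Suc m) (u x)) * a i x) (at (x i))"
      using DERIV_chain2[OF DERIV_flat a(2)[OF ix], of m] by simp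
  next
    fix i assume "i < n"
    then show "Ck_on k n S (\<lambda>x. (flat (m + 2) (u x) + (- real m) * flat (Suc m) (u x)) * a i x)"
      by (intro Ck_on_mult Ck_on_add Ck_on_const Suc.IH low a)
  qed
qed

text \<open>A smooth descent from 1 on \<open>s \<le> d / 4\<close> to 0 on
  \<open>s \<ge> d\<close>. For \<open>d > 0\<close> one of \<open>d - s\<close> and
  \<open>s - d / 4\<close> is always positive, so the denominator does not vanish. The quarter fits
  squared distances: \<open>d = a^2\<close> gives the radii \<open>a / 2\<close> and
  \<open>a\<close>.\<close>

definition step :: "real \<Rightarrow> real \<Rightarrow> real" where
  "step d s = flat 0 (d - s) * inverse (flat 0 (d - s) + flat 0 (s - d / 4))"

lemma step_denominator_pos: "d > 0 \<Longrightarrow> flat 0 (d - s) + flat 0 (s - d / 4) > 0"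
  by (auto simp: flat_def add_pos_pos)

lemma step_eq_1: "d > 0 \<Longrightarrow> s \<le> d / 4 \<Longrightarrow> step d s = 1"
  using step_denominator_pos[of d s] by (simp add: step_def flat_def)

lemma step_eq_0: "d \<le> s \<Longrightarrow> step d s = 0"
  by (simp add: step_def flat_def)

lemma Ck_on_step:
  assumes "d > 0" "Ck_on k n S u"
  shows "Ck_on k n S (\<lambda>x. step d (u x))"
proof -
  have 1: "Ck_on k n S (\<lambda>x. flat 0 (d - u x))"
    using Ck_on_flat[OF Ck_on_add[OF Ck_on_const[of _ _ _ d] Ck_on_mult[OF Ck_on_const[of _ _ _ "-1"] assms(2)]]] by simp
  have 2: "Ck_on k n S (\<lambda>x. flat 0 (u x - d / 4))"
    using Ck_on_flat[OF Ck_on_add[OF Ck_on_const[of _ _ _ "- d / 4"] assms(2)]] by (simp add: algebra_simps)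
  show ?thesis unfolding step_def
    using step_denominator_pos[OF assms(1)]
    by (intro Ck_on_mult Ck_on_inverse Ck_on_add 1 2) (metis less_irrefl)
qed

section \<open>Smooth functions on manifolds\<close>

lemma Csmooth_on_cong:
  "openin (Euclidean_space n) S \<Longrightarrow> (\<And>x. x \<in> S \<Longrightarrow> f x = g x) \<Longrightarrow> Csmooth_on n S f \<Longrightarrow> Csmooth_on n S g"
  unfolding Csmooth_on_def using Ck_on_cong by blast

lemma Csmooth_on_subset: "Csmooth_on n S f \<Longrightarrow> T \<subseteq> S \<Longrightarrow> Csmooth_on n T f"
  unfolding Csmooth_on_def using Ck_on_subset by blast

lemma Csmooth_on_continuous: "Csmooth_on n S f \<Longrightarrow> continuous_on S f"
  unfolding Csmooth_on_def using Ck_on_continuous by blast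

lemma Csmooth_on_local:
  "openin (Euclidean_space n) S \<Longrightarrow>
   (\<And>x. x \<in> S \<Longrightarrow> \<exists>T. openin (Euclidean_space n) T \<and> x \<in> T \<and> Csmooth_on n T f) \<Longrightarrow> Csmooth_on n S f"
  unfolding Csmooth_on_def using Ck_on_local[of n S] by meson

lemma Csmooth_on_const: "Csmooth_on n S (\<lambda>x. c)"
  by (simp add: Csmooth_on_def Ck_on_const)

lemma Csmooth_on_add: "Csmooth_on n S f \<Longrightarrow> Csmooth_on n S g \<Longrightarrow> Csmooth_on n S (\<lambda>x. f x + g x)"
  by (simp add: Csmooth_on_def Ck_on_add)

lemma Csmooth_on_mult: "Csmooth_on n S f \<Longrightarrow> Csmooth_on n S g \<Longrightarrow> Csmooth_on n S (\<lambda>x. f x * g x)"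
  by (simp add: Csmooth_on_def Ck_on_mult)

lemma Csmooth_on_sum: "(\<And>i. i \<in> I \<Longrightarrow> Csmooth_on n S (f i)) \<Longrightarrow> Csmooth_on n S (\<lambda>x. \<Sum>i\<in>I. f i x)"
  by (simp add: Csmooth_on_def Ck_on_sum)

lemma Csmooth_on_step: "d > 0 \<Longrightarrow> Csmooth_on n S u \<Longrightarrow> Csmooth_on n S (\<lambda>x. step d (u x))"
  by (simp add: Csmooth_on_def Ck_on_step)

lemma Csmooth_on_compose:
  assumes "openin (Euclidean_space n) S" "openin (Euclidean_space m) T"
    "\<And>x. x \<in> S \<Longrightarrow> F x \<in> T" "\<And>i. i < m \<Longrightarrow> Csmooth_on n S (\<lambda>x. F x i)" "Csmooth_on m T f"
  shows "Csmooth_on n S (\<lambda>x. f (F x))"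
  using assms Ck_on_compose[of n S m T F] unfolding Csmooth_on_def by blast

lemma openin_Euclidean_preimage:
  assumes S: "openin (Euclidean_space n) S" and F: "\<And>x. x \<in> S \<Longrightarrow> F x \<in> topspace (Euclidean_space m)"
    and c: "\<And>i. i < m \<Longrightarrow> continuous_on S (\<lambda>x. F x i)" and T: "openin (Euclidean_space m) T"
  shows "openin (Euclidean_space n) {x \<in> S. F x \<in> T}"
proof -
  have "continuous_on S (\<lambda>x. F x i)" for i
  proof (cases "i < m")
    case False
    then have "F x i = 0" if "x \<in> S" for x using F[OF that] by (auto simp: topspace_Euclidean_space)
    then show ?thesis by (simp cong: continuous_on_cong)
  qed (rule c)
  then have cF: "continuous_on S F" by (rule continuous_on_coordinatewise_then_product)
  obtain T' where T': "open T'" "T = T' \<inter> topspace (Euclidean_space m)" using T openin_Euclidean_space_iff by blast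
  obtain S' where S': "open S'" "S = S' \<inter> topspace (Euclidean_space n)" using S openin_Euclidean_space_iff by blast
  obtain A where A: "open A" "A \<inter> S = F -` T' \<inter> S"
    using cF T'(1) unfolding continuous_on_open_invariant by blast
  have "{x \<in> S. F x \<in> T} = (A \<inter> S') \<inter> topspace (Euclidean_space n)"
    using A(2) S'(2) T'(2) F by blast
  then show ?thesis using A(1) S'(1) openin_Euclidean_space_iff by blast
qed

text \<open>Injectivity of the charts turns images of intersections into intersections of images,
  which gives the intersection axiom. Stated under this hypothesis alone, the result also covers
  total spaces, where \<open>total_chart_inj\<close> supplies it.\<close>

lemma openin_mtop_inj:
  assumes inj: "\<And>U \<phi>. (U, \<phi>) \<in> charts M \<Longrightarrow> inj_on \<phi> U"
  shows "openin (mtop M) A \<longleftrightarrow> A \<subseteq> points M \<and>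
     (\<forall>(U, \<phi>)\<in>charts M. openin (Euclidean_space (mdim M)) (\<phi> ` (A \<inter> U)))"
proof -
  let ?P = "\<lambda>A. A \<subseteq> points M \<and> (\<forall>(U, \<phi>)\<in>charts M. openin (Euclidean_space (mdim M)) (\<phi> ` (A \<inter> U)))"
  have "istopology ?P"
    unfolding istopology_def
  proof (rule conjI, intro allI impI)
    fix A B assume AB: "?P A" "?P B"
    have "openin (Euclidean_space (mdim M)) (\<phi> ` (A \<inter> B \<inter> U))" if c: "(U, \<phi>) \<in> charts M" for U \<phi>
    proof -
      have "\<phi> ` (A \<inter> B \<inter> U) = \<phi> ` (A \<inter> U) \<inter> \<phi> ` (B \<inter> U)"
        using inj[OF c] unfolding inj_on_def by blast
      then show ?thesis using AB c by (auto intro: openin_Int)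
    qed
    moreover have "A \<inter> B \<subseteq> points M" using AB(1) by blast
    ultimately show "?P (A \<inter> B)" by blast
  next
    show "\<forall>\<K>. (\<forall>K\<in>\<K>. ?P K) \<longrightarrow> ?P (\<Union>\<K>)"
    proof (intro allI impI)
    fix \<K> assume K: "\<forall>K\<in>\<K>. ?P K"
    have "\<phi> ` (\<Union>\<K> \<inter> U) = (\<Union>K\<in>\<K>. \<phi> ` (K \<inter> U))" for \<phi> :: "'a \<Rightarrow> nat \<Rightarrow> real" and U by blast
    then show "?P (\<Union>\<K>)" using K by (auto intro!: openin_Union)
    qed
  qed
  then show ?thesis by (simp add: mtop_def topology_inverse')
qed

lemma openin_mtop:
  assumes "smooth_manifold M"
  shows "openin (mtop M) A \<longleftrightarrow> A \<subseteq> points M \<and>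
     (\<forall>(U, \<phi>)\<in>charts M. openin (Euclidean_space (mdim M)) (\<phi> ` (A \<inter> U)))"
  by (rule openin_mtop_inj) (use assms in \<open>auto simp: smooth_manifold_def\<close>)

lemma smooth_mapD:
  "smooth_map M N f \<Longrightarrow> (U, \<phi>) \<in> charts M \<Longrightarrow> (V, \<psi>) \<in> charts N \<Longrightarrow> i < mdim N \<Longrightarrow>
   Csmooth_on (mdim M) (\<phi> ` {x \<in> U. f x \<in> V}) (\<lambda>x. \<psi> (f (inv_into U \<phi> x)) i)"
  unfolding smooth_map_def by blast

lemma smooth_fun_onI:
  "(\<And>U \<phi>. (U, \<phi>) \<in> charts M \<Longrightarrow> Csmooth_on (mdim M) (\<phi> ` (A \<inter> U)) (\<lambda>x. f (inv_into U \<phi> x))) \<Longrightarrow> smooth_fun_on M A f"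
  unfolding smooth_fun_on_def by blast

lemma smooth_fun_onD:
  "smooth_fun_on M A f \<Longrightarrow> (U, \<phi>) \<in> charts M \<Longrightarrow> Csmooth_on (mdim M) (\<phi> ` (A \<inter> U)) (\<lambda>x. f (inv_into U \<phi> x))"
  unfolding smooth_fun_on_def by blast

text \<open>The open set \<open>W\<close> expresses that the support of \<psi> lies in
  \<open>V\<close>: together, \<open>V\<close> and \<open>W\<close> form an open cover of
  \<open>M\<close>, and a function cut off by \<psi> can be tested for smoothness on each of the
  two.\<close>

definition bump_on :: "'a manifold \<Rightarrow> 'a set \<Rightarrow> 'a \<Rightarrow> ('a \<Rightarrow> real) \<Rightarrow> 'a set \<Rightarrow> 'a set \<Rightarrow> bool" where
  "bump_on M V x \<psi> O' W \<longleftrightarrow> \<psi> \<in> smooth_functions M \<and> openin (mtop M) O' \<and> x \<in> O' \<and> O' \<subseteq> V \<and>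
     (\<forall>y\<in>O'. \<psi> y = 1) \<and> openin (mtop M) W \<and> V \<union> W = points M \<and> (\<forall>y\<in>W. \<psi> y = 0)"

lemma bump_onD:
  assumes "bump_on M V x \<psi> O' W"
  shows "\<psi> \<in> smooth_functions M" "openin (mtop M) O'" "x \<in> O'" "O' \<subseteq> V" "\<And>y. y \<in> O' \<Longrightarrow> \<psi> y = 1"
    "openin (mtop M) W" "V \<union> W = points M" "\<And>y. y \<in> W \<Longrightarrow> \<psi> y = 0"
  using assms unfolding bump_on_def by blast+

context
  fixes M :: "'a manifold"
  assumes M: "smooth_manifold M"
begin

lemma Hausdorff_mtop: "Hausdorff_space (mtop M)"
  using M unfolding smooth_manifold_def by (elim conjE)

lemma chart_inj: "(U, \<phi>) \<in> charts M \<Longrightarrow> inj_on \<phi> U"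
  using M unfolding smooth_manifold_def by blast

lemma chart_inv: "(U, \<phi>) \<in> charts M \<Longrightarrow> x \<in> U \<Longrightarrow> inv_into U \<phi> (\<phi> x) = x"
  using chart_inj by (simp add: inv_into_f_f)

lemma chart_subset: "(U, \<phi>) \<in> charts M \<Longrightarrow> U \<subseteq> points M"
  using M unfolding smooth_manifold_def by blast

lemma chart_cover: "x \<in> points M \<Longrightarrow> \<exists>U \<phi>. (U, \<phi>) \<in> charts M \<and> x \<in> U"
  using M unfolding smooth_manifold_def by blast

lemma chart_transition:
  assumes "(U, \<phi>) \<in> charts M" "(V, \<psi>) \<in> charts M"
  shows "openin (Euclidean_space (mdim M)) (\<phi> ` (U \<inter> V))"
    and "i < mdim M \<Longrightarrow> Csmooth_on (mdim M) (\<phi> ` (U \<inter> V)) (\<lambda>x. \<psi> (inv_into U \<phi> x) i)"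
  using M assms unfolding smooth_manifold_def by blast+

lemma chart_open: "(U, \<phi>) \<in> charts M \<Longrightarrow> openin (mtop M) U"
  using chart_subset chart_transition(1) by (fastforce simp: openin_mtop[OF M] Int_commute)

lemma chart_in_Euclidean: "(U, \<phi>) \<in> charts M \<Longrightarrow> x \<in> U \<Longrightarrow> \<phi> x \<in> topspace (Euclidean_space (mdim M))"
  using chart_transition(1)[of U \<phi> U \<phi>] openin_subset by fastforce

lemma topspace_mtop: "topspace (mtop M) = points M"
proof -
  have "points M = (\<Union>(U, \<phi>)\<in>charts M. U)" using M unfolding smooth_manifold_def by blast
  then have "openin (mtop M) (points M)" using chart_open by (auto intro!: openin_Union)
  then show ?thesis using openin_mtop[OF M] by (meson openin_subset openin_topspace subset_antisym)
qed

lemma openin_points: "openin (mtop M) (points M)"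
  using topspace_mtop openin_topspace by metis

lemma mtop_subset: "openin (mtop M) A \<Longrightarrow> A \<subseteq> points M"
  using openin_mtop[OF M] by blast

lemma openin_chart_image: "openin (mtop M) A \<Longrightarrow> (U, \<phi>) \<in> charts M \<Longrightarrow> openin (Euclidean_space (mdim M)) (\<phi> ` (A \<inter> U))"
  using openin_mtop[OF M] by blast

lemma openin_chart_preimage:
  assumes c: "(U, \<phi>) \<in> charts M" and T: "openin (Euclidean_space (mdim M)) T"
  shows "openin (mtop M) {x \<in> U. \<phi> x \<in> T}"
  unfolding openin_mtop[OF M]
proof (intro conjI ballI, use chart_subset[OF c] in blast, clarify)
  fix V \<psi> assume d: "(V, \<psi>) \<in> charts M"
  have "\<psi> ` ({x \<in> U. \<phi> x \<in> T} \<inter> V) = {z \<in> \<psi> ` (V \<inter> U). \<phi> (inv_into V \<psi> z) \<in> T}"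
    using chart_inv[OF d] by force
  also have "openin (Euclidean_space (mdim M)) \<dots>"
  proof (rule openin_Euclidean_preimage[OF _ _ _ T])
    show "openin (Euclidean_space (mdim M)) (\<psi> ` (V \<inter> U))" using chart_transition(1)[OF d c] .
    show "\<phi> (inv_into V \<psi> x) \<in> topspace (Euclidean_space (mdim M))" if "x \<in> \<psi> ` (V \<inter> U)" for x
      using that chart_inv[OF d] chart_in_Euclidean[OF c] by auto
    show "continuous_on (\<psi> ` (V \<inter> U)) (\<lambda>x. \<phi> (inv_into V \<psi> x) i)" if "i < mdim M" for i
      using chart_transition(2)[OF d c that] Csmooth_on_continuous by blast
  qed
  finally show "openin (Euclidean_space (mdim M)) (\<psi> ` ({x \<in> U. \<phi> x \<in> T} \<inter> V))" .
qed

lemma smooth_fun_on_cong: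
  assumes "openin (mtop M) A" "\<And>x. x \<in> A \<Longrightarrow> f x = g x" "smooth_fun_on M A f"
  shows "smooth_fun_on M A g"
  unfolding smooth_fun_on_def
proof clarify
  fix U \<phi> assume c: "(U, \<phi>) \<in> charts M"
  show "Csmooth_on (mdim M) (\<phi> ` (A \<inter> U)) (\<lambda>x. g (inv_into U \<phi> x))"
    by (rule Csmooth_on_cong[OF openin_chart_image[OF assms(1) c], of "\<lambda>x. f (inv_into U \<phi> x)"])
      (use assms(2,3) c chart_inv[OF c] in \<open>auto simp: smooth_fun_on_def\<close>)
qed

lemma smooth_fun_on_subset: "smooth_fun_on M A f \<Longrightarrow> B \<subseteq> A \<Longrightarrow> smooth_fun_on M B f"
  unfolding smooth_fun_on_def by (fastforce intro: Csmooth_on_subset)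

lemma smooth_fun_on_local:
  assumes "openin (mtop M) A" "\<And>x. x \<in> A \<Longrightarrow> \<exists>B. openin (mtop M) B \<and> x \<in> B \<and> smooth_fun_on M B f"
  shows "smooth_fun_on M A f"
  unfolding smooth_fun_on_def
proof clarify
  fix U \<phi> assume c: "(U, \<phi>) \<in> charts M"
  show "Csmooth_on (mdim M) (\<phi> ` (A \<inter> U)) (\<lambda>x. f (inv_into U \<phi> x))"
  proof (rule Csmooth_on_local[OF openin_chart_image[OF assms(1) c]])
    fix z assume "z \<in> \<phi> ` (A \<inter> U)"
    then obtain x where x: "x \<in> A" "x \<in> U" "z = \<phi> x" by blast
    obtain B where "openin (mtop M) B" "x \<in> B" "smooth_fun_on M B f" using assms(2)[OF x(1)] by blast
    then show "\<exists>T. openin (Euclidean_space (mdim M)) T \<and> z \<in> T \<and> Csmooth_on (mdim M) T (\<lambda>x. f (inv_into U \<phi> x))"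
      using x c openin_chart_image[OF _ c, of B] by (intro exI[of _ "\<phi> ` (B \<inter> U)"]) (auto simp: smooth_fun_on_def)
  qed
qed

lemma smooth_fun_on_const: "smooth_fun_on M A (\<lambda>x. c)"
  by (auto simp: smooth_fun_on_def Csmooth_on_const)

lemma smooth_fun_on_add: "smooth_fun_on M A f \<Longrightarrow> smooth_fun_on M A g \<Longrightarrow> smooth_fun_on M A (\<lambda>x. f x + g x)"
  by (simp add: smooth_fun_on_def case_prod_beta Csmooth_on_add)

lemma smooth_fun_on_mult: "smooth_fun_on M A f \<Longrightarrow> smooth_fun_on M A g \<Longrightarrow> smooth_fun_on M A (\<lambda>x. f x * g x)"
  by (simp add: smooth_fun_on_def case_prod_beta Csmooth_on_mult)

lemma smooth_fun_on_diff:
  assumes "smooth_fun_on M A f" "smooth_fun_on M A g"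
  shows "smooth_fun_on M A (\<lambda>x. f x - g x)"
  using smooth_fun_on_add[OF assms(1) smooth_fun_on_mult[OF smooth_fun_on_const[of _ "-1"] assms(2)]] by simp

lemma smooth_fun_on_sum: "(\<And>i. i \<in> I \<Longrightarrow> smooth_fun_on M A (f i)) \<Longrightarrow> smooth_fun_on M A (\<lambda>x. \<Sum>i\<in>I. f i x)"
  by (simp add: smooth_fun_on_def case_prod_beta Csmooth_on_sum)

lemma smooth_fun_on_prod:
  "(\<And>i. i \<in> I \<Longrightarrow> smooth_fun_on M A (f i)) \<Longrightarrow> smooth_fun_on M A (\<lambda>x. \<Prod>i\<in>I. f i x)"
  by (induction I rule: infinite_finite_induct) (auto intro: smooth_fun_on_const smooth_fun_on_mult)

lemma smooth_functions_restrict: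
  "(\<lambda>x\<in>points M. f x) \<in> smooth_functions M \<longleftrightarrow> smooth_fun_on M (points M) f"
proof -
  have "smooth_fun_on M (points M) (\<lambda>x\<in>points M. f x) \<longleftrightarrow> smooth_fun_on M (points M) f"
    using smooth_fun_on_cong[OF openin_points, of f "\<lambda>x\<in>points M. f x"]
      smooth_fun_on_cong[OF openin_points, of "\<lambda>x\<in>points M. f x" f] by (auto simp del: restrict_apply simp: restrict_apply')
  then show ?thesis by (simp add: smooth_functions_def)
qed

lemma smooth_functionsD: "f \<in> smooth_functions M \<Longrightarrow> A \<subseteq> points M \<Longrightarrow> smooth_fun_on M A f"
  unfolding smooth_functions_def using smooth_fun_on_subset by blast

lemma smooth_functions_eqI:
  "f \<in> smooth_functions M \<Longrightarrow> g \<in> smooth_functions M \<Longrightarrow> (\<And>x. x \<in> points M \<Longrightarrow> f x = g x) \<Longrightarrow> f = g"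
  unfolding smooth_functions_def by (auto intro: extensionalityI)

lemma smooth_near_smooth_function: "f \<in> smooth_functions M \<Longrightarrow> x \<in> points M \<Longrightarrow> smooth_near M x f"
  unfolding smooth_near_def using openin_points smooth_functionsD by blast

section \<open>Bump functions and partitions of unity\<close>

text \<open>The obstacle is extension by 0 beyond the chart. A closed box in the chart is compact,
  so its preimage is compact and, by the Hausdorff axiom, closed in all of \<open>M\<close>. Its
  complement is open, and the function vanishes there.\<close>

lemma bump_function:
  assumes V: "openin (mtop M) V" and x: "x \<in> V"
  obtains \<psi> O' W where "bump_on M V x \<psi> O' W"
proof -
  let ?n = "mdim M" and ?E = "topspace (Euclidean_space (mdim M))"
  obtain U \<phi> where c: "(U, \<phi>) \<in> charts M" "x \<in> U"
    using chart_cover mtop_subset[OF V] x by blast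
  have inj: "inj_on \<phi> U" using chart_inj[OF c(1)] .
  define c0 where "c0 = \<phi> x"
  have c0E: "c0 \<in> ?E" using chart_in_Euclidean[OF c] by (simp add: c0_def)
  obtain e where e: "e > 0" "\<And>z. (\<And>i. i < ?n \<Longrightarrow> \<bar>z i - c0 i\<bar> < e) \<Longrightarrow> z \<in> ?E \<Longrightarrow> z \<in> \<phi> ` (V \<inter> U)"
    using Euclidean_box[OF openin_chart_image[OF V c(1)], of c0] x c(2) by (auto simp: c0_def)
  \<comment> \<open>Half of \<open>e\<close>, so that the closed box of this size still lies in the
    open box of size \<open>e\<close>.\<close>
  define a where "a = e / 2"
  have a: "a > 0" "a < e" using e(1) by (auto simp: a_def)
  define K where "K = {z \<in> ?E. \<forall>i<?n. \<bar>z i - c0 i\<bar> \<le> a}"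
  have K: "K \<subseteq> \<phi> ` (V \<inter> U)" using a e(2) by (force simp: K_def)
  \<comment> \<open>R^n sits in an infinite product, so the box is written as a product of intervals
    and, from index \<open>n\<close> on, of singletons; Tychonoff's theorem then applies.\<close>
  have "compactin (powertop_real UNIV) (\<Pi>\<^sub>E i\<in>UNIV. if i < ?n then {c0 i - a..c0 i + a} else {0})"
    by (auto simp: compactin_PiE)
  moreover have "(\<Pi>\<^sub>E i\<in>UNIV. if i < ?n then {c0 i - a..c0 i + a} else {0}) = K"
  proof (intro Set.set_eqI)
    fix z :: "nat \<Rightarrow> real"
    have "z \<in> (\<Pi>\<^sub>E i\<in>UNIV. if i < ?n then {c0 i - a..c0 i + a} else {0}) \<longleftrightarrow>
        (\<forall>i. if i < ?n then \<bar>z i - c0 i\<bar> \<le> a else z i = 0)"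
      unfolding PiE_iff by (simp add: abs_le_iff) (smt (verit))
    also have "\<dots> \<longleftrightarrow> z \<in> K" unfolding K_def topspace_Euclidean_space mem_Collect_eq by (metis not_le)
    finally show "z \<in> (\<Pi>\<^sub>E i\<in>UNIV. if i < ?n then {c0 i - a..c0 i + a} else {0}) \<longleftrightarrow> z \<in> K" .
  qed
  ultimately have "compactin (Euclidean_space ?n) K"
    unfolding Euclidean_space_def compactin_subtopology by (auto simp: K_def topspace_Euclidean_space)
  then have cK: "compactin (subtopology (Euclidean_space ?n) (\<phi> ` U)) K"
    using K unfolding compactin_subtopology by blast
  have "continuous_map (subtopology (Euclidean_space ?n) (\<phi> ` U)) (mtop M) (inv_into U \<phi>)"
    unfolding continuous_map_def
  proof (intro conjI allI impI)
    show "inv_into U \<phi> \<in> topspace (subtopology (Euclidean_space ?n) (\<phi> ` U)) \<rightarrow> topspace (mtop M)"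
      using inv_into_into[of _ \<phi> U] chart_subset[OF c(1)] by (auto simp: topspace_mtop)
    fix A assume A: "openin (mtop M) A"
    have "{z \<in> topspace (subtopology (Euclidean_space ?n) (\<phi> ` U)). inv_into U \<phi> z \<in> A} = \<phi> ` (A \<inter> U) \<inter> \<phi> ` U"
      using chart_inv[OF c(1)] chart_in_Euclidean[OF c(1)] by (auto; metis)
    then show "openin (subtopology (Euclidean_space ?n) (\<phi> ` U))
        {z \<in> topspace (subtopology (Euclidean_space ?n) (\<phi> ` U)). inv_into U \<phi> z \<in> A}"
      using openin_chart_image[OF A c(1)] by (auto simp: openin_subtopology)
  qed
  then have "compactin (mtop M) (inv_into U \<phi> ` K)" by (rule image_compactin[OF cK])
  then have clo: "closedin (mtop M) (inv_into U \<phi> ` K)"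
    by (intro compactin_imp_closedin Hausdorff_mtop)
  have KV: "inv_into U \<phi> ` K \<subseteq> V \<inter> U" using K chart_inv[OF c(1)] by force
  define W where "W = points M - inv_into U \<phi> ` K"
  have W: "openin (mtop M) W" using clo by (simp add: W_def closedin_def topspace_mtop)
  \<comment> \<open>The squared distance to the centre is polynomial, hence smooth. The ball
    \<open>Q z < a^2\<close> lies inside the box \<open>K\<close>, so the step function of
    \<open>Q\<close> vanishes off \<open>K\<close>.\<close>
  define Q where "Q z = (\<Sum>i<?n. (z i + - c0 i) * (z i + - c0 i))" for z :: "nat \<Rightarrow> real"
  define \<psi> where "\<psi> = (\<lambda>y\<in>points M. if y \<in> U then step (a\<^sup>2) (Q (\<phi> y)) else 0)"
  have zero: "\<psi> y = 0" if y: "y \<in> W" for y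
  proof (cases "y \<in> U")
    case True
    have "\<phi> y \<notin> K" using y True chart_inv[OF c(1) True] by (force simp: W_def)
    then obtain i where i: "i < ?n" "\<bar>\<phi> y i - c0 i\<bar> > a"
      using chart_in_Euclidean[OF c(1) True] by (auto simp: K_def not_le)
    have "a\<^sup>2 \<le> (\<phi> y i + - c0 i) * (\<phi> y i + - c0 i)"
      using i(2) a(1) abs_le_square_iff[of a "\<phi> y i - c0 i"] by (simp add: power2_eq_square)
    also have "\<dots> \<le> Q (\<phi> y)" unfolding Q_def using i(1) by (intro member_le_sum) auto
    finally show ?thesis using y by (simp add: \<psi>_def step_eq_0 W_def)
  qed (use y in \<open>simp add: \<psi>_def W_def\<close>)
  have smU: "smooth_fun_on M U \<psi>"
  proof (rule smooth_fun_on_cong[OF chart_open[OF c(1)], of "\<lambda>y. step (a\<^sup>2) (Q (\<phi> y))"])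
    show "smooth_fun_on M U (\<lambda>y. step (a\<^sup>2) (Q (\<phi> y)))"
      unfolding smooth_fun_on_def
    proof clarify
      fix V \<sigma> assume d: "(V, \<sigma>) \<in> charts M"
      show "Csmooth_on ?n (\<sigma> ` (U \<inter> V)) (\<lambda>x. step (a\<^sup>2) (Q (\<phi> (inv_into V \<sigma> x))))"
        unfolding Q_def using a(1) chart_transition(2)[OF d c(1)]
        by (intro Csmooth_on_step Csmooth_on_sum Csmooth_on_mult Csmooth_on_add Csmooth_on_const)
          (auto simp: Int_commute)
    qed
  qed (use chart_subset[OF c(1)] in \<open>auto simp: \<psi>_def\<close>)
  have smW: "smooth_fun_on M W \<psi>"
    by (rule smooth_fun_on_cong[OF W _ smooth_fun_on_const[of _ 0]]) (simp add: zero)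
  have cover: "V \<union> W = points M" "U \<union> W = points M"
    using KV mtop_subset[OF V] chart_subset[OF c(1)] by (auto simp: W_def)
  have "smooth_fun_on M (points M) \<psi>"
  proof (rule smooth_fun_on_local[OF openin_points])
    fix y assume "y \<in> points M"
    then show "\<exists>B. openin (mtop M) B \<and> y \<in> B \<and> smooth_fun_on M B \<psi>"
      using cover smU smW W chart_open[OF c(1)] by blast
  qed
  then have sm: "\<psi> \<in> smooth_functions M" by (simp add: smooth_functions_def \<psi>_def)
  define T where "T = {z \<in> \<phi> ` (V \<inter> U). Q z \<in> {..<a\<^sup>2 / 4}}"
  have oT: "openin (Euclidean_space ?n) T"
  proof -
    have "continuous_on UNIV Q" unfolding Q_def
      by (intro continuous_on_sum continuous_on_mult continuous_on_add continuous_on_const continuous_on_product_coordinates)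
    then have "open (Q -` {..<a\<^sup>2 / 4})" by (simp add: open_vimage)
    moreover obtain S where "open S" "\<phi> ` (V \<inter> U) = S \<inter> ?E"
      using openin_chart_image[OF V c(1)] openin_Euclidean_space_iff by blast
    ultimately show ?thesis unfolding openin_Euclidean_space_iff T_def
      by (intro exI[of _ "S \<inter> Q -` {..<a\<^sup>2 / 4}"]) auto
  qed
  show thesis
  proof (rule that[of \<psi> "{x \<in> U. \<phi> x \<in> T}" W], unfold bump_on_def,
      intro conjI ballI sm openin_chart_preimage[OF c(1) oT] W cover(1) zero)
    show "x \<in> {x \<in> U. \<phi> x \<in> T}" using c(2) x a(1) by (auto simp: T_def Q_def c0_def)
    show "{x \<in> U. \<phi> x \<in> T} \<subseteq> V" using inj by (force simp: T_def inj_on_def)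
    show "\<psi> y = 1" if "y \<in> {x \<in> U. \<phi> x \<in> T}" for y
      using that a(1) chart_subset[OF c(1)] by (auto simp: \<psi>_def T_def intro!: step_eq_1)
  qed
qed

lemma bump_separating:
  assumes "x \<in> points M" "y \<in> points M" "x \<noteq> y"
  obtains \<psi> O' where "\<psi> \<in> smooth_functions M" "openin (mtop M) O'" "x \<in> O'" "\<And>z. z \<in> O' \<Longrightarrow> \<psi> z = 1" "\<psi> y = 0"
proof -
  obtain V V' where V: "openin (mtop M) V" "openin (mtop M) V'" "x \<in> V" "y \<in> V'" "disjnt V V'"
    using assms Hausdorff_mtop unfolding Hausdorff_space_def topspace_mtop by meson
  have "y \<notin> V" using V by (auto simp: disjnt_iff)
  obtain \<psi> O' W where "bump_on M V x \<psi> O' W"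
    by (rule bump_function[OF V(1,3)])
  note \<psi> = bump_onD[OF this]
  then show thesis using that \<open>y \<notin> V\<close> assms(2) by blast
qed

text \<open>On \<open>V\<close> the function is a product of smooth functions, on \<open>W\<close>
  it is 0, and smoothness is local.\<close>

lemma smooth_cutoff:
  assumes "\<psi> \<in> smooth_functions M" "openin (mtop M) V" "openin (mtop M) W" "V \<union> W = points M"
    "\<And>y. y \<in> W \<Longrightarrow> \<psi> y = 0" "smooth_fun_on M V f" "openin (mtop M) A"
  shows "smooth_fun_on M A (\<lambda>y. if y \<in> V then \<psi> y * f y else 0)"
proof (rule smooth_fun_on_local[OF assms(7)])
  fix y assume y: "y \<in> A"
  have "smooth_fun_on M V (\<lambda>y. \<psi> y * f y)"
    by (rule smooth_fun_on_mult[OF smooth_functionsD[OF assms(1) mtop_subset[OF assms(2)]] assms(6)])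
  then have 1: "smooth_fun_on M V (\<lambda>y. if y \<in> V then \<psi> y * f y else 0)"
    by (rule smooth_fun_on_cong[OF assms(2), rotated]) simp
  have 2: "smooth_fun_on M W (\<lambda>y. if y \<in> V then \<psi> y * f y else 0)"
    by (rule smooth_fun_on_cong[OF assms(3) _ smooth_fun_on_const[of _ 0]]) (simp add: assms(5))
  have "y \<in> V \<union> W" using y assms(4) mtop_subset[OF assms(7)] by blast
  then show "\<exists>B. openin (mtop M) B \<and> y \<in> B \<and> smooth_fun_on M B (\<lambda>y. if y \<in> V then \<psi> y * f y else 0)"
    using 1 2 assms(2,3) by blast
qed

text \<open>
  With \<open>\<psi>\<^sub>n\<close> equal to \<open>1\<close> on the \<open>n\<close>-th member of a countable open cover, the functions
  \<open>\<psi>\<^sub>n (1 - \<psi>\<^sub>0) \<dots> (1 - \<psi>\<^sub>n\<^sub>-\<^sub>1)\<close> are a partition of unity by telescoping, and they are locally finite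
  because all of them with index \<open>> n\<close> vanish on the \<open>n\<close>-th member.  The assumption \<open>P {}\<close> allows a
  finite cover to be continued by empty sets.
\<close>

lemma partition_of_unity:
  assumes P0: "P {}" and cover: "\<forall>x\<in>points M. \<exists>V. openin (mtop M) V \<and> x \<in> V \<and> P V"
  shows "\<exists>(g :: nat \<Rightarrow> 'a \<Rightarrow> real) V. (\<forall>n. g n \<in> smooth_functions M) \<and> (\<forall>n. P (V n)) \<and>
    (\<forall>n. \<forall>x\<in>points M. g n x \<noteq> 0 \<longrightarrow> x \<in> V n) \<and>
    (\<forall>x\<in>points M. \<exists>A m. openin (mtop M) A \<and> x \<in> A \<and> (\<forall>y\<in>A. (\<forall>n>m. g n y = 0) \<and> (\<Sum>n\<le>m. g n y) = 1))"
proof -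
  \<comment> \<open>The cover consists of sets on which some bump function is identically 1; on such
    a set the product left over by the telescoping sum contains a factor 0.\<close>
  define Q where "Q B \<longleftrightarrow> openin (mtop M) B \<and> (\<exists>\<psi> V. \<psi> \<in> smooth_functions M \<and> P V \<and> (\<forall>y\<in>B. \<psi> y = 1) \<and>
     (\<forall>y\<in>points M. \<psi> y \<noteq> 0 \<longrightarrow> y \<in> V))" for B
  have Q: "\<exists>B. Q B \<and> x \<in> B" if x: "x \<in> points M" for x
  proof -
    obtain V where V: "openin (mtop M) V" "x \<in> V" "P V" using cover x by blast
    obtain \<psi> O' W where "bump_on M V x \<psi> O' W"
      by (rule bump_function[OF V(1,2)])
    note \<psi> = bump_onD[OF this]
    then have "Q O'" unfolding Q_def using V(3) by blast
    then show ?thesis using \<open>x \<in> O'\<close> by blast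
  qed
  have "(\<lambda>x\<in>points M. 0) \<in> smooth_functions M"
    unfolding smooth_functions_restrict by (rule smooth_fun_on_const)
  then have Q0: "Q {}" unfolding Q_def using P0 by (intro conjI exI[of _ "\<lambda>x\<in>points M. 0"] exI[of _ "{}"]) auto
  have "second_countable (mtop M)" using M unfolding smooth_manifold_def by (elim conjE)
  then have "Lindelof_space (mtop M)" by (rule second_countable_imp_Lindelof_space)
  moreover have Qopen: "openin (mtop M) B" if "B \<in> Collect Q" for B using that by (simp add: Q_def)
  moreover have "\<Union>(Collect Q) = points M"
  proof
    show "\<Union>(Collect Q) \<subseteq> points M" using mtop_subset[OF Qopen] by auto
    show "points M \<subseteq> \<Union>(Collect Q)" using Q by auto
  qed
  ultimately obtain \<B> where B: "countable \<B>" "\<B> \<subseteq> Collect Q" "\<Union>\<B> = points M"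
    unfolding Lindelof_space_def topspace_mtop by (metis mem_Collect_eq)
  define b where "b = from_nat_into (insert {} \<B>)"
  have b: "range b = insert {} \<B>" unfolding b_def using B(1) by (intro range_from_nat_into) auto
  have Qb: "Q (b n)" for n using b B(2) Q0 by (metis insertE mem_Collect_eq rangeI subsetD)
  then obtain \<psi> V where \<psi>: "\<And>n. \<psi> n \<in> smooth_functions M" "\<And>n. P (V n)" "\<And>n y. y \<in> b n \<Longrightarrow> \<psi> n y = 1"
    "\<And>n y. y \<in> points M \<Longrightarrow> \<psi> n y \<noteq> 0 \<Longrightarrow> y \<in> V n"
    unfolding Q_def by metis
  define g where "g n = (\<lambda>x\<in>points M. \<psi> n x * (\<Prod>i<n. 1 - \<psi> i x))" for n
  have tel: "(\<Sum>n\<le>m. g n x) = 1 - (\<Prod>i\<le>m. 1 - \<psi> i x)" if "x \<in> points M" for x m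
  proof (induction m)
    case (Suc m)
    have "g (Suc m) x = \<psi> (Suc m) x * (\<Prod>i\<le>m. 1 - \<psi> i x)"
      using that by (simp add: g_def lessThan_Suc_atMost del: prod.lessThan_Suc)
    then show ?case using Suc by (simp add: algebra_simps)
  qed (use that in \<open>simp add: g_def\<close>)
  show ?thesis
  proof (intro exI[of _ g] exI[of _ V] conjI allI ballI impI)
    show "g n \<in> smooth_functions M" for n
      unfolding g_def smooth_functions_restrict
      by (intro smooth_fun_on_mult smooth_fun_on_prod smooth_fun_on_diff smooth_fun_on_const smooth_functionsD \<psi>) auto
    show "x \<in> V n" if "x \<in> points M" "g n x \<noteq> 0" for n x using that \<psi>(4) by (auto simp: g_def)
    fix x assume x: "x \<in> points M"
    then obtain m where m: "x \<in> b m" using B(3) b by (metis UnionE insertI2 rangeE)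
    have "(\<forall>n>m. g n y = 0) \<and> (\<Sum>n\<le>m. g n y) = 1" if y: "y \<in> b m" for y
    proof -
      have yM: "y \<in> points M" using Qb y mtop_subset unfolding Q_def by blast
      have "(\<Prod>i\<le>m. 1 - \<psi> i y) = 0" using \<psi>(3)[OF y] by (auto intro!: exI[of _ m])
      moreover have "g n y = 0" if "n > m" for n
        using that yM \<psi>(3)[OF y] by (auto simp: g_def intro!: exI[of _ m] disjI2)
      ultimately show ?thesis using tel[OF yM] by simp
    qed
    then show "\<exists>A m. openin (mtop M) A \<and> x \<in> A \<and> (\<forall>y\<in>A. (\<forall>n>m. g n y = 0) \<and> (\<Sum>n\<le>m. g n y) = 1)"
      using m Qb unfolding Q_def by blast
  qed (rule \<psi>)
qed

text \<open>The index set varies with the point. Near a given point it stays below a fixed bound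
  \<open>m\<close>, where the sum agrees with one over \<open>n \<le> m\<close>.\<close>

lemma locally_finite_sum_smooth:
  fixes g F :: "nat \<Rightarrow> 'a \<Rightarrow> real"
  assumes "\<And>n. g n \<in> smooth_functions M" "\<And>n. smooth_fun_on M (points M) (F n)"
    and lf: "\<And>x. x \<in> points M \<Longrightarrow> \<exists>A m. openin (mtop M) A \<and> x \<in> A \<and> (\<forall>y\<in>A. \<forall>n>m. g n y = 0)"
  shows "smooth_fun_on M (points M) (\<lambda>x. \<Sum>n | g n x \<noteq> 0. g n x * F n x)"
proof (rule smooth_fun_on_local[OF openin_points])
  fix x assume x: "x \<in> points M"
  obtain A m where A: "openin (mtop M) A" "x \<in> A" "\<And>y n. y \<in> A \<Longrightarrow> n > m \<Longrightarrow> g n y = 0"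
    using lf[OF x] by blast
  have "smooth_fun_on M A (\<lambda>x. \<Sum>n\<le>m. g n x * F n x)"
    by (intro smooth_fun_on_sum smooth_fun_on_mult smooth_functionsD assms mtop_subset[OF A(1)]
        smooth_fun_on_subset[OF assms(2)])
  then have "smooth_fun_on M A (\<lambda>x. \<Sum>n | g n x \<noteq> 0. g n x * F n x)"
  proof (rule smooth_fun_on_cong[OF A(1), rotated])
    fix y assume y: "y \<in> A"
    show "(\<Sum>n\<le>m. g n y * F n y) = (\<Sum>n | g n y \<noteq> 0. g n y * F n y)"
      using A(3)[OF y] by (intro sum.mono_neutral_right) (auto simp: not_less[symmetric])
  qed
  then show "\<exists>B. openin (mtop M) B \<and> x \<in> B \<and> smooth_fun_on M B (\<lambda>x. \<Sum>n | g n x \<noteq> 0. g n x * F n x)"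
    using A(1,2) by blast
qed

end

text \<open>The chain rule in R^n enters here: near each point the composite is, in charts, the
  coordinate expression of \<open>g\<close> after that of \<open>h\<close>.\<close>

lemma smooth_fun_on_compose:
  assumes M: "smooth_manifold M" and N: "smooth_manifold N" and h: "smooth_map M N h"
    and A: "openin (mtop N) A" and g: "smooth_fun_on N A g"
  shows "openin (mtop M) {x \<in> points M. h x \<in> A}"
    and "smooth_fun_on M {x \<in> points M. h x \<in> A} (\<lambda>x. g (h x))"
proof -
  have cont: "openin (mtop M) {x \<in> points M. h x \<in> B}" if "openin (mtop N) B" for B
    using h that unfolding smooth_map_def continuous_map_def topspace_mtop[OF M] by blast
  show oA: "openin (mtop M) {x \<in> points M. h x \<in> A}" by (rule cont[OF A])
  let ?A = "{x \<in> points M. h x \<in> A}"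
  show "smooth_fun_on M ?A (\<lambda>x. g (h x))"
    unfolding smooth_fun_on_def
  proof clarify
    fix U \<phi> assume c: "(U, \<phi>) \<in> charts M"
    note inv = chart_inv[OF M c]
    show "Csmooth_on (mdim M) (\<phi> ` (?A \<inter> U)) (\<lambda>x. g (h (inv_into U \<phi> x)))"
    proof (rule Csmooth_on_local[OF openin_chart_image[OF M oA c]])
      fix z assume "z \<in> \<phi> ` (?A \<inter> U)"
      then obtain x where x: "x \<in> points M" "h x \<in> A" "x \<in> U" "z = \<phi> x" by blast
      obtain V \<sigma> where d: "(V, \<sigma>) \<in> charts N" "h x \<in> V" using chart_cover[OF N] mtop_subset[OF N A] x(2) by blast
      let ?B = "{x \<in> points M. h x \<in> A \<inter> V}"
      have oB: "openin (mtop M) ?B" by (rule cont) (use A chart_open[OF N d(1)] in auto)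
      have "Csmooth_on (mdim M) (\<phi> ` (?B \<inter> U)) (\<lambda>x. g (inv_into V \<sigma> (\<sigma> (h (inv_into U \<phi> x)))))"
      proof (rule Csmooth_on_compose[OF openin_chart_image[OF M oB c] openin_chart_image[OF N A d(1)],
            where F = "\<lambda>x. \<sigma> (h (inv_into U \<phi> x))" and f = "\<lambda>y. g (inv_into V \<sigma> y)"])
        show "\<sigma> (h (inv_into U \<phi> x)) \<in> \<sigma> ` (A \<inter> V)" if "x \<in> \<phi> ` (?B \<inter> U)" for x
          using that inv by auto
        show "Csmooth_on (mdim M) (\<phi> ` (?B \<inter> U)) (\<lambda>x. \<sigma> (h (inv_into U \<phi> x)) i)" if "i < mdim N" for i
        proof (rule Csmooth_on_subset)
          show "Csmooth_on (mdim M) (\<phi> ` {x \<in> U. h x \<in> V}) (\<lambda>x. \<sigma> (h (inv_into U \<phi> x)) i)"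
            by (rule smooth_mapD[OF h c d(1) that])
        qed blast
        show "Csmooth_on (mdim N) (\<sigma> ` (A \<inter> V)) (\<lambda>y. g (inv_into V \<sigma> y))"
          using g d(1) unfolding smooth_fun_on_def by blast
      qed
      then have "Csmooth_on (mdim M) (\<phi> ` (?B \<inter> U)) (\<lambda>x. g (h (inv_into U \<phi> x)))"
        by (rule Csmooth_on_cong[OF openin_chart_image[OF M oB c], rotated]) (use inv chart_inv[OF N d(1)] in auto)
      then show "\<exists>T. openin (Euclidean_space (mdim M)) T \<and> z \<in> T \<and> Csmooth_on (mdim M) T (\<lambda>x. g (h (inv_into U \<phi> x)))"
        using openin_chart_image[OF M oB c] x d(2) by (intro exI[of _ "\<phi> ` (?B \<inter> U)"]) auto
    qed
  qed
qed

section \<open>Sections of vector bundles\<close>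

context
  fixes B :: "('e, 'b) vbundle"
  assumes B: "vector_bundle B"
begin

lemma vbundle_manifold: "smooth_manifold (base B)"
  using B unfolding vector_bundle_def by (elim conjE)

lemma fibre_closed:
  assumes "x \<in> points (base B)"
  shows "fzero B x \<in> fibre B x"
    and "e \<in> fibre B x \<Longrightarrow> e' \<in> fibre B x \<Longrightarrow> fadd B e e' \<in> fibre B x"
    and "e \<in> fibre B x \<Longrightarrow> fscale B c e \<in> fibre B x"
  using B assms unfolding vector_bundle_def by blast+

lemma triv_local_triv: "(U, \<tau>) \<in> trivs B \<Longrightarrow> local_triv B U \<tau>"
  using B unfolding vector_bundle_def by blast

lemma triv_cover: "x \<in> points (base B) \<Longrightarrow> \<exists>U \<tau>. (U, \<tau>) \<in> trivs B \<and> x \<in> U"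
  using B unfolding vector_bundle_def by blast

lemma local_triv_open: "local_triv B V \<tau> \<Longrightarrow> openin (mtop (base B)) V"
  unfolding local_triv_def by (elim conjE)

lemma local_triv_subset: "local_triv B V \<tau> \<Longrightarrow> V \<subseteq> points (base B)"
  using local_triv_open mtop_subset[OF vbundle_manifold] by blast

lemma local_triv_bij:
  "local_triv B V \<tau> \<Longrightarrow> x \<in> V \<Longrightarrow> bij_betw \<tau> (fibre B x) (topspace (Euclidean_space (frank B)))"
  unfolding local_triv_def by blast

lemma local_triv_linear:
  assumes "local_triv B V \<tau>" "x \<in> V"
  shows "\<tau> (fzero B x) i = 0"
    and "e \<in> fibre B x \<Longrightarrow> e' \<in> fibre B x \<Longrightarrow> \<tau> (fadd B e e') i = \<tau> e i + \<tau> e' i"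
    and "e \<in> fibre B x \<Longrightarrow> \<tau> (fscale B c e) i = c * \<tau> e i"
  using assms unfolding local_triv_def by blast+

lemma local_triv_transition:
  assumes "local_triv B V \<tau>" "(U, \<sigma>) \<in> trivs B"
  shows "smooth_transition B U \<sigma> V \<tau>" "smooth_transition B V \<tau> U \<sigma>"
  using assms unfolding local_triv_def by blast+

lemma local_triv_Euclidean:
  "local_triv B V \<tau> \<Longrightarrow> x \<in> V \<Longrightarrow> e \<in> fibre B x \<Longrightarrow> \<tau> e \<in> topspace (Euclidean_space (frank B))"
  using local_triv_bij bij_betwE by blast

lemma local_triv_eqI:
  assumes "local_triv B V \<tau>" "x \<in> V" "e \<in> fibre B x" "e' \<in> fibre B x"
    and "\<And>i. i < frank B \<Longrightarrow> \<tau> e i = \<tau> e' i"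
  shows "e = e'"
proof -
  have "\<tau> e i = \<tau> e' i" for i
    using assms(5)[of i] local_triv_Euclidean[OF assms(1-3)] local_triv_Euclidean[OF assms(1,2,4)]
    by (cases "i < frank B") (auto simp: topspace_Euclidean_space)
  then have "\<tau> e = \<tau> e'" by auto
  then show ?thesis
    using bij_betw_imp_inj_on[OF local_triv_bij[OF assms(1,2)]] assms(3,4) by (auto dest: inj_onD)
qed

section \<open>Charts of the total space and smoothness of sections\<close>

lemma total_chart_inj:
  assumes "(U, \<phi>) \<in> charts (base B)" "(V, \<tau>) \<in> trivs B"
  shows "inj_on (\<lambda>e. join (mdim (base B)) (\<phi> (bproj B e)) (\<tau> e)) {e \<in> tot B. bproj B e \<in> U \<inter> V}"
proof (rule inj_onI)
  fix e e' assume e: "e \<in> {e \<in> tot B. bproj B e \<in> U \<inter> V}" "e' \<in> {e \<in> tot B. bproj B e \<in> U \<inter> V}"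
    and eq: "join (mdim (base B)) (\<phi> (bproj B e)) (\<tau> e) = join (mdim (base B)) (\<phi> (bproj B e')) (\<tau> e')"
  note M = vbundle_manifold
  have "\<phi> (bproj B e) i = \<phi> (bproj B e') i" for i
  proof (cases "i < mdim (base B)")
    case True
    then show ?thesis using fun_cong[OF eq, of i] by (simp add: join_def)
  next
    case False
    then show ?thesis
      using chart_in_Euclidean[OF M assms(1)] e by (auto simp: topspace_Euclidean_space)
  qed
  then have "\<phi> (bproj B e) = \<phi> (bproj B e')" by auto
  then have "bproj B e = bproj B e'"
    using inj_onD[OF chart_inj[OF M assms(1)]] e by blast
  moreover have "\<tau> e i = \<tau> e' i" for i
    using fun_cong[OF eq, of "mdim (base B) + i"] by (simp add: join_def)
  ultimately show "e = e'"
    using local_triv_eqI[OF triv_local_triv[OF assms(2)], of "bproj B e" e e'] e by (auto simp: fibre_def)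
qed

lemma charts_total_space:
  "(C, \<kappa>) \<in> charts (total_space B) \<longleftrightarrow> (\<exists>U \<phi> V \<tau>. (U, \<phi>) \<in> charts (base B) \<and> (V, \<tau>) \<in> trivs B \<and>
     C = {e \<in> tot B. bproj B e \<in> U \<inter> V} \<and> \<kappa> = (\<lambda>e. join (mdim (base B)) (\<phi> (bproj B e)) (\<tau> e)))"
  unfolding total_space_def by (auto split: prod.splits) blast+

lemma openin_total_space:
  "openin (mtop (total_space B)) A \<longleftrightarrow> A \<subseteq> tot B \<and>
     (\<forall>(C, \<kappa>)\<in>charts (total_space B). openin (Euclidean_space (mdim (base B) + frank B)) (\<kappa> ` (A \<inter> C)))"
proof -
  have "inj_on \<kappa> C" if "(C, \<kappa>) \<in> charts (total_space B)" for C \<kappa>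
    using that total_chart_inj unfolding charts_total_space by blast
  from openin_mtop_inj[of "total_space B", OF this] show ?thesis by (simp add: total_space_def)
qed

text \<open>\<open>smooth_map\<close> requires continuity for the topology that the charts induce on
  the total space, so it has to be recovered from the components.\<close>

lemma continuous_section:
  assumes fib: "\<And>x. x \<in> points (base B) \<Longrightarrow> s x \<in> fibre B x"
    and sm: "\<And>U \<tau> i. (U, \<tau>) \<in> trivs B \<Longrightarrow> i < frank B \<Longrightarrow> smooth_fun_on (base B) U (\<lambda>x. \<tau> (s x) i)"
  shows "continuous_map (mtop (base B)) (mtop (total_space B)) s"
proof -
  note M = vbundle_manifold
  let ?m = "mdim (base B)"
  have inv: "openin (mtop (base B)) {x \<in> points (base B). s x \<in> A}" if A: "openin (mtop (total_space B)) A" for A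
  proof (subst openin_subopen, clarify)
    fix x0 assume x0: "x0 \<in> points (base B)" "s x0 \<in> A"
    obtain U \<phi> where U: "(U, \<phi>) \<in> charts (base B)" "x0 \<in> U" using chart_cover[OF M x0(1)] by blast
    obtain V \<tau> where V: "(V, \<tau>) \<in> trivs B" "x0 \<in> V" using triv_cover[OF x0(1)] by blast
    note lt = triv_local_triv[OF V(1)]
    let ?C = "{e \<in> tot B. bproj B e \<in> U \<inter> V}" and ?\<kappa> = "\<lambda>e. join ?m (\<phi> (bproj B e)) (\<tau> e)"
    have "(?C, ?\<kappa>) \<in> charts (total_space B)" unfolding charts_total_space using U V by blast
    then have oC: "openin (Euclidean_space (?m + frank B)) (?\<kappa> ` (A \<inter> ?C))"
      using A unfolding openin_total_space by blast
    \<comment> \<open>In charts a section becomes the graph map of its components.\<close>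
    let ?F = "\<lambda>z. join ?m z (\<tau> (s (inv_into U \<phi> z)))"
    let ?T = "{z \<in> \<phi> ` (V \<inter> U). ?F z \<in> ?\<kappa> ` (A \<inter> ?C)}"
    have inv: "inv_into U \<phi> (\<phi> x) = x" if "x \<in> U" for x using chart_inv[OF M U(1) that] .
    have sC: "s x \<in> ?C" "bproj B (s x) = x" if "x \<in> U" "x \<in> V" for x
      using fib[of x] chart_subset[OF M U(1)] that by (auto simp: fibre_def)
    have oVU: "openin (Euclidean_space ?m) (\<phi> ` (V \<inter> U))"
      by (rule openin_chart_image[OF M local_triv_open[OF lt] U(1)])
    have "openin (Euclidean_space ?m) ?T"
    proof (rule openin_Euclidean_preimage[OF oVU _ _ oC])
      fix z assume "z \<in> \<phi> ` (V \<inter> U)"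
      then obtain x where x: "x \<in> V" "x \<in> U" "z = \<phi> x" by blast
      have "s x \<in> fibre B x" using fib chart_subset[OF M U(1)] x by blast
      from local_triv_Euclidean[OF lt x(1) this]
      show "?F z \<in> topspace (Euclidean_space (?m + frank B))"
        using inv[OF x(2)] x(3) by (auto simp: topspace_Euclidean_space join_def)
    next
      fix i assume i: "i < ?m + frank B"
      show "continuous_on (\<phi> ` (V \<inter> U)) (\<lambda>z. ?F z i)"
      proof (cases "i < ?m")
        case True
        then show ?thesis by (simp add: join_def) (rule continuous_on_product_then_coordinatewise[OF continuous_on_id])
      next
        case False
        then have "smooth_fun_on (base B) V (\<lambda>x. \<tau> (s x) (i - ?m))" using sm[OF V(1)] i by simp
        from Csmooth_on_continuous[OF smooth_fun_onD[OF this U(1)]] False show ?thesis by (simp add: join_def)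
      qed
    qed
    from openin_chart_preimage[OF M U(1) this] have "openin (mtop (base B)) {x \<in> U. \<phi> x \<in> ?T}" .
    moreover have "x0 \<in> {x \<in> U. \<phi> x \<in> ?T}"
      using U(2) V(2) inv[OF U(2)] sC[OF U(2) V(2)] x0(2) by (auto intro!: image_eqI[of _ _ "s x0"])
    moreover have "{x \<in> U. \<phi> x \<in> ?T} \<subseteq> {x \<in> points (base B). s x \<in> A}"
    proof clarify
      fix x x' e assume x: "x \<in> U" "x' \<in> V" "x' \<in> U" "\<phi> x = \<phi> x'" and e: "?F (\<phi> x) = ?\<kappa> e" "e \<in> A" "e \<in> tot B" "bproj B e \<in> U" "bproj B e \<in> V"
      have xx: "x' = x" by (metis inv x(1,3,4))
      then have xV: "x \<in> V" using x by simp
      have "?\<kappa> (s x) = ?\<kappa> e" using e(1) inv[OF x(1)] sC[OF x(1) xV] by simp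
      moreover have "e \<in> ?C" using e by simp
      ultimately have "s x = e" by (rule inj_onD[OF total_chart_inj[OF U(1) V(1)] _ sC(1)[OF x(1) xV]])
      then show "x \<in> points (base B) \<and> s x \<in> A" using e(2) x(1) chart_subset[OF M U(1)] by blast
    qed
    ultimately show "\<exists>T. openin (mtop (base B)) T \<and> x0 \<in> T \<and> T \<subseteq> {x \<in> points (base B). s x \<in> A}" by blast
  qed
  have sub: "topspace (mtop (total_space B)) \<subseteq> tot B"
    using openin_total_space openin_topspace by blast
  show ?thesis unfolding continuous_map_def topspace_mtop[OF M]
  proof (intro conjI allI impI)
    show "s \<in> points (base B) \<rightarrow> topspace (mtop (total_space B))"
    proof
      fix x0 assume x0: "x0 \<in> points (base B)"
      obtain U \<phi> where U: "(U, \<phi>) \<in> charts (base B)" "x0 \<in> U" using chart_cover[OF M x0] by blast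
      \<comment> \<open>Needed to know that the values of \<open>s\<close> lie in the underlying set
        of the topology. The image of a full chart is a cylinder: the first \<open>?m\<close>
        coordinates range over an open set, the others are free.\<close>
      have "openin (mtop (total_space B)) (tot B)"
        unfolding openin_total_space
      proof (intro conjI subset_refl, clarify)
        fix C \<kappa> assume "(C, \<kappa>) \<in> charts (total_space B)"
        then obtain U \<phi> V \<tau> where c: "(U, \<phi>) \<in> charts (base B)" "(V, \<tau>) \<in> trivs B"
          "C = {e \<in> tot B. bproj B e \<in> U \<inter> V}" "\<kappa> = (\<lambda>e. join ?m (\<phi> (bproj B e)) (\<tau> e))"
          unfolding charts_total_space by blast
        note lt = triv_local_triv[OF c(2)]
        obtain S where S: "open S" "\<phi> ` (V \<inter> U) = S \<inter> topspace (Euclidean_space ?m)"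
          using openin_chart_image[OF M local_triv_open[OF lt] c(1)] openin_Euclidean_space_iff by blast
        let ?R = "\<lambda>z. (\<lambda>i. if i < ?m then z i else 0) :: nat \<Rightarrow> real"
        have "continuous_on UNIV ?R"
        proof (rule continuous_on_coordinatewise_then_product)
          show "continuous_on UNIV (\<lambda>z. ?R z i)" for i by (cases "i < ?m") (simp_all add: continuous_on_product_coordinates)
        qed
        then have "open (?R -` S)" using S(1) by (simp add: open_vimage)
        moreover have "\<kappa> ` (tot B \<inter> C) = ?R -` S \<inter> topspace (Euclidean_space (?m + frank B))"
        proof (intro subset_antisym subsetI)
          fix z assume "z \<in> \<kappa> ` (tot B \<inter> C)"
          then obtain e where e: "e \<in> tot B" "bproj B e \<in> U" "bproj B e \<in> V" "z = \<kappa> e" unfolding c(3) by blast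
          have E: "\<phi> (bproj B e) \<in> topspace (Euclidean_space ?m)" "\<tau> e \<in> topspace (Euclidean_space (frank B))"
            using chart_in_Euclidean[OF M c(1)] local_triv_Euclidean[OF lt e(3)] e by (auto simp: fibre_def)
          then have "?R z = \<phi> (bproj B e)" by (auto simp: e(4) c(4) join_def topspace_Euclidean_space fun_eq_iff)
          moreover have "\<phi> (bproj B e) \<in> S" using S(2) e by blast
          ultimately have "?R z \<in> S" by simp
          moreover have "z \<in> topspace (Euclidean_space (?m + frank B))"
            using E by (auto simp: e(4) c(4) join_def topspace_Euclidean_space)
          ultimately show "z \<in> ?R -` S \<inter> topspace (Euclidean_space (?m + frank B))" by blast
        next
          fix z assume z: "z \<in> ?R -` S \<inter> topspace (Euclidean_space (?m + frank B))"
          then have "?R z \<in> \<phi> ` (V \<inter> U)" unfolding S(2) by (auto simp: topspace_Euclidean_space)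
          then obtain x where x: "x \<in> V" "x \<in> U" "?R z = \<phi> x" by blast
          have "(\<lambda>i. z (?m + i)) \<in> topspace (Euclidean_space (frank B))" using z by (auto simp: topspace_Euclidean_space)
          then obtain e where e: "e \<in> fibre B x" "\<tau> e = (\<lambda>i. z (?m + i))"
            using bij_betw_imp_surj_on[OF local_triv_bij[OF lt x(1)]] by (metis imageE)
          have "\<kappa> e = z" using e x(3)[symmetric] by (auto simp: c(4) fibre_def join_def fun_eq_iff)
          then show "z \<in> \<kappa> ` (tot B \<inter> C)" using e x unfolding c(3) by (auto simp: fibre_def)
        qed
        ultimately show "openin (Euclidean_space (?m + frank B)) (\<kappa> ` (tot B \<inter> C))"
          unfolding openin_Euclidean_space_iff by blast
      qed
      then have "tot B \<subseteq> topspace (mtop (total_space B))" by (rule openin_subset)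
      then show "s x0 \<in> topspace (mtop (total_space B))" using fib[OF x0] by (auto simp: fibre_def)
    qed
  qed (rule inv)
qed

text \<open>Allows the later arguments to work with components and to leave the total space aside.
  Component \<open>i\<close> is the coordinate of index \<open>?m + i\<close> of a total space
  chart; conversely, the coordinates below \<open>?m\<close> are transition maps of the
  base.\<close>

lemma sections_iff:
  "s \<in> sections B \<longleftrightarrow> s \<in> extensional (points (base B)) \<and> (\<forall>x\<in>points (base B). s x \<in> fibre B x) \<and>
     (\<forall>(U, \<tau>)\<in>trivs B. \<forall>i<frank B. smooth_fun_on (base B) U (\<lambda>x. \<tau> (s x) i))"
  (is "?L \<longleftrightarrow> ?R")
proof
  note M = vbundle_manifold
  let ?m = "mdim (base B)"
  assume L: ?L
  have fib: "s x \<in> fibre B x" if "x \<in> points (base B)" for x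
    using L that by (auto simp: sections_def smooth_map_def total_space_def fibre_def)
  have "smooth_fun_on (base B) V (\<lambda>x. \<tau> (s x) i)" if V: "(V, \<tau>) \<in> trivs B" and i: "i < frank B" for V \<tau> i
  proof (rule smooth_fun_onI)
    fix U \<phi> assume U: "(U, \<phi>) \<in> charts (base B)"
    let ?C = "{e \<in> tot B. bproj B e \<in> U \<inter> V}" and ?\<kappa> = "\<lambda>e. join ?m (\<phi> (bproj B e)) (\<tau> e)"
    have "(?C, ?\<kappa>) \<in> charts (total_space B)" unfolding charts_total_space using U V by blast
    moreover have "smooth_map (base B) (total_space B) s" using L by (simp add: sections_def)
    moreover have "?m + i < mdim (total_space B)" using i by (simp add: total_space_def)
    ultimately have "Csmooth_on ?m (\<phi> ` {x \<in> U. s x \<in> ?C}) (\<lambda>x. ?\<kappa> (s (inv_into U \<phi> x)) (?m + i))"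
      using smooth_mapD[OF _ U, of "total_space B" s ?C ?\<kappa> "?m + i"] by blast
    moreover have "{x \<in> U. s x \<in> ?C} = V \<inter> U"
      using fib chart_subset[OF M U] by (auto simp: fibre_def)
    ultimately show "Csmooth_on ?m (\<phi> ` (V \<inter> U)) (\<lambda>x. \<tau> (s (inv_into U \<phi> x)) i)"
      by (simp add: join_def)
  qed
  then show ?R using fib L by (auto simp: sections_def)
next
  note M = vbundle_manifold
  let ?m = "mdim (base B)"
  assume R: ?R
  have fib: "s x \<in> fibre B x" if "x \<in> points (base B)" for x using R that by blast
  have sm: "smooth_fun_on (base B) U (\<lambda>x. \<tau> (s x) i)" if "(U, \<tau>) \<in> trivs B" "i < frank B" for U \<tau> i
    using R that by blast
  have "Csmooth_on ?m (\<phi>' ` {x \<in> U'. s x \<in> C}) (\<lambda>x. \<kappa> (s (inv_into U' \<phi>' x)) i)"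
    if U': "(U', \<phi>') \<in> charts (base B)" and "(C, \<kappa>) \<in> charts (total_space B)" and i: "i < mdim (total_space B)" for U' \<phi>' C \<kappa> i
  proof -
    obtain U \<phi> V \<tau> where c: "(U, \<phi>) \<in> charts (base B)" "(V, \<tau>) \<in> trivs B"
      "C = {e \<in> tot B. bproj B e \<in> U \<inter> V}" "\<kappa> = (\<lambda>e. join ?m (\<phi> (bproj B e)) (\<tau> e))"
      using \<open>(C, \<kappa>) \<in> charts (total_space B)\<close> unfolding charts_total_space by blast
    have eq: "{x \<in> U'. s x \<in> C} = U \<inter> V \<inter> U'"
      using fib chart_subset[OF M U'] unfolding c(3) by (auto simp: fibre_def)
    have "openin (mtop (base B)) (U \<inter> V)"
      by (intro openin_Int chart_open[OF M c(1)] local_triv_open[OF triv_local_triv[OF c(2)]])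
    then have op: "openin (Euclidean_space ?m) (\<phi>' ` (U \<inter> V \<inter> U'))" by (rule openin_chart_image[OF M _ U'])
    show ?thesis unfolding eq
    proof (cases "i < ?m")
      case True
      have "Csmooth_on ?m (\<phi>' ` (U \<inter> V \<inter> U')) (\<lambda>x. \<phi> (inv_into U' \<phi>' x) i)"
        by (rule Csmooth_on_subset[OF chart_transition(2)[OF M U' c(1) True]]) blast
      then show "Csmooth_on ?m (\<phi>' ` (U \<inter> V \<inter> U')) (\<lambda>x. \<kappa> (s (inv_into U' \<phi>' x)) i)"
      proof (rule Csmooth_on_cong[OF op, rotated])
        fix z assume "z \<in> \<phi>' ` (U \<inter> V \<inter> U')"
        then obtain x where "x \<in> U'" "z = \<phi>' x" by blast
        then show "\<phi> (inv_into U' \<phi>' z) i = \<kappa> (s (inv_into U' \<phi>' z)) i"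
          using fib[of x] chart_inv[OF M U'] chart_subset[OF M U'] True by (auto simp: c(4) join_def fibre_def)
      qed
    next
      case False
      then have "i - ?m < frank B" using i by (simp add: total_space_def)
      from smooth_fun_onD[OF sm[OF c(2) this] U']
      have "Csmooth_on ?m (\<phi>' ` (U \<inter> V \<inter> U')) (\<lambda>x. \<tau> (s (inv_into U' \<phi>' x)) (i - ?m))"
        by (rule Csmooth_on_subset) blast
      then show "Csmooth_on ?m (\<phi>' ` (U \<inter> V \<inter> U')) (\<lambda>x. \<kappa> (s (inv_into U' \<phi>' x)) i)"
        using False by (simp add: c(4) join_def)
    qed
  qed
  moreover have "continuous_map (mtop (base B)) (mtop (total_space B)) s"
    by (rule continuous_section) (fact fib sm)+
  ultimately have "smooth_map (base B) (total_space B) s"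
    using fib unfolding smooth_map_def
    by (intro conjI) (fastforce simp: total_space_def fibre_def, blast, blast)
  then show ?L using R by (auto simp: sections_def fibre_def)
qed

lemma section_in_fibre: "s \<in> sections B \<Longrightarrow> x \<in> points (base B) \<Longrightarrow> s x \<in> fibre B x"
  using sections_iff by blast

text \<open>\<open>sections_iff\<close> concerns members of the bundle atlas. Trivializations
  adapted to a subbundle are only compatible with the atlas, and the smooth transition coefficients
  bridge the difference.\<close>

lemma section_component_smooth:
  assumes s: "s \<in> sections B" and lt: "local_triv B V \<tau>" and i: "i < frank B"
  shows "smooth_fun_on (base B) V (\<lambda>x. \<tau> (s x) i)"
proof (rule smooth_fun_on_local[OF vbundle_manifold local_triv_open[OF lt]])
  note M = vbundle_manifold
  fix x assume x: "x \<in> V"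
  obtain U \<sigma> where U: "(U, \<sigma>) \<in> trivs B" "x \<in> U" using triv_cover local_triv_subset[OF lt] x by blast
  have oUV: "openin (mtop (base B)) (U \<inter> V)"
    using local_triv_open[OF lt] local_triv_open[OF triv_local_triv[OF U(1)]] by blast
  obtain g where g: "\<And>i j. i < frank B \<Longrightarrow> j < frank B \<Longrightarrow> smooth_fun_on (base B) (U \<inter> V) (g i j)"
    "\<And>x e i. x \<in> U \<inter> V \<Longrightarrow> e \<in> fibre B x \<Longrightarrow> i < frank B \<Longrightarrow> \<tau> e i = (\<Sum>j<frank B. g i j x * \<sigma> e j)"
    using local_triv_transition(1)[OF lt U(1)] unfolding smooth_transition_def by blast
  have "smooth_fun_on (base B) (U \<inter> V) (\<lambda>x. \<sigma> (s x) j)" if "j < frank B" for j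
  proof (rule smooth_fun_on_subset[OF M])
    show "smooth_fun_on (base B) U (\<lambda>x. \<sigma> (s x) j)" using s U(1) that sections_iff by blast
  qed blast
  then have "smooth_fun_on (base B) (U \<inter> V) (\<lambda>x. \<Sum>j<frank B. g i j x * \<sigma> (s x) j)"
    using g(1)[OF i] by (intro smooth_fun_on_sum[OF M] smooth_fun_on_mult[OF M]) auto
  then have "smooth_fun_on (base B) (U \<inter> V) (\<lambda>x. \<tau> (s x) i)"
    by (rule smooth_fun_on_cong[OF M oUV, rotated])
      (use g(2) section_in_fibre[OF s] local_triv_subset[OF lt] i in auto)
  then show "\<exists>A. openin (mtop (base B)) A \<and> x \<in> A \<and> smooth_fun_on (base B) A (\<lambda>x. \<tau> (s x) i)"
    using oUV x U(2) by blast
qed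

lemma sec_add_sections:
  assumes "s \<in> sections B" "t \<in> sections B"
  shows "sec_add B s t \<in> sections B"
proof -
  note M = vbundle_manifold
  have "smooth_fun_on (base B) U (\<lambda>x. \<tau> (sec_add B s t x) i)" if U: "(U, \<tau>) \<in> trivs B" and i: "i < frank B" for U \<tau> i
  proof -
    note lt = triv_local_triv[OF U]
    have "smooth_fun_on (base B) U (\<lambda>x. \<tau> (s x) i + \<tau> (t x) i)"
      using assms lt i by (intro smooth_fun_on_add[OF M] section_component_smooth)
    then show ?thesis
    proof (rule smooth_fun_on_cong[OF M local_triv_open[OF lt], rotated])
      fix x assume x: "x \<in> U"
      then show "\<tau> (s x) i + \<tau> (t x) i = \<tau> (sec_add B s t x) i"
        using local_triv_linear(2)[OF lt x section_in_fibre section_in_fibre] assms local_triv_subset[OF lt]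
        by (auto simp: sec_add_def)
    qed
  qed
  then show ?thesis unfolding sections_iff using assms section_in_fibre fibre_closed by (auto simp: sec_add_def)
qed

lemma sec_scale_sections:
  assumes "smooth_fun_on (base B) (points (base B)) f" "s \<in> sections B"
  shows "sec_scale B f s \<in> sections B"
proof -
  note M = vbundle_manifold
  have "smooth_fun_on (base B) U (\<lambda>x. \<tau> (sec_scale B f s x) i)" if U: "(U, \<tau>) \<in> trivs B" and i: "i < frank B" for U \<tau> i
  proof -
    note lt = triv_local_triv[OF U]
    have "smooth_fun_on (base B) U (\<lambda>x. f x * \<tau> (s x) i)"
      using assms lt i local_triv_subset[OF lt]
      by (intro smooth_fun_on_mult[OF M] section_component_smooth smooth_fun_on_subset[OF M assms(1)])
    then show ?thesis
    proof (rule smooth_fun_on_cong[OF M local_triv_open[OF lt], rotated])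
      fix x assume x: "x \<in> U"
      then show "f x * \<tau> (s x) i = \<tau> (sec_scale B f s x) i"
        using local_triv_linear(3)[OF lt x section_in_fibre] assms local_triv_subset[OF lt]
        by (auto simp: sec_scale_def)
    qed
  qed
  then show ?thesis unfolding sections_iff using assms section_in_fibre fibre_closed by (auto simp: sec_scale_def)
qed

lemma sec_zero_sections: "sec_zero B \<in> sections B"
proof -
  note M = vbundle_manifold
  have "smooth_fun_on (base B) U (\<lambda>x. \<tau> (sec_zero B x) i)" if U: "(U, \<tau>) \<in> trivs B" for U \<tau> i
    by (rule smooth_fun_on_cong[OF M local_triv_open[OF triv_local_triv[OF U]] _ smooth_fun_on_const[OF M, of _ 0]])
      (use local_triv_linear(1)[OF triv_local_triv[OF U]] local_triv_subset[OF triv_local_triv[OF U]] in \<open>auto simp: sec_zero_def\<close>)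
  then show ?thesis unfolding sections_iff using fibre_closed(1) by (auto simp: sec_zero_def)
qed

text \<open>The \<open>j\<close>-th frame vector of the trivialization times \<psi>, extended by the
  zero section. Over \<open>W\<close> it vanishes, so the two descriptions agree on the
  overlap.\<close>

lemma frame_section:
  assumes lt: "local_triv B V \<tau>" and \<psi>: "\<psi> \<in> smooth_functions (base B)"
    and W: "openin (mtop (base B)) W" "V \<union> W = points (base B)" "\<And>y. y \<in> W \<Longrightarrow> \<psi> y = 0"
    and j: "j < frank B"
  obtains s where "s \<in> sections B" "\<And>y i. y \<in> V \<Longrightarrow> \<tau> (s y) i = (if i = j then \<psi> y else 0)"
proof -
  note M = vbundle_manifold
  define c where "c y = (\<lambda>i. if i = j then \<psi> y else 0)" for y
  define s where "s = (\<lambda>y\<in>points (base B). if y \<in> V then inv_into (fibre B y) \<tau> (c y) else fzero B y)"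
  have cE: "c y \<in> topspace (Euclidean_space (frank B))" for y
    using j by (auto simp: c_def topspace_Euclidean_space)
  have sV: "s y \<in> fibre B y" "\<tau> (s y) = c y" if "y \<in> V" for y
    using that local_triv_subset[OF lt] cE[of y] bij_betw_imp_surj_on[OF local_triv_bij[OF lt that]]
    by (auto simp: s_def inv_into_into f_inv_into_f)
  have sf: "s y \<in> fibre B y" if "y \<in> points (base B)" for y
  proof (cases "y \<in> V")
    case False
    then show ?thesis using that fibre_closed(1) by (simp add: s_def)
  qed (rule sV(1))
  have sW: "s y = fzero B y" if y: "y \<in> W" for y
  proof (cases "y \<in> V")
    case True
    then show ?thesis
      using y W sV[OF True] fibre_closed(1)[of y] local_triv_linear(1)[OF lt True]
      by (intro local_triv_eqI[OF lt True]) (auto simp: c_def)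
  qed (use y W in \<open>auto simp: s_def\<close>)
  have "smooth_fun_on (base B) U (\<lambda>x. \<sigma> (s x) i)" if U: "(U, \<sigma>) \<in> trivs B" and i: "i < frank B" for U \<sigma> i
  proof (rule smooth_fun_on_local[OF M local_triv_open[OF triv_local_triv[OF U]]])
    note lu = triv_local_triv[OF U]
    fix x assume x: "x \<in> U"
    show "\<exists>A. openin (mtop (base B)) A \<and> x \<in> A \<and> smooth_fun_on (base B) A (\<lambda>x. \<sigma> (s x) i)"
    proof (cases "x \<in> V")
      case True
      have oVU: "openin (mtop (base B)) (V \<inter> U)" using local_triv_open[OF lt] local_triv_open[OF lu] by blast
      obtain g where g: "\<And>i j. i < frank B \<Longrightarrow> j < frank B \<Longrightarrow> smooth_fun_on (base B) (V \<inter> U) (g i j)"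
        "\<And>x e i. x \<in> V \<inter> U \<Longrightarrow> e \<in> fibre B x \<Longrightarrow> i < frank B \<Longrightarrow> \<sigma> e i = (\<Sum>j<frank B. g i j x * \<tau> e j)"
        using local_triv_transition(2)[OF lt U] unfolding smooth_transition_def by blast
      have "V \<inter> U \<subseteq> points (base B)" using local_triv_subset[OF lt] by blast
      then have "smooth_fun_on (base B) (V \<inter> U) (\<lambda>x. g i j x * \<psi> x)"
        by (intro smooth_fun_on_mult[OF M] g(1) i j smooth_functionsD[OF M \<psi>])
      then have "smooth_fun_on (base B) (V \<inter> U) (\<lambda>x. \<sigma> (s x) i)"
      proof (rule smooth_fun_on_cong[OF M oVU, rotated])
        fix x assume x: "x \<in> V \<inter> U"
        have "\<sigma> (s x) i = (\<Sum>k<frank B. g i k x * c x k)"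
          using g(2)[OF x sV(1) i] sV(2) x by auto
        also have "\<dots> = (\<Sum>k<frank B. if k = j then g i k x * \<psi> x else 0)"
          by (intro sum.cong) (auto simp: c_def)
        also have "\<dots> = g i j x * \<psi> x" using j by simp
        finally show "g i j x * \<psi> x = \<sigma> (s x) i" by simp
      qed
      then show ?thesis using oVU True x by blast
    next
      case False
      then have xW: "x \<in> W" using x W(2) local_triv_subset[OF lu] by blast
      have oWU: "openin (mtop (base B)) (W \<inter> U)" using W(1) local_triv_open[OF lu] by blast
      have "smooth_fun_on (base B) (W \<inter> U) (\<lambda>x. \<sigma> (s x) i)"
        by (rule smooth_fun_on_cong[OF M oWU _ smooth_fun_on_const[OF M, of _ 0]])
          (use sW local_triv_linear(1)[OF lu] in auto)
      then show ?thesis using oWU xW x by blast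
    qed
  qed
  then have "s \<in> sections B" unfolding sections_iff using sf by (auto simp: s_def)
  then show thesis using that[of s] sV(2) by (auto simp: c_def)
qed

lemma sections_eqI:
  assumes "s \<in> sections B" "t \<in> sections B"
    and "\<And>V \<tau> x i. local_triv B V \<tau> \<Longrightarrow> x \<in> V \<Longrightarrow> i < frank B \<Longrightarrow> \<tau> (s x) i = \<tau> (t x) i"
  shows "s = t"
proof (rule extensionalityI[of _ "points (base B)"])
  fix x assume x: "x \<in> points (base B)"
  obtain U \<tau> where U: "(U, \<tau>) \<in> trivs B" "x \<in> U" using triv_cover[OF x] by blast
  note lt = triv_local_triv[OF U(1)]
  show "s x = t x"
    by (rule local_triv_eqI[OF lt U(2)]) (use section_in_fibre assms x assms(3)[OF lt U(2)] in auto)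
qed (use assms sections_iff in blast)+

lemma sec_component:
  assumes "local_triv B V \<tau>" "x \<in> V" "s \<in> sections B"
  shows "t \<in> sections B \<Longrightarrow> \<tau> (sec_add B s t x) i = \<tau> (s x) i + \<tau> (t x) i"
    and "\<tau> (sec_scale B f s x) i = f x * \<tau> (s x) i"
    and "\<tau> (sec_zero B x) i = 0"
  using local_triv_linear[OF assms(1,2)] local_triv_subset[OF assms(1)] assms(2,3) section_in_fibre
  by (auto simp: sec_add_def sec_scale_def sec_zero_def)

end

section \<open>Forms\<close>

lemma tuples_1: "Zs \<in> tuples B 1 \<longleftrightarrow> (\<exists>Z\<in>sections B. Zs = [Z])"
  by (auto simp: tuples_def length_Suc_conv)

lemma tuples_2: "Zs \<in> tuples B 2 \<longleftrightarrow> (\<exists>Z\<in>sections B. \<exists>W\<in>sections B. Zs = [Z, W])"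
  by (auto simp: tuples_def length_Suc_conv numeral_2_eq_2)

text \<open>The common form of components of sections, one-forms and d\<Theta> with one argument
  fixed, all evaluated at \<open>x\<close>. A section is described near \<open>x\<close> by the
  values of such functionals on it, which allows d\<Theta> to be expanded without being realised as
  a map on the fibre.\<close>

definition pointwise_functional :: "('e, 'b) vbundle \<Rightarrow> 'b \<Rightarrow> (('b \<Rightarrow> 'e) \<Rightarrow> real) \<Rightarrow> bool" where
  "pointwise_functional B x \<kappa> \<longleftrightarrow>
     (\<forall>Z\<in>sections B. \<forall>W\<in>sections B. \<kappa> (sec_add B Z W) = \<kappa> Z + \<kappa> W) \<and>
     (\<forall>Z\<in>sections B. \<forall>f\<in>smooth_functions (base B). \<kappa> (sec_scale B f Z) = f x * \<kappa> Z)"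

lemma pointwise_functionalD:
  assumes "pointwise_functional B x \<kappa>" "Z \<in> sections B"
  shows "W \<in> sections B \<Longrightarrow> \<kappa> (sec_add B Z W) = \<kappa> Z + \<kappa> W"
    and "f \<in> smooth_functions (base B) \<Longrightarrow> \<kappa> (sec_scale B f Z) = f x * \<kappa> Z"
  using assms unfolding pointwise_functional_def by blast+

lemma pointwise_functional_sum:
  "(\<And>i. i \<in> I \<Longrightarrow> pointwise_functional B x (\<kappa> i)) \<Longrightarrow> pointwise_functional B x (\<lambda>Z. \<Sum>i\<in>I. c i * \<kappa> i Z)"
  unfolding pointwise_functional_def
  by (auto simp: sum.distrib[symmetric] sum_distrib_left algebra_simps intro!: sum.cong)

lemma pointwise_functional_scale:
  "pointwise_functional B x \<kappa> \<Longrightarrow> pointwise_functional B x (\<lambda>Z. c * \<kappa> Z)"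
  unfolding pointwise_functional_def by (auto simp: algebra_simps)

lemma pointwise_functional_diff:
  "pointwise_functional B x \<kappa> \<Longrightarrow> pointwise_functional B x \<mu> \<Longrightarrow> pointwise_functional B x (\<lambda>Z. \<kappa> Z - \<mu> Z)"
  unfolding pointwise_functional_def by (auto simp: algebra_simps)

text \<open>Forms take lists of sections and are extensional. This wraps a function of a single
  section accordingly.\<close>

definition one_form :: "('e, 'b) vbundle \<Rightarrow> (('b \<Rightarrow> 'e) \<Rightarrow> 'b \<Rightarrow> real) \<Rightarrow> ('e, 'b) form" where
  "one_form B F = (\<lambda>Zs\<in>tuples B 1. \<lambda>x\<in>points (base B). F (hd Zs) x)"

lemma one_form_apply:
  "Z \<in> sections B \<Longrightarrow> one_form B F [Z] = (\<lambda>x\<in>points (base B). F Z x)"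
  using tuples_1[of "[Z]" B] by (simp add: one_form_def)

text \<open>Two positions admit two (1,1)-shuffles. The one that puts position 1 first has a single
  inversion, whence the minus sign.\<close>

lemma wedge_1_1:
  assumes "Z \<in> sections B" "W \<in> sections B" "x \<in> points (base B)"
  shows "wedge B 1 1 \<omega> \<theta> [Z, W] x = \<omega> [Z] x * \<theta> [W] x - \<omega> [W] x * \<theta> [Z] x"
proof -
  have "A \<in> {{0}, {1}}" if "A \<subseteq> {..<2}" "card A = 1" for A :: "nat set"
    using that by (auto simp: card_1_singleton_iff less_2_cases_iff)
  then have sub: "{A. A \<subseteq> {..<2} \<and> card A = 1} = {{0}, {1 :: nat}}"
    by (intro subset_antisym subsetI) (auto simp: numeral_2_eq_2)
  have s0: "{(i, j). i \<in> {0 :: nat} \<and> j \<in> {..<2} - {0} \<and> j < i} = {}"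
    and s1: "{(i, j). i \<in> {1 :: nat} \<and> j \<in> {..<2} - {1} \<and> j < i} = {(1, 0)}"
    by auto
  have sign: "shuffle_sign 2 {0} = 1" "shuffle_sign 2 {1} = -1"
    unfolding shuffle_sign_def s0 s1 by simp_all
  have "[Z, W] \<in> tuples B (1 + 1)" using assms by (simp add: tuples_def)
  then show ?thesis
    using assms(3) sign by (simp add: wedge_def sub nths_Cons del: One_nat_def)
qed

lemma ext_diff_1:
  assumes "Z \<in> sections B" "W \<in> sections B" "x \<in> points (base B)"
  shows "ext_diff B a br 1 \<omega> [Z, W] x =
    vf_apply (base B) (a Z) (\<omega> [W]) x - vf_apply (base B) (a W) (\<omega> [Z]) x - \<omega> [br Z W] x"
proof -
  have "[Z, W] \<in> tuples B (Suc 1)" using assms by (simp add: tuples_def)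
  moreover have "{..1 :: nat} = {0, 1}" by auto
  moreover have "{..<1 :: nat} = {0}" "{..<0 :: nat} = {}" by auto
  ultimately show ?thesis
    using assms(3) by (simp add: ext_diff_def nths_Cons del: One_nat_def)
qed

context
  fixes B :: "('e, 'b) vbundle"
  assumes B: "vector_bundle B"
begin

lemma const_smooth_function: "(\<lambda>x\<in>points (base B). c) \<in> smooth_functions (base B)"
  by (simp add: smooth_functions_restrict[OF vbundle_manifold[OF B]] smooth_fun_on_const[OF vbundle_manifold[OF B]])

lemma sec_scale_in_sections: "f \<in> smooth_functions (base B) \<Longrightarrow> Z \<in> sections B \<Longrightarrow> sec_scale B f Z \<in> sections B"
  by (rule sec_scale_sections[OF B]) (simp_all add: smooth_functions_def)

text \<open>\<open>forms\<close> expresses linearity by one clause for combinations of two sections.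
  The constants 1 and 0 as coefficients separate it into additivity and homogeneity.\<close>

lemma sec_lincomb:
  assumes "Z \<in> sections B" "W \<in> sections B"
  shows "sec_add B (sec_scale B (\<lambda>x\<in>points (base B). 1) Z) (sec_scale B (\<lambda>x\<in>points (base B). 1) W) = sec_add B Z W"
    and "f \<in> smooth_functions (base B) \<Longrightarrow>
      sec_add B (sec_scale B f Z) (sec_scale B (\<lambda>x\<in>points (base B). 0) Z) = sec_scale B f Z"
proof -
  note cl = sec_scale_in_sections const_smooth_function sec_add_sections[OF B] assms
  show "sec_add B (sec_scale B (\<lambda>x\<in>points (base B). 1) Z) (sec_scale B (\<lambda>x\<in>points (base B). 1) W) = sec_add B Z W"
  proof (rule sections_eqI[OF B])
    fix V \<tau> x i assume lt: "local_triv B V \<tau>" "x \<in> V"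
    then have "x \<in> points (base B)" using local_triv_subset[OF B] by blast
    then show "\<tau> (sec_add B (sec_scale B (\<lambda>x\<in>points (base B). 1) Z) (sec_scale B (\<lambda>x\<in>points (base B). 1) W) x) i
      = \<tau> (sec_add B Z W x) i" by (simp add: sec_component[OF B lt] cl)
  qed (intro cl)+
  assume f: "f \<in> smooth_functions (base B)"
  show "sec_add B (sec_scale B f Z) (sec_scale B (\<lambda>x\<in>points (base B). 0) Z) = sec_scale B f Z"
  proof (rule sections_eqI[OF B])
    fix V \<tau> x i assume lt: "local_triv B V \<tau>" "x \<in> V"
    then have "x \<in> points (base B)" using local_triv_subset[OF B] by blast
    then show "\<tau> (sec_add B (sec_scale B f Z) (sec_scale B (\<lambda>x\<in>points (base B). 0) Z) x) i
      = \<tau> (sec_scale B f Z x) i" by (simp add: sec_component[OF B lt] cl f)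
  qed (intro cl f)+
qed

lemma pointwise_functional_zero:
  assumes "pointwise_functional B x \<kappa>"
  shows "\<kappa> (sec_zero B) = 0"
proof -
  note z = sec_zero_sections[OF B]
  have "sec_add B (sec_zero B) (sec_zero B) = sec_zero B"
    by (rule sections_eqI[OF B sec_add_sections[OF B z z] z]) (simp add: sec_component[OF B _ _ z] z)
  then show ?thesis using pointwise_functionalD(1)[OF assms z z] by simp
qed

lemma pointwise_functional_component:
  assumes "local_triv B V \<tau>" "x \<in> V"
  shows "pointwise_functional B x (\<lambda>Z. \<tau> (Z x) i)"
  unfolding pointwise_functional_def by (auto simp: sec_component[OF B assms])

lemma one_form_in_forms:
  assumes sm: "\<And>Z. Z \<in> sections B \<Longrightarrow> smooth_fun_on (base B) (points (base B)) (F Z)"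
    and lin: "\<And>x. x \<in> points (base B) \<Longrightarrow> pointwise_functional B x (\<lambda>Z. F Z x)"
  shows "one_form B F \<in> forms B 1"
  unfolding forms_def
proof (intro CollectI conjI ballI allI impI)
  show "one_form B F \<in> extensional (tuples B 1)" by (simp add: one_form_def)
next
  fix Zs assume "Zs \<in> tuples B 1"
  then obtain Z where "Z \<in> sections B" "Zs = [Z]" unfolding tuples_1 by blast
  then show "one_form B F Zs \<in> smooth_functions (base B)"
    by (simp add: one_form_apply smooth_functions_restrict[OF vbundle_manifold[OF B]] sm)
next
  fix Zs and i :: nat and Z W f g
  assume "Zs \<in> tuples B 1" "i < 1" and ZW: "Z \<in> sections B" "W \<in> sections B"
    and fg: "f \<in> smooth_functions (base B)" "g \<in> smooth_functions (base B)"
  then obtain Z' where "Zs = [Z']" unfolding tuples_1 by blast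
  then show "one_form B F (Zs[i := sec_add B (sec_scale B f Z) (sec_scale B g W)]) =
     (\<lambda>x\<in>points (base B). f x * one_form B F (Zs[i := Z]) x + g x * one_form B F (Zs[i := W]) x)"
    using ZW fg \<open>i < 1\<close> sec_scale_in_sections sec_add_sections[OF B]
    by (auto simp: one_form_apply pointwise_functionalD[OF lin] fun_eq_iff)
qed auto

lemma form_smooth: "\<omega> \<in> forms B 1 \<Longrightarrow> Z \<in> sections B \<Longrightarrow> \<omega> [Z] \<in> smooth_functions (base B)"
  by (simp add: forms_def tuples_1 del: One_nat_def)

lemma pointwise_functional_form:
  assumes \<omega>: "\<omega> \<in> forms B 1" and x: "x \<in> points (base B)"
  shows "pointwise_functional B x (\<lambda>Z. \<omega> [Z] x)"
proof -
  have lin: "\<omega> [sec_add B (sec_scale B f Z) (sec_scale B g W)] x = f x * \<omega> [Z] x + g x * \<omega> [W] x"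
    if "Z \<in> sections B" "W \<in> sections B" "f \<in> smooth_functions (base B)" "g \<in> smooth_functions (base B)" for f g Z W
  proof -
    have "[Z] \<in> tuples B 1" using that by (simp add: tuples_1 del: One_nat_def)
    then have "\<omega> ([Z][0 := sec_add B (sec_scale B f Z) (sec_scale B g W)]) =
        (\<lambda>x\<in>points (base B). f x * \<omega> ([Z][0 := Z]) x + g x * \<omega> ([Z][0 := W]) x)"
      using \<omega> that unfolding forms_def by blast
    then show ?thesis using x by simp
  qed
  show ?thesis unfolding pointwise_functional_def
  proof (intro conjI ballI)
    fix Z W assume ZW: "Z \<in> sections B" "W \<in> sections B"
    show "\<omega> [sec_add B Z W] x = \<omega> [Z] x + \<omega> [W] x"
      using lin[OF ZW const_smooth_function[of 1] const_smooth_function[of 1]] x sec_lincomb(1)[OF ZW] by simp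
  next
    fix Z f assume Z: "Z \<in> sections B" and f: "f \<in> smooth_functions (base B)"
    show "\<omega> [sec_scale B f Z] x = f x * \<omega> [Z] x"
      using lin[OF Z Z f const_smooth_function[of 0]] x sec_lincomb(2)[OF Z Z f] by simp
  qed
qed

lemma form_zero_in_forms: "form_zero B q \<in> forms B q"
proof -
  have upd: "Zs[i := Z] \<in> tuples B q" if "Zs \<in> tuples B q" "Z \<in> sections B" for Zs i Z
    using that set_update_subset_insert[of Zs i Z] by (auto simp: tuples_def)
  show ?thesis
    unfolding forms_def
    by (auto simp: form_zero_def upd const_smooth_function sec_add_sections[OF B] sec_scale_in_sections)
qed

section \<open>Coframes and annihilating forms\<close>

lemma coframe_form:
  assumes lt: "local_triv B V \<tau>" and \<psi>: "\<psi> \<in> smooth_functions (base B)"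
    and W: "openin (mtop (base B)) W" "V \<union> W = points (base B)" "\<And>y. y \<in> W \<Longrightarrow> \<psi> y = 0"
    and i: "i < frank B"
  shows "one_form B (\<lambda>Z y. if y \<in> V then \<psi> y * \<tau> (Z y) i else 0) \<in> forms B 1"
proof (rule one_form_in_forms)
  note M = vbundle_manifold[OF B]
  fix Z assume "Z \<in> sections B"
  from smooth_cutoff[OF M \<psi> local_triv_open[OF B lt] W section_component_smooth[OF B this lt i] openin_points[OF M]]
  show "smooth_fun_on (base B) (points (base B)) (\<lambda>y. if y \<in> V then \<psi> y * \<tau> (Z y) i else 0)" .
next
  fix x
  show "pointwise_functional B x (\<lambda>Z. if x \<in> V then \<psi> x * \<tau> (Z x) i else 0)"
  proof (cases "x \<in> V")
    case True
    then show ?thesis using pointwise_functional_scale[OF pointwise_functional_component[OF lt True]] by simp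
  next
    case False
    then show ?thesis by (simp add: pointwise_functional_def)
  qed
qed

text \<open>In an adapted trivialization the coordinates from index \<open>r\<close> on vanish on
  \<open>E\<close>; the cutoff makes them global forms.\<close>

lemma coframe_annihilator:
  assumes lt: "local_triv B V \<tau>" and \<psi>: "\<psi> \<in> smooth_functions (base B)"
    and W: "openin (mtop (base B)) W" "V \<union> W = points (base B)" "\<And>y. y \<in> W \<Longrightarrow> \<psi> y = 0"
    and i: "i < frank B" "r \<le> i"
    and E: "\<And>y. y \<in> V \<Longrightarrow> E \<inter> fibre B y = {e \<in> fibre B y. \<forall>i\<ge>r. \<tau> e i = 0}"
  shows "one_form B (\<lambda>Z y. if y \<in> V then \<psi> y * \<tau> (Z y) i else 0) \<in> annihilator_sections B E"
  unfolding annihilator_sections_def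
proof (intro CollectI conjI ballI coframe_form[OF lt \<psi> W i(1)])
  fix S assume "S \<in> sections_in B E"
  then have S: "S \<in> sections B" "\<And>x. x \<in> points (base B) \<Longrightarrow> S x \<in> E" by (auto simp: sections_in_def)
  have "\<tau> (S x) i = 0" if x: "x \<in> V" for x
    using E[OF x] S(2) section_in_fibre[OF B S(1)] local_triv_subset[OF B lt] x i(2) by blast
  then show "one_form B (\<lambda>Z y. if y \<in> V then \<psi> y * \<tau> (Z y) i else 0) [S] = (\<lambda>x\<in>points (base B). 0)"
    using S(1) by (auto simp: one_form_apply)
qed

text \<open>At \<open>x\<close> the cut-off coordinate forms read off the adapted coordinates of
  \<open>Z x\<close>, because the bump is 1 there.\<close>

lemma annihilator_detects:
  assumes E: "subbundle B r E" and Z: "Z \<in> sections B"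
    and ann: "\<And>\<omega> x. \<omega> \<in> annihilator_sections B E \<Longrightarrow> x \<in> points (base B) \<Longrightarrow> \<omega> [Z] x = 0"
  shows "Z \<in> sections_in B E"
  unfolding sections_in_def
proof (intro CollectI conjI ballI Z)
  note M = vbundle_manifold[OF B]
  fix x assume x: "x \<in> points (base B)"
  obtain V \<tau> where V: "x \<in> V" "local_triv B V \<tau>" "\<And>y. y \<in> V \<Longrightarrow> E \<inter> fibre B y = {e \<in> fibre B y. \<forall>i\<ge>r. \<tau> e i = 0}"
    using E x unfolding subbundle_def by meson
  obtain \<psi> O' W where "bump_on (base B) V x \<psi> O' W"
    by (rule bump_function[OF M local_triv_open[OF B V(2)] V(1)])
  note \<psi> = bump_onD[OF this]
  have "\<tau> (Z x) i = 0" if "i \<ge> r" for i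
  proof (cases "i < frank B")
    case True
    have "one_form B (\<lambda>Z y. if y \<in> V then \<psi> y * \<tau> (Z y) i else 0) [Z] x = 0"
      by (rule ann[OF coframe_annihilator[OF V(2) \<psi>(1,6,7,8) True that V(3)] x])
    then show ?thesis using Z x V(1) \<psi>(3,5) by (simp add: one_form_apply)
  next
    case False
    then show ?thesis using local_triv_Euclidean[OF B V(2,1) section_in_fibre[OF B Z x]]
      by (simp add: topspace_Euclidean_space)
  qed
  then show "Z x \<in> E" using V(3)[OF V(1)] section_in_fibre[OF B Z x] by blast
qed

lemma glue_one_forms:
  fixes g :: "nat \<Rightarrow> 'b \<Rightarrow> real"
  assumes "\<And>n. g n \<in> smooth_functions (base B)" "\<And>n. \<omega> n \<in> forms B 1"
    and "\<And>x. x \<in> points (base B) \<Longrightarrow> \<exists>A m. openin (mtop (base B)) A \<and> x \<in> A \<and> (\<forall>y\<in>A. \<forall>n>m. g n y = 0)"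
  shows "one_form B (\<lambda>Z x. \<Sum>n | g n x \<noteq> 0. g n x * \<omega> n [Z] x) \<in> forms B 1"
proof (rule one_form_in_forms)
  note M = vbundle_manifold[OF B]
  fix Z assume Z: "Z \<in> sections B"
  show "smooth_fun_on (base B) (points (base B)) (\<lambda>x. \<Sum>n | g n x \<noteq> 0. g n x * \<omega> n [Z] x)"
    by (rule locally_finite_sum_smooth[OF M assms(1) _ assms(3)])
      (use form_smooth[OF assms(2) Z] in \<open>auto simp: smooth_functions_def\<close>)
next
  fix x assume "x \<in> points (base B)"
  then show "pointwise_functional B x (\<lambda>Z. \<Sum>n | g n x \<noteq> 0. g n x * \<omega> n [Z] x)"
    by (intro pointwise_functional_sum pointwise_functional_form assms(2))
qed

section \<open>The ideal generated by one-forms\<close>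

lemma nths_tuples:
  assumes "Zs \<in> tuples B (q + s)" "A \<subseteq> {..<q + s}" "card A = q"
  shows "nths Zs A \<in> tuples B q" "nths Zs (- A) \<in> tuples B s"
proof -
  have len: "length Zs = q + s" and sub: "set Zs \<subseteq> sections B" using assms(1) by (auto simp: tuples_def)
  have "{i. i < length Zs \<and> i \<in> A} = A" using assms(2) len by auto
  then have "length (nths Zs A) = q" using assms(3) by (simp add: length_nths)
  moreover have "{i. i < length Zs \<and> i \<in> - A} = {..<q + s} - A" using len by auto
  then have "length (nths Zs (- A)) = s"
    using assms(2,3) card_Diff_subset[of A "{..<q + s}"] finite_subset[OF assms(2)] by (simp add: length_nths)
  ultimately show "nths Zs A \<in> tuples B q" "nths Zs (- A) \<in> tuples B s"
    using sub set_nths_subset[of Zs] by (auto simp: tuples_def)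
qed

lemma wedge_form_zero:
  "wedge B q s (form_zero B q) \<theta> = form_zero B (q + s)" "wedge B q s \<omega> (form_zero B s) = form_zero B (q + s)"
proof -
  have "form_zero B q (nths Zs A) x = 0" "form_zero B s (nths Zs (- A)) x = 0"
    if "Zs \<in> tuples B (q + s)" "A \<subseteq> {..<q + s}" "card A = q" "x \<in> points (base B)" for Zs A x
    using nths_tuples[OF that(1-3)] that(4) by (simp_all add: form_zero_def)
  then show "wedge B q s (form_zero B q) \<theta> = form_zero B (q + s)" "wedge B q s \<omega> (form_zero B s) = form_zero B (q + s)"
    by (auto simp: wedge_def form_zero_def[of B "q + s"] fun_eq_iff restrict_def intro!: sum.neutral)
qed

text \<open>Among the summands of the product, only \<open>i = 1\<close> in degree
  \<open>k = 2\<close> has two nonzero factors to offer.\<close>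

lemma homogeneous_mult:
  "homogeneous B 1 \<omega> \<otimes>\<^bsub>exterior_algebra B\<^esub> homogeneous B 1 \<theta> = homogeneous B 2 (wedge B 1 1 \<omega> \<theta>)"
proof
  fix k
  let ?w = "\<lambda>i. wedge B i (k - i) (homogeneous B 1 \<omega> i) (homogeneous B 1 \<theta> (k - i))"
  have zero: "?w i = form_zero B k" if "i \<le> k" "\<not> (i = 1 \<and> k = 2)" for i
  proof (cases "i = 1")
    case True
    then have "k - i \<noteq> 1" using that by auto
    then show ?thesis using wedge_form_zero(2)[of i "k - i"] that(1) by (simp add: homogeneous_def)
  next
    case False
    then show ?thesis using wedge_form_zero(1)[of i "k - i"] that(1) by (simp add: homogeneous_def)
  qed
  have z0: "form_zero B k Zs x = 0" if "Zs \<in> tuples B k" "x \<in> points (base B)" for Zs x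
    using that by (simp add: form_zero_def)
  have "form_sum B k {..k} ?w Zs x = homogeneous B 2 (wedge B 1 1 \<omega> \<theta>) k Zs x" for Zs x
  proof (cases "Zs \<in> tuples B k \<and> x \<in> points (base B)")
    case True
    show ?thesis
    proof (cases "k = 2")
      case k: True
      have "(\<Sum>i\<le>k. ?w i Zs x) = (\<Sum>i\<in>{1}. ?w i Zs x)"
        using zero z0 True k by (intro sum.mono_neutral_right) auto
      then show ?thesis using True k by (simp add: form_sum_def homogeneous_def)
    next
      case False
      then show ?thesis using True zero z0 by (auto simp: form_sum_def homogeneous_def intro!: sum.neutral)
    qed
  next
    case False
    have "Zs \<in> tuples B (1 + 1) \<longleftrightarrow> Zs \<in> tuples B 2" by (simp add: numeral_2_eq_2)
    then show ?thesis
      using False by (auto simp: form_sum_def homogeneous_def form_zero_def wedge_def restrict_def)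
  qed
  then have "form_sum B k {..k} ?w = homogeneous B 2 (wedge B 1 1 \<omega> \<theta>) k" by (intro ext)
  then show "(homogeneous B 1 \<omega> \<otimes>\<^bsub>exterior_algebra B\<^esub> homogeneous B 1 \<theta>) k = homogeneous B 2 (wedge B 1 1 \<omega> \<theta>) k"
    by (simp add: exterior_algebra_def)
qed

lemma homogeneous_carrier: "\<omega> \<in> forms B q \<Longrightarrow> homogeneous B q \<omega> \<in> carrier (exterior_algebra B)"
  using form_zero_in_forms finite_subset[of "{k. homogeneous B q \<omega> k \<noteq> form_zero B k}" "{q}"]
  by (auto simp: exterior_algebra_def homogeneous_def)

text \<open>No ring axioms have to be verified for \<open>exterior_algebra B\<close>, since every ideal in the
  intersection that defines \<open>Idl\<close> comes with them.\<close>

lemma sum_wedge_in_genideal: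
  assumes "finite I" "\<And>\<beta>. \<beta> \<in> I \<Longrightarrow> \<omega> \<beta> \<in> forms B 1" "\<And>\<beta>. \<beta> \<in> I \<Longrightarrow> \<theta> \<beta> \<in> S"
  shows "homogeneous B 2 (form_sum B 2 I (\<lambda>\<beta>. wedge B 1 1 (\<omega> \<beta>) (\<theta> \<beta>)))
    \<in> Idl\<^bsub>exterior_algebra B\<^esub> (homogeneous B 1 ` S)"
  unfolding genideal_def
proof (intro InterI, clarify)
  let ?R = "exterior_algebra B"
  fix J assume J: "ideal J ?R" and S: "homogeneous B 1 ` S \<subseteq> J"
  interpret ideal J ?R by (rule J)
  show "homogeneous B 2 (form_sum B 2 I (\<lambda>\<beta>. wedge B 1 1 (\<omega> \<beta>) (\<theta> \<beta>))) \<in> J"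
    using assms
  proof (induction I rule: finite_induct)
    case empty
    have "homogeneous B 2 (form_sum B 2 {} (\<lambda>\<beta>. wedge B 1 1 (\<omega> \<beta>) (\<theta> \<beta>))) = \<zero>\<^bsub>?R\<^esub>"
      by (auto simp: homogeneous_def form_sum_def form_zero_def exterior_algebra_def fun_eq_iff)
    then show ?case using zero_closed by simp
  next
    case (insert \<beta> I)
    let ?w = "\<lambda>\<beta>. wedge B 1 1 (\<omega> \<beta>) (\<theta> \<beta>)"
    have "homogeneous B 1 (\<omega> \<beta>) \<otimes>\<^bsub>?R\<^esub> homogeneous B 1 (\<theta> \<beta>) \<in> J"
      using insert.prems S homogeneous_carrier by (intro I_l_closed) auto
    then have 1: "homogeneous B 2 (?w \<beta>) \<in> J" unfolding homogeneous_mult .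
    have 2: "homogeneous B 2 (form_sum B 2 I ?w) \<in> J" using insert by auto
    have "homogeneous B 2 (form_sum B 2 (insert \<beta> I) ?w) = homogeneous B 2 (?w \<beta>) \<oplus>\<^bsub>?R\<^esub> homogeneous B 2 (form_sum B 2 I ?w)"
      using insert.hyps by (auto simp: homogeneous_def form_sum_def form_zero_def exterior_algebra_def fun_eq_iff)
    then show ?case using additive_subgroup.a_closed[OF is_additive_subgroup 1 2] by simp
  qed
qed

end

lemma left_inverse_right_inverse:
  fixes A C :: "nat \<Rightarrow> nat \<Rightarrow> real"
  assumes "\<And>i j. i < n \<Longrightarrow> j < n \<Longrightarrow> (\<Sum>k<n. A i k * C k j) = (if i = j then 1 else 0)"
    and "i < n" "j < n"
  shows "(\<Sum>k<n. C i k * A k j) = (if i = j then 1 else 0)"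
proof -
  let ?A = "mat n n (\<lambda>(i, j). A i j)" and ?C = "mat n n (\<lambda>(i, j). C i j)"
  have prod: "(mat n n (\<lambda>(i, j). P i j) * mat n n (\<lambda>(i, j). Q i j)) $$ (i, j) = (\<Sum>k<n. P i k * Q k j)"
    if "i < n" "j < n" for P Q :: "nat \<Rightarrow> nat \<Rightarrow> real" and i j
    using that by (simp add: scalar_prod_def atLeast0LessThan)
  have "?A * ?C = 1\<^sub>m n" by (rule eq_matI) (simp_all add: prod assms(1) del: index_mult_mat(1))
  then have "?C * ?A = 1\<^sub>m n" by (intro mat_mult_left_right_inverse[of ?A n ?C]) auto
  then show ?thesis using prod[OF assms(2,3), of C A] assms(2,3) by simp
qed

section \<open>Brackets with an anchor\<close>

text \<open>
  The anchor is only assumed to be linear over functions up to a point map \<open>t\<close>: by the definition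
  of \<open>pb_anchor\<close>, the vector field of \<open>Z\<close> at \<open>x\<close> depends on the value of \<open>Z\<close> at
  \<open>h\<inverse> (\<eta>\<inverse> x)\<close>, which need not be \<open>x\<close>.
\<close>

locale anchored_bracket =
  fixes B :: "('e, 'b) vbundle" and a :: "('b \<Rightarrow> 'e) \<Rightarrow> 'b \<Rightarrow> 'b \<times> 'b deriv"
    and br :: "('b \<Rightarrow> 'e) \<Rightarrow> ('b \<Rightarrow> 'e) \<Rightarrow> 'b \<Rightarrow> 'e" and t :: "'b \<Rightarrow> 'b"
  assumes B: "vector_bundle B"
    and br_closed: "Z \<in> sections B \<Longrightarrow> W \<in> sections B \<Longrightarrow> br Z W \<in> sections B"
    and br_add: "Z \<in> sections B \<Longrightarrow> Z' \<in> sections B \<Longrightarrow> W \<in> sections B \<Longrightarrow>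
      br (sec_add B Z Z') W = sec_add B (br Z W) (br Z' W)"
      "Z \<in> sections B \<Longrightarrow> Z' \<in> sections B \<Longrightarrow> W \<in> sections B \<Longrightarrow>
      br W (sec_add B Z Z') = sec_add B (br W Z) (br W Z')"
    and br_self: "Z \<in> sections B \<Longrightarrow> br Z Z = sec_zero B"
    and br_scale: "Z \<in> sections B \<Longrightarrow> W \<in> sections B \<Longrightarrow> f \<in> smooth_functions (base B) \<Longrightarrow>
      br Z (sec_scale B f W) = sec_add B (sec_scale B f (br Z W)) (sec_scale B (vf_apply (base B) (a Z) f) W)"
    and t_closed: "x \<in> points (base B) \<Longrightarrow> t x \<in> points (base B)"
    and anchor_add: "Z \<in> sections B \<Longrightarrow> W \<in> sections B \<Longrightarrow> x \<in> points (base B) \<Longrightarrow>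
      vf_apply (base B) (a (sec_add B Z W)) f x = vf_apply (base B) (a Z) f x + vf_apply (base B) (a W) f x"
    and anchor_scale_shift: "Z \<in> sections B \<Longrightarrow> g \<in> smooth_functions (base B) \<Longrightarrow> x \<in> points (base B) \<Longrightarrow>
      vf_apply (base B) (a (sec_scale B g Z)) f x = g (t x) * vf_apply (base B) (a Z) f x"
    and anchor_plus: "Z \<in> sections B \<Longrightarrow> f \<in> smooth_functions (base B) \<Longrightarrow> g \<in> smooth_functions (base B) \<Longrightarrow>
      x \<in> points (base B) \<Longrightarrow> vf_apply (base B) (a Z) (\<lambda>x\<in>points (base B). f x + g x) x =
        vf_apply (base B) (a Z) f x + vf_apply (base B) (a Z) g x"
    and anchor_times: "Z \<in> sections B \<Longrightarrow> f \<in> smooth_functions (base B) \<Longrightarrow> g \<in> smooth_functions (base B) \<Longrightarrow>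
      x \<in> points (base B) \<Longrightarrow> vf_apply (base B) (a Z) (\<lambda>x\<in>points (base B). f x * g x) x =
        vf_apply (base B) (a Z) f x * g x + f x * vf_apply (base B) (a Z) g x"
    and anchor_local: "Z \<in> sections B \<Longrightarrow> openin (mtop (base B)) A \<Longrightarrow> x \<in> A \<Longrightarrow> (\<And>y. y \<in> A \<Longrightarrow> f y = g y) \<Longrightarrow>
      vf_apply (base B) (a Z) f x = vf_apply (base B) (a Z) g x"
begin

abbreviation D :: "('b \<Rightarrow> 'e) \<Rightarrow> ('b \<Rightarrow> real) \<Rightarrow> 'b \<Rightarrow> real" where
  "D Z f \<equiv> vf_apply (base B) (a Z) f"

lemma manifold_base: "smooth_manifold (base B)"
  by (rule vbundle_manifold[OF B])

text \<open>Polarization: the bracket of \<open>Z + W\<close> with itself is zero.\<close>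

lemma br_skew:
  assumes \<kappa>: "pointwise_functional B x \<kappa>" and ZW: "Z \<in> sections B" "W \<in> sections B"
  shows "\<kappa> (br Z W) = - \<kappa> (br W Z)"
proof -
  have s: "sec_add B Z W \<in> sections B" by (rule sec_add_sections[OF B ZW])
  have "0 = \<kappa> (br (sec_add B Z W) (sec_add B Z W))"
    using br_self[OF s] pointwise_functional_zero[OF B \<kappa>] by simp
  also have "\<dots> = \<kappa> (br Z Z) + \<kappa> (br Z W) + (\<kappa> (br W Z) + \<kappa> (br W W))"
    by (simp add: br_add ZW s sec_add_sections[OF B] br_closed pointwise_functionalD(1)[OF \<kappa>])
  finally show ?thesis using br_self ZW pointwise_functional_zero[OF B \<kappa>] by simp
qed

text \<open>A derivation kills the constants 1 and 0 because 1 * 1 = 1 and 0 + 0 = 0.\<close>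

lemma anchor_const:
  assumes "Z \<in> sections B" "x \<in> points (base B)"
  shows "D Z (\<lambda>x\<in>points (base B). 1) x = 0" "D Z (\<lambda>x\<in>points (base B). 0) x = 0"
proof -
  let ?c = "\<lambda>c. \<lambda>x\<in>points (base B). c :: real"
  have r: "(\<lambda>x\<in>points (base B). ?c 1 x * ?c 1 x) = ?c 1" "(\<lambda>x\<in>points (base B). ?c 0 x + ?c 0 x) = ?c 0"
    by (auto simp: fun_eq_iff restrict_def)
  show 1: "D Z (?c 1) x = 0"
    using anchor_times[OF assms(1) const_smooth_function[OF B] const_smooth_function[OF B] assms(2), of 1 1]
    unfolding r using assms(2) by simp
  show 0: "D Z (?c 0) x = 0"
    using anchor_plus[OF assms(1) const_smooth_function[OF B] const_smooth_function[OF B] assms(2), of 0 0]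
    unfolding r by simp
qed

text \<open>For a multiple of \<open>e\<close> near \<open>x\<close>, component 0 is the coefficient
  itself. Applied to the Leibniz rule, this isolates the anchor term; it presupposes that there is a
  component 0.\<close>

lemma unit_section:
  assumes p: "0 < frank B" and x: "x \<in> points (base B)"
  obtains V \<tau> O' e where "local_triv B V \<tau>" "openin (mtop (base B)) O'" "x \<in> O'" "O' \<subseteq> V"
    "e \<in> sections B" "\<And>y. y \<in> O' \<Longrightarrow> \<tau> (e y) 0 = 1"
proof -
  obtain V \<tau> where V: "(V, \<tau>) \<in> trivs B" "x \<in> V" using triv_cover[OF B x] by blast
  note lt = triv_local_triv[OF B V(1)]
  obtain \<psi> O' W where "bump_on (base B) V x \<psi> O' W"
    by (rule bump_function[OF manifold_base local_triv_open[OF B lt] V(2)])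
  note \<psi> = bump_onD[OF this]
  obtain e where e: "e \<in> sections B" "\<And>y i. y \<in> V \<Longrightarrow> \<tau> (e y) i = (if i = 0 then \<psi> y else 0)"
    using frame_section[OF B lt \<psi>(1,6,7,8) p] by blast
  show thesis by (rule that[OF lt \<psi>(2,3,4) e(1)]) (use e(2) \<psi>(4,5) in auto)
qed

text \<open>Smoothness is read off the Leibniz rule; no expression of derivations in coordinates is needed.\<close>

lemma anchor_smooth:
  assumes p: "0 < frank B" and Z: "Z \<in> sections B" and f: "f \<in> smooth_functions (base B)"
  shows "D Z f \<in> smooth_functions (base B)"
proof -
  have "smooth_fun_on (base B) (points (base B)) (D Z f)"
  proof (rule smooth_fun_on_local[OF manifold_base openin_points[OF manifold_base]])
    fix x assume "x \<in> points (base B)"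
    then obtain V \<tau> O' e where e: "local_triv B V \<tau>" "openin (mtop (base B)) O'" "x \<in> O'" "O' \<subseteq> V"
      "e \<in> sections B" "\<And>y. y \<in> O' \<Longrightarrow> \<tau> (e y) 0 = 1"
      using unit_section[OF p] by blast
    have fe: "sec_scale B f e \<in> sections B" by (rule sec_scale_in_sections[OF B f e(5)])
    have brs: "br Z (sec_scale B f e) \<in> sections B" "br Z e \<in> sections B" using br_closed Z fe e(5) by auto
    have "smooth_fun_on (base B) V (\<lambda>y. \<tau> (br Z (sec_scale B f e) y) 0 - f y * \<tau> (br Z e y) 0)"
      by (intro smooth_fun_on_diff[OF manifold_base] smooth_fun_on_mult[OF manifold_base]
          section_component_smooth[OF B _ e(1) p] brs smooth_functionsD[OF manifold_base f] local_triv_subset[OF B e(1)])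
    then have "smooth_fun_on (base B) O' (\<lambda>y. \<tau> (br Z (sec_scale B f e) y) 0 - f y * \<tau> (br Z e y) 0)"
      by (rule smooth_fun_on_subset[OF manifold_base _ e(4)])
    then have "smooth_fun_on (base B) O' (D Z f)"
    proof (rule smooth_fun_on_cong[OF manifold_base e(2), rotated])
      fix y assume y: "y \<in> O'"
      then have yV: "y \<in> V" and yM: "y \<in> points (base B)" using e(4) local_triv_subset[OF B e(1)] by auto
      note lin = local_triv_linear[OF B e(1) yV] and fc = fibre_closed[OF B yM]
      have "\<tau> (br Z (sec_scale B f e) y) 0 = f y * \<tau> (br Z e y) 0 + D Z f y * \<tau> (e y) 0"
        unfolding br_scale[OF Z e(5) f]
        using yM section_in_fibre[OF B e(5) yM] section_in_fibre[OF B brs(2) yM]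
        by (simp add: sec_add_def sec_scale_def lin fc)
      then show "\<tau> (br Z (sec_scale B f e) y) 0 - f y * \<tau> (br Z e y) 0 = D Z f y" using e(6)[OF y] by simp
    qed
    then show "\<exists>A. openin (mtop (base B)) A \<and> x \<in> A \<and> smooth_fun_on (base B) A (D Z f)" using e(2,3) by blast
  qed
  then show ?thesis by (simp add: smooth_functions_def vf_apply_def)
qed

text \<open>Evaluating the Leibniz rule under \<kappa> requires \<open>D Z f\<close> to be a smooth
  coefficient, which \<open>anchor_smooth\<close> provides. The rule for the first argument follows
  by skew symmetry.\<close>

lemma br_scale_pointwise:
  assumes p: "0 < frank B" and \<kappa>: "pointwise_functional B x \<kappa>"
    and s: "Z \<in> sections B" "W \<in> sections B" and f: "f \<in> smooth_functions (base B)"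
  shows "\<kappa> (br Z (sec_scale B f W)) = f x * \<kappa> (br Z W) + D Z f x * \<kappa> W"
    and "\<kappa> (br (sec_scale B f W) Z) = f x * \<kappa> (br W Z) - D Z f x * \<kappa> W"
proof -
  note Df = anchor_smooth[OF p s(1) f]
  note sc = sec_scale_in_sections[OF B] br_closed s f Df
  show 1: "\<kappa> (br Z (sec_scale B f W)) = f x * \<kappa> (br Z W) + D Z f x * \<kappa> W"
    unfolding br_scale[OF s f] by (simp add: sc pointwise_functionalD[OF \<kappa>])
  show "\<kappa> (br (sec_scale B f W) Z) = f x * \<kappa> (br W Z) - D Z f x * \<kappa> W"
    using br_skew[OF \<kappa>, of Z "sec_scale B f W"] br_skew[OF \<kappa>, of Z W] 1 sc by simp
qed

text \<open>
  The bracket \<open>[f Z, g e]\<close> is expanded in two orders, with \<open>f = 1\<close> near \<open>x\<close> and \<open>f (t x) = 0\<close>: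
  the terms that remain are the multiples of \<open>e\<close> in which the anchor of \<open>Z\<close> acts on \<open>g\<close>.
\<close>

lemma anchor_vanishes:
  assumes p: "0 < frank B" and x: "x \<in> points (base B)" "t x \<noteq> x"
    and Z: "Z \<in> sections B" and g: "g \<in> smooth_functions (base B)"
  shows "D Z g x = 0"
proof -
  obtain V \<tau> O' e where e: "local_triv B V \<tau>" "openin (mtop (base B)) O'" "x \<in> O'" "O' \<subseteq> V"
    "e \<in> sections B" "\<And>y. y \<in> O' \<Longrightarrow> \<tau> (e y) 0 = 1"
    using unit_section[OF p x(1)] by blast
  obtain f A where f: "f \<in> smooth_functions (base B)" "openin (mtop (base B)) A" "x \<in> A"
    "\<And>y. y \<in> A \<Longrightarrow> f y = 1" "f (t x) = 0"
    using bump_separating[OF manifold_base x(1) t_closed[OF x(1)]] x(2) by metis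
  define \<kappa> where "\<kappa> = (\<lambda>S. \<tau> (S x) 0)"
  have \<kappa>: "pointwise_functional B x \<kappa>"
    unfolding \<kappa>_def by (rule pointwise_functional_component[OF B e(1)]) (use e(3,4) in blast)
  have Df: "D e f x = 0"
  proof -
    have "D e f x = D e (\<lambda>x\<in>points (base B). 1) x"
    proof (rule anchor_local[OF e(5) f(2,3)])
      fix y assume "y \<in> A"
      then show "f y = (\<lambda>x\<in>points (base B). 1) y" using f(4) mtop_subset[OF manifold_base f(2)] by auto
    qed
    then show ?thesis using anchor_const(1)[OF e(5) x(1)] by simp
  qed
  note sc = sec_scale_in_sections[OF B] Z e(5) f(1) g br_closed
  note rule = br_scale_pointwise[OF p \<kappa>]
  let ?fZ = "sec_scale B f Z" and ?ge = "sec_scale B g e"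
  have "\<kappa> (br ?fZ ?ge) = g x * \<kappa> (br ?fZ e) + f (t x) * D Z g x * \<kappa> e"
    using rule(1)[of ?fZ e g] anchor_scale_shift[OF Z f(1) x(1)] sc by simp
  also have "\<dots> = g x * (f x * \<kappa> (br Z e) - D e f x * \<kappa> Z)"
    using rule(2)[of e Z f] f(5) sc by simp
  also have "\<dots> = g x * \<kappa> (br Z e)" using Df f(3,4) by simp
  finally have 1: "\<kappa> (br ?fZ ?ge) = g x * \<kappa> (br Z e)" .
  have "\<kappa> (br ?fZ ?ge) = f x * \<kappa> (br Z ?ge) - D ?ge f x * \<kappa> Z"
    using rule(2)[of ?ge Z f] sc by simp
  also have "\<dots> = \<kappa> (br Z ?ge)"
    using anchor_scale_shift[OF e(5) g x(1)] Df f(3,4) by simp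
  also have "\<dots> = g x * \<kappa> (br Z e) + D Z g x * \<kappa> e"
    using rule(1)[of Z e g] sc by simp
  finally have "D Z g x * \<kappa> e = 0" using 1 by simp
  then show ?thesis using e(3,6) by (simp add: \<kappa>_def)
qed

text \<open>If \<open>t x = x\<close>, the shifted rule is already the wanted one; otherwise both
  sides are 0 by \<open>anchor_vanishes\<close>.\<close>

lemma anchor_scale:
  assumes "0 < frank B" "x \<in> points (base B)" "Z \<in> sections B"
    "f \<in> smooth_functions (base B)" "g \<in> smooth_functions (base B)"
  shows "D (sec_scale B f Z) g x = f x * D Z g x"
  using anchor_scale_shift[OF assms(3,4,2), of g] anchor_vanishes[OF assms(1,2) _ assms(3,5)]
  by (cases "t x = x") auto

text \<open>The exterior differential of a one-form with its two arguments taken out of the list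
  encoding; \<open>ext_diff_eq_iff\<close> connects it with \<open>ext_diff\<close>.\<close>

definition dform :: "('e, 'b) form \<Rightarrow> ('b \<Rightarrow> 'e) \<Rightarrow> ('b \<Rightarrow> 'e) \<Rightarrow> 'b \<Rightarrow> real" where
  "dform \<omega> Z W x = D Z (\<omega> [W]) x - D W (\<omega> [Z]) x - \<omega> [br Z W] x"

lemma dform_skew:
  assumes "\<omega> \<in> forms B 1" "Z \<in> sections B" "W \<in> sections B" "x \<in> points (base B)"
  shows "dform \<omega> Z W x = - dform \<omega> W Z x"
  using br_skew[OF pointwise_functional_form[OF B assms(1,4)] assms(2,3)] by (simp add: dform_def)

lemma dform_smooth:
  assumes p: "0 < frank B" and \<omega>: "\<omega> \<in> forms B 1" and s: "Z \<in> sections B" "W \<in> sections B"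
  shows "smooth_fun_on (base B) (points (base B)) (dform \<omega> Z W)"
proof -
  note M = manifold_base and sm = form_smooth[OF B \<omega>]
  note sD = smooth_functionsD[OF M _ subset_refl]
  show ?thesis unfolding dform_def
    by (rule smooth_fun_on_diff[OF M smooth_fun_on_diff[OF M sD[OF anchor_smooth[OF p s(1) sm[OF s(2)]]]
            sD[OF anchor_smooth[OF p s(2) sm[OF s(1)]]]] sD[OF sm[OF br_closed[OF s]]]])
qed

text \<open>For homogeneity, the term \<open>D W f\<close> times \<omega>(Z) from the product rule
  cancels the one from the bracket. The remaining derivative term is governed by
  \<open>anchor_scale\<close>, so this is where the vanishing of the anchor at displaced points pays
  off.\<close>

lemma dform_pointwise:
  assumes p: "0 < frank B" and \<omega>: "\<omega> \<in> forms B 1" and W: "W \<in> sections B" and x: "x \<in> points (base B)"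
  shows "pointwise_functional B x (\<lambda>Z. dform \<omega> Z W x)"
  unfolding pointwise_functional_def
proof (intro conjI ballI)
  note \<omega>x = pointwise_functional_form[OF B \<omega>] and sm = form_smooth[OF B \<omega>] and M = manifold_base
  {
    fix Z Z' assume s: "Z \<in> sections B" "Z' \<in> sections B"
    have "\<omega> [sec_add B Z Z'] = (\<lambda>x\<in>points (base B). \<omega> [Z] x + \<omega> [Z'] x)"
    proof (rule smooth_functions_eqI[OF M sm[OF sec_add_sections[OF B s]]])
      show "(\<lambda>x\<in>points (base B). \<omega> [Z] x + \<omega> [Z'] x) \<in> smooth_functions (base B)"
        unfolding smooth_functions_restrict[OF M]
        by (intro smooth_fun_on_add[OF M] smooth_functionsD[OF M _ subset_refl] sm s)
    qed (simp add: pointwise_functionalD(1)[OF \<omega>x] s)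
    then have "D W (\<omega> [sec_add B Z Z']) x = D W (\<omega> [Z]) x + D W (\<omega> [Z']) x"
      using anchor_plus[OF W sm sm x] s by simp
    then show "dform \<omega> (sec_add B Z Z') W x = dform \<omega> Z W x + dform \<omega> Z' W x"
      using anchor_add[OF s x] br_add(1)[OF s W] pointwise_functionalD(1)[OF \<omega>x[OF x] br_closed[OF s(1) W] br_closed[OF s(2) W]]
      by (simp add: dform_def)
  next
    fix Z f assume Z: "Z \<in> sections B" and f: "f \<in> smooth_functions (base B)"
    have "\<omega> [sec_scale B f Z] = (\<lambda>x\<in>points (base B). f x * \<omega> [Z] x)"
    proof (rule smooth_functions_eqI[OF M sm[OF sec_scale_in_sections[OF B f Z]]])
      show "(\<lambda>x\<in>points (base B). f x * \<omega> [Z] x) \<in> smooth_functions (base B)"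
        unfolding smooth_functions_restrict[OF M]
        by (intro smooth_fun_on_mult[OF M] smooth_functionsD[OF M _ subset_refl] sm Z f)
    qed (simp add: pointwise_functionalD(2)[OF \<omega>x] Z f)
    then have "D W (\<omega> [sec_scale B f Z]) x = D W f x * \<omega> [Z] x + f x * D W (\<omega> [Z]) x"
      using anchor_times[OF W f sm x] Z by simp
    moreover have "D (sec_scale B f Z) (\<omega> [W]) x = f x * D Z (\<omega> [W]) x"
      by (rule anchor_scale[OF p x Z f sm[OF W]])
    ultimately show "dform \<omega> (sec_scale B f Z) W x = f x * dform \<omega> Z W x"
      using br_scale_pointwise(2)[OF p \<omega>x[OF x] W Z f] by (simp add: dform_def algebra_simps)
  }
qed

end

text \<open>The linear combination of the \<open>e j\<close> with coefficients \<open>c j\<close>,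
  characterised by what every functional at every point makes of it.\<close>

lemma lincomb_section:
  assumes B: "vector_bundle B" and "finite J" "\<And>j. j \<in> J \<Longrightarrow> c j \<in> smooth_functions (base B)" "\<And>j. j \<in> J \<Longrightarrow> e j \<in> sections B"
  shows "\<exists>S\<in>sections B. \<forall>x \<kappa>. pointwise_functional B x \<kappa> \<longrightarrow> \<kappa> S = (\<Sum>j\<in>J. c j x * \<kappa> (e j))"
  using assms(2-)
proof (induction J rule: finite_induct)
  case empty
  then show ?case using sec_zero_sections[OF B] pointwise_functional_zero[OF B] by auto
next
  case (insert j J)
  then obtain S where S: "S \<in> sections B" "\<And>x \<kappa>. pointwise_functional B x \<kappa> \<Longrightarrow> \<kappa> S = (\<Sum>j\<in>J. c j x * \<kappa> (e j))"
    by auto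
  have ce: "sec_scale B (c j) (e j) \<in> sections B" using insert.prems by (intro sec_scale_in_sections[OF B]) auto
  show ?case
  proof (intro bexI[of _ "sec_add B (sec_scale B (c j) (e j)) S"] allI impI)
    fix x \<kappa> assume \<kappa>: "pointwise_functional B x \<kappa>"
    show "\<kappa> (sec_add B (sec_scale B (c j) (e j)) S) = (\<Sum>j\<in>insert j J. c j x * \<kappa> (e j))"
      using insert.hyps insert.prems S ce \<kappa> by (simp add: pointwise_functionalD[OF \<kappa>])
  qed (rule sec_add_sections[OF B ce S(1)])
qed

text \<open>Here \<open>z\<close> and \<open>w\<close> stand for the values of the \<Theta>_\<beta>
  on Z and W, \<open>p\<close> and \<open>q\<close> for d\<Theta>(Z, S_\<beta>) and d\<Theta>(W,
  S_\<beta>), and \<open>m\<close> for d\<Theta>(S_\<beta>, S_\<gamma>). Exchanging the summation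
  indices makes the two correction terms equal up to sign, so the halves add up to one double
  sum.\<close>

lemma skew_double_sum:
  fixes z w p q :: "'i \<Rightarrow> real"
  assumes "\<And>\<beta> \<gamma>. \<beta> \<in> I \<Longrightarrow> \<gamma> \<in> I \<Longrightarrow> m \<gamma> \<beta> = - m \<beta> \<gamma>"
  shows "(\<Sum>\<beta>\<in>I. (p \<beta> - 1 / 2 * (\<Sum>\<gamma>\<in>I. m \<gamma> \<beta> * z \<gamma>)) * w \<beta> - (q \<beta> - 1 / 2 * (\<Sum>\<gamma>\<in>I. m \<gamma> \<beta> * w \<gamma>)) * z \<beta>) =
    (\<Sum>\<beta>\<in>I. p \<beta> * w \<beta>) - (\<Sum>\<beta>\<in>I. q \<beta> * z \<beta>) - (\<Sum>\<beta>\<in>I. \<Sum>\<gamma>\<in>I. z \<beta> * w \<gamma> * m \<beta> \<gamma>)"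
proof -
  have "(\<Sum>\<beta>\<in>I. (\<Sum>\<gamma>\<in>I. m \<gamma> \<beta> * z \<gamma>) * w \<beta>) = (\<Sum>\<beta>\<in>I. \<Sum>\<gamma>\<in>I. m \<gamma> \<beta> * z \<gamma> * w \<beta>)"
    by (simp add: sum_distrib_right)
  also have "\<dots> = (\<Sum>\<gamma>\<in>I. \<Sum>\<beta>\<in>I. m \<gamma> \<beta> * z \<gamma> * w \<beta>)" by (rule sum.swap)
  finally have 1: "(\<Sum>\<beta>\<in>I. (\<Sum>\<gamma>\<in>I. m \<gamma> \<beta> * z \<gamma>) * w \<beta>) = (\<Sum>\<beta>\<in>I. \<Sum>\<gamma>\<in>I. z \<beta> * w \<gamma> * m \<beta> \<gamma>)"
    by (simp add: mult_ac)
  have "(\<Sum>\<beta>\<in>I. (\<Sum>\<gamma>\<in>I. m \<gamma> \<beta> * w \<gamma>) * z \<beta>) = (\<Sum>\<beta>\<in>I. \<Sum>\<gamma>\<in>I. - (z \<beta> * w \<gamma> * m \<beta> \<gamma>))"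
    unfolding sum_distrib_right
  proof (intro sum.cong refl)
    fix \<beta> \<gamma> assume "\<beta> \<in> I" "\<gamma> \<in> I"
    then have "m \<gamma> \<beta> = - m \<beta> \<gamma>" by (rule assms)
    then show "m \<gamma> \<beta> * w \<gamma> * z \<beta> = - (z \<beta> * w \<gamma> * m \<beta> \<gamma>)" by simp
  qed
  then have 2: "(\<Sum>\<beta>\<in>I. (\<Sum>\<gamma>\<in>I. m \<gamma> \<beta> * w \<gamma>) * z \<beta>) = - (\<Sum>\<beta>\<in>I. \<Sum>\<gamma>\<in>I. z \<beta> * w \<gamma> * m \<beta> \<gamma>)"
    by (simp add: sum_negf)
  have "(\<Sum>\<beta>\<in>I. (p \<beta> - 1 / 2 * P \<beta>) * w \<beta> - (q \<beta> - 1 / 2 * Q \<beta>) * z \<beta>) =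
    (\<Sum>\<beta>\<in>I. p \<beta> * w \<beta>) - (\<Sum>\<beta>\<in>I. q \<beta> * z \<beta>)
     - 1 / 2 * (\<Sum>\<beta>\<in>I. P \<beta> * w \<beta>) + 1 / 2 * (\<Sum>\<beta>\<in>I. Q \<beta> * z \<beta>)" for P Q
    unfolding sum_distrib_left sum_subtractf[symmetric] sum.distrib[symmetric]
    by (intro sum.cong refl) (simp add: algebra_simps)
  from this[of "\<lambda>\<beta>. \<Sum>\<gamma>\<in>I. m \<gamma> \<beta> * z \<gamma>" "\<lambda>\<beta>. \<Sum>\<gamma>\<in>I. m \<gamma> \<beta> * w \<gamma>"]
  show ?thesis unfolding 1 2 by simp
qed

section \<open>Involutivity in terms of the annihilator\<close>

lemma sum_reindex_Suc: "(\<Sum>\<alpha>\<in>{r + 1..p :: nat}. f \<alpha>) = (\<Sum>k<p - r. f (r + 1 + k))"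
  by (rule sum.reindex_bij_witness[of _ "\<lambda>k. r + 1 + k" "\<lambda>\<alpha>. \<alpha> - (r + 1)"]) auto

context anchored_bracket
begin

context
  fixes E :: "'e set" and p r :: nat and \<Theta> :: "nat \<Rightarrow> ('e, 'b) form"
  assumes rank: "frank B = p" and E: "subbundle B r E"
    and basis: "module_basis B 1 (annihilator_sections B E) {r+1..p} \<Theta>"
begin

lemma basis_annihilator: "\<alpha> \<in> {r+1..p} \<Longrightarrow> \<Theta> \<alpha> \<in> annihilator_sections B E"
  using basis unfolding module_basis_def by blast

lemma basis_forms: "\<alpha> \<in> {r+1..p} \<Longrightarrow> \<Theta> \<alpha> \<in> forms B 1"
  using basis_annihilator unfolding annihilator_sections_def by blast

lemma basis_span:
  assumes "\<omega> \<in> annihilator_sections B E"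
  shows "\<exists>c. (\<forall>\<alpha>\<in>{r+1..p}. c \<alpha> \<in> smooth_functions (base B)) \<and>
    (\<forall>Z\<in>sections B. \<forall>x\<in>points (base B). \<omega> [Z] x = (\<Sum>\<alpha>\<in>{r+1..p}. c \<alpha> x * \<Theta> \<alpha> [Z] x))"
proof -
  obtain c where c: "\<And>\<alpha>. \<alpha> \<in> {r+1..p} \<Longrightarrow> c \<alpha> \<in> smooth_functions (base B)"
    "\<omega> = form_sum B 1 {r+1..p} (\<lambda>\<alpha>. form_scale B 1 (c \<alpha>) (\<Theta> \<alpha>))"
    using basis assms unfolding module_basis_def by blast
  have "\<omega> [Z] x = (\<Sum>\<alpha>\<in>{r+1..p}. c \<alpha> x * \<Theta> \<alpha> [Z] x)" if "Z \<in> sections B" "x \<in> points (base B)" for Z x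
    unfolding c(2) using that by (simp add: form_sum_def form_scale_def tuples_1 del: One_nat_def)
  then show ?thesis using c(1) by blast
qed

lemma basis_detects:
  assumes Z: "Z \<in> sections B" and 0: "\<And>\<alpha> x. \<alpha> \<in> {r+1..p} \<Longrightarrow> x \<in> points (base B) \<Longrightarrow> \<Theta> \<alpha> [Z] x = 0"
  shows "Z \<in> sections_in B E"
proof (rule annihilator_detects[OF B E Z])
  fix \<omega> x assume \<omega>: "\<omega> \<in> annihilator_sections B E" and x: "x \<in> points (base B)"
  obtain c where c: "\<forall>Z\<in>sections B. \<forall>x\<in>points (base B). \<omega> [Z] x = (\<Sum>\<alpha>\<in>{r+1..p}. c \<alpha> x * \<Theta> \<alpha> [Z] x)"
    using basis_span[OF \<omega>] by blast
  then have "\<omega> [Z] x = (\<Sum>\<alpha>\<in>{r+1..p}. c \<alpha> x * \<Theta> \<alpha> [Z] x)" using Z x by blast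
  then show "\<omega> [Z] x = 0" using 0[OF _ x] by (simp add: sum.neutral)
qed

lemma basis_zero: "S \<in> sections_in B E \<Longrightarrow> \<alpha> \<in> {r+1..p} \<Longrightarrow> \<Theta> \<alpha> [S] = (\<lambda>x\<in>points (base B). 0)"
  using basis_annihilator unfolding annihilator_sections_def by blast

lemma sections_in_sections: "S \<in> sections_in B E \<Longrightarrow> S \<in> sections B"
  by (simp add: sections_in_def)

lemma dform_sections_in:
  assumes "\<alpha> \<in> {r+1..p}" "S \<in> sections_in B E" "T \<in> sections_in B E" "x \<in> points (base B)"
  shows "dform (\<Theta> \<alpha>) S T x = - \<Theta> \<alpha> [br S T] x"
  using assms by (simp add: dform_def basis_zero anchor_const(2) sections_in_sections)

text \<open>
  Near a point the coframe of \<open>E\<^sup>0\<close> dual to a frame \<open>e\<^sub>j\<close> is \<open>\<Sum>\<^sub>\<alpha> c\<^sub>j\<^sub>\<alpha> \<Theta>\<^sub>\<alpha>\<close>, so the matrix \<open>c\<close> is a left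
  inverse of the square matrix \<open>\<Theta>\<^sub>\<alpha>(e\<^sub>j)\<close>, hence also a right inverse.
\<close>

lemma dual_sections:
  assumes x: "x \<in> points (base B)"
  obtains O' S where "openin (mtop (base B)) O'" "x \<in> O'" "\<And>\<beta>. \<beta> \<in> {r+1..p} \<Longrightarrow> S \<beta> \<in> sections B"
    "\<And>y \<alpha> \<beta>. y \<in> O' \<Longrightarrow> \<alpha> \<in> {r+1..p} \<Longrightarrow> \<beta> \<in> {r+1..p} \<Longrightarrow> \<Theta> \<alpha> [S \<beta>] y = (if \<alpha> = \<beta> then 1 else 0)"
proof -
  \<comment> \<open>The corank of \<open>E\<close>: both the number of adapted coordinates that
    vanish on \<open>E\<close> and the number of basis forms, which makes the matrices
    square.\<close>
  define n where "n = p - r"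
  have rp: "r \<le> p" using E rank by (simp add: subbundle_def)
  obtain V \<tau> where V: "x \<in> V" "local_triv B V \<tau>" "\<And>y. y \<in> V \<Longrightarrow> E \<inter> fibre B y = {e \<in> fibre B y. \<forall>i\<ge>r. \<tau> e i = 0}"
    using E x unfolding subbundle_def by meson
  obtain \<psi> O' W where "bump_on (base B) V x \<psi> O' W"
    by (rule bump_function[OF manifold_base local_triv_open[OF B V(2)] V(1)])
  note \<psi> = bump_onD[OF this]
  have "\<exists>e. e \<in> sections B \<and> (\<forall>y\<in>V. \<forall>i. \<tau> (e y) i = (if i = r + j then \<psi> y else 0))" if j: "j < n" for j
  proof -
    have "r + j < frank B" using j rank by (simp add: n_def)
    then obtain s where "s \<in> sections B" "\<And>y i. y \<in> V \<Longrightarrow> \<tau> (s y) i = (if i = r + j then \<psi> y else 0)"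
      using frame_section[OF B V(2) \<psi>(1,6,7,8)] by blast
    then show ?thesis by (intro exI[of _ s]) simp
  qed
  then obtain e where e: "\<And>j. j < n \<Longrightarrow> e j \<in> sections B"
    "\<And>j y i. j < n \<Longrightarrow> y \<in> V \<Longrightarrow> \<tau> (e j y) i = (if i = r + j then \<psi> y else 0)" by metis
  define \<epsilon> where "\<epsilon> i = one_form B (\<lambda>Z y. if y \<in> V then \<psi> y * \<tau> (Z y) (r + i) else 0)" for i
  define Q where "Q i c \<longleftrightarrow> (\<forall>\<alpha>\<in>{r+1..p}. c \<alpha> \<in> smooth_functions (base B)) \<and>
     (\<forall>Z\<in>sections B. \<forall>x\<in>points (base B). \<epsilon> i [Z] x = (\<Sum>\<alpha>\<in>{r+1..p}. c \<alpha> x * \<Theta> \<alpha> [Z] x))" for i c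
  have "\<exists>c. Q i c" if i: "i < n" for i
  proof -
    have "r + i < frank B" "r \<le> r + i" using i rank by (simp_all add: n_def)
    from coframe_annihilator[OF B V(2) \<psi>(1,6,7,8) this V(3)] have "\<epsilon> i \<in> annihilator_sections B E"
      unfolding \<epsilon>_def by blast
    then show ?thesis unfolding Q_def by (rule basis_span)
  qed
  then obtain c where "\<And>i. i < n \<Longrightarrow> Q i (c i)" by metis
  then have c: "\<And>i \<alpha>. i < n \<Longrightarrow> \<alpha> \<in> {r+1..p} \<Longrightarrow> c i \<alpha> \<in> smooth_functions (base B)"
    "\<And>i Z x. i < n \<Longrightarrow> Z \<in> sections B \<Longrightarrow> x \<in> points (base B) \<Longrightarrow> \<epsilon> i [Z] x = (\<Sum>\<alpha>\<in>{r+1..p}. c i \<alpha> x * \<Theta> \<alpha> [Z] x)"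
    unfolding Q_def by blast+
  \<comment> \<open>With \<open>S \<beta>\<close> the combination of the \<open>e j\<close> with
    coefficients \<open>c j \<beta>\<close>, the values \<Theta>_\<alpha>(S_\<beta>) are the entries
    of the matrix product in the reverse order, so the right inverse property is the one to
    use.\<close>
  have "\<exists>S\<in>sections B. \<forall>x \<kappa>. pointwise_functional B x \<kappa> \<longrightarrow> \<kappa> S = (\<Sum>j<n. c j \<beta> x * \<kappa> (e j))"
    if "\<beta> \<in> {r+1..p}" for \<beta>
    using c(1) e(1) that by (intro lincomb_section[OF B]) auto
  then obtain S where S: "\<And>\<beta>. \<beta> \<in> {r+1..p} \<Longrightarrow> S \<beta> \<in> sections B"
    "\<And>\<beta> x \<kappa>. \<beta> \<in> {r+1..p} \<Longrightarrow> pointwise_functional B x \<kappa> \<Longrightarrow> \<kappa> (S \<beta>) = (\<Sum>j<n. c j \<beta> x * \<kappa> (e j))" by metis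
  show thesis
  proof (rule that[OF \<psi>(2,3) S(1)])
    fix y \<alpha> \<beta> assume y: "y \<in> O'" and \<alpha>: "\<alpha> \<in> {r+1..p}" and \<beta>: "\<beta> \<in> {r+1..p}"
    have yV: "y \<in> V" and yM: "y \<in> points (base B)" using y \<psi>(4) local_triv_subset[OF B V(2)] by auto
    have left: "(\<Sum>k<n. c i (r + 1 + k) y * \<Theta> (r + 1 + k) [e j] y) = (if i = j then 1 else 0)" if ij: "i < n" "j < n" for i j
    proof -
      \<comment> \<open>Coframe and frame each carry a factor \<psi>, and \<psi> is 1 on
        \<open>O'\<close>.\<close>
      have "\<epsilon> i [e j] y = (if i = j then 1 else 0)"
        using e yV yM ij \<psi>(5)[OF y] by (simp add: \<epsilon>_def one_form_apply)
      then show ?thesis using c(2)[OF ij(1) e(1)[OF ij(2)] yM, unfolded sum_reindex_Suc, folded n_def] by simp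
    qed
    \<comment> \<open>The basis is numbered from \<open>r + 1\<close>, the matrices from 0.\<close>
    define a b where "a = \<alpha> - (r + 1)" and "b = \<beta> - (r + 1)"
    have ab: "a < n" "b < n" "\<alpha> = r + 1 + a" "\<beta> = r + 1 + b"
      using \<alpha> \<beta> by (auto simp: a_def b_def n_def)
    have "\<Theta> \<alpha> [S \<beta>] y = (\<Sum>j<n. \<Theta> (r + 1 + a) [e j] y * c j (r + 1 + b) y)"
      using S(2)[OF \<beta> pointwise_functional_form[OF B basis_forms[OF \<alpha>] yM]] ab by (simp add: mult.commute)
    also have "\<dots> = (if a = b then 1 else 0)"
      by (rule left_inverse_right_inverse[OF left ab(1,2)])
    finally show "\<Theta> \<alpha> [S \<beta>] y = (if \<alpha> = \<beta> then 1 else 0)" using ab by simp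
  qed
qed

abbreviation wedge_sum :: "(nat \<Rightarrow> ('e, 'b) form) \<Rightarrow> ('b \<Rightarrow> 'e) \<Rightarrow> ('b \<Rightarrow> 'e) \<Rightarrow> 'b \<Rightarrow> real" where
  "wedge_sum \<Omega> Z W y \<equiv> \<Sum>\<beta>\<in>{r+1..p}. \<Omega> \<beta> [Z] y * \<Theta> \<beta> [W] y - \<Omega> \<beta> [W] y * \<Theta> \<beta> [Z] y"

section \<open>From involutivity to the structure equations\<close>

lemma involutive_local:
  assumes inv: "involutive B br E" and x: "x \<in> points (base B)" and ne: "r < p"
  obtains O' \<Omega> where "openin (mtop (base B)) O'" "x \<in> O'"
    "\<And>\<alpha> \<beta>. \<alpha> \<in> {r+1..p} \<Longrightarrow> \<beta> \<in> {r+1..p} \<Longrightarrow> \<Omega> \<alpha> \<beta> \<in> forms B 1"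
    "\<And>y Z W \<alpha>. y \<in> O' \<Longrightarrow> Z \<in> sections B \<Longrightarrow> W \<in> sections B \<Longrightarrow> \<alpha> \<in> {r+1..p} \<Longrightarrow>
      dform (\<Theta> \<alpha>) Z W y = wedge_sum (\<Omega> \<alpha>) Z W y"
proof -
  let ?I = "{r+1..p}"
  have p: "0 < frank B" using ne rank by simp
  obtain O' S where O': "openin (mtop (base B)) O'" "x \<in> O'" and S: "\<And>\<beta>. \<beta> \<in> ?I \<Longrightarrow> S \<beta> \<in> sections B"
    "\<And>y \<alpha> \<beta>. y \<in> O' \<Longrightarrow> \<alpha> \<in> ?I \<Longrightarrow> \<beta> \<in> ?I \<Longrightarrow> \<Theta> \<alpha> [S \<beta>] y = (if \<alpha> = \<beta> then 1 else 0)"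
    using dual_sections[OF x] by blast
  define F where "F \<alpha> \<beta> Z y = dform (\<Theta> \<alpha>) Z (S \<beta>) y - 1 / 2 * (\<Sum>\<gamma>\<in>?I. dform (\<Theta> \<alpha>) (S \<gamma>) (S \<beta>) y * \<Theta> \<gamma> [Z] y)" for \<alpha> \<beta> Z y
  note M = manifold_base
  have forms: "one_form B (F \<alpha> \<beta>) \<in> forms B 1" if \<alpha>: "\<alpha> \<in> ?I" and \<beta>: "\<beta> \<in> ?I" for \<alpha> \<beta>
  proof (rule one_form_in_forms[OF B])
    fix Z assume Z: "Z \<in> sections B"
    have "smooth_fun_on (base B) (points (base B)) (\<lambda>y. \<Sum>\<gamma>\<in>?I. dform (\<Theta> \<alpha>) (S \<gamma>) (S \<beta>) y * \<Theta> \<gamma> [Z] y)"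
    proof (rule smooth_fun_on_sum[OF M])
      fix \<gamma> assume \<gamma>: "\<gamma> \<in> ?I"
      show "smooth_fun_on (base B) (points (base B)) (\<lambda>y. dform (\<Theta> \<alpha>) (S \<gamma>) (S \<beta>) y * \<Theta> \<gamma> [Z] y)"
        by (rule smooth_fun_on_mult[OF M dform_smooth[OF p basis_forms[OF \<alpha>] S(1)[OF \<gamma>] S(1)[OF \<beta>]]
              smooth_functionsD[OF M form_smooth[OF B basis_forms[OF \<gamma>] Z] subset_refl]])
    qed
    then show "smooth_fun_on (base B) (points (base B)) (F \<alpha> \<beta> Z)"
      unfolding F_def
      by (rule smooth_fun_on_diff[OF M dform_smooth[OF p basis_forms[OF \<alpha>] Z S(1)[OF \<beta>]]
            smooth_fun_on_mult[OF M smooth_fun_on_const[OF M]]])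
  next
    fix y assume y: "y \<in> points (base B)"
    show "pointwise_functional B y (\<lambda>Z. F \<alpha> \<beta> Z y)"
      unfolding F_def
      by (intro pointwise_functional_diff pointwise_functional_scale pointwise_functional_sum
          dform_pointwise[OF p basis_forms[OF \<alpha>] S(1)[OF \<beta>] y] pointwise_functional_form[OF B basis_forms y])
  qed
  have eq: "dform (\<Theta> \<alpha>) Z W y = (\<Sum>\<beta>\<in>?I. F \<alpha> \<beta> Z y * \<Theta> \<beta> [W] y - F \<alpha> \<beta> W y * \<Theta> \<beta> [Z] y)"
    if y: "y \<in> O'" and Z: "Z \<in> sections B" and W: "W \<in> sections B" and \<alpha>: "\<alpha> \<in> ?I" for y Z W \<alpha>
  proof -
    have yM: "y \<in> points (base B)" using y mtop_subset[OF M O'(1)] by blast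
    \<comment> \<open>The forms and the \<open>S \<beta>\<close> are dual on \<open>O'\<close> only,
      so outside it the projection of \<open>Z\<close> need not lie in \<open>E\<close>. The bump
      supported in \<open>O'\<close> yields a global section of \<open>E\<close> with the same
      functionals at \<open>y\<close>.\<close>
    obtain \<psi> A C where "bump_on (base B) O' y \<psi> A C"
      by (rule bump_function[OF M O'(1) y])
    note \<psi> = bump_onD[OF this]
    have \<psi>1: "\<psi> y = 1" using \<psi>(3,5) by blast
    have proj: "\<exists>Q\<in>sections_in B E. \<forall>\<kappa>. pointwise_functional B y \<kappa> \<longrightarrow>
        \<kappa> Q = \<kappa> Z - (\<Sum>\<beta>\<in>?I. \<Theta> \<beta> [Z] y * \<kappa> (S \<beta>))" if Z: "Z \<in> sections B" for Z
    proof -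
      have sm: "(\<lambda>z\<in>points (base B). - (\<psi> z * \<Theta> \<beta> [Z] z)) \<in> smooth_functions (base B)" if \<beta>: "\<beta> \<in> ?I" for \<beta>
      proof -
        have "smooth_fun_on (base B) (points (base B)) (\<lambda>z. -1 * (\<psi> z * \<Theta> \<beta> [Z] z))"
          by (intro smooth_fun_on_mult[OF M] smooth_fun_on_const[OF M] smooth_functionsD[OF M \<psi>(1)]
              smooth_functionsD[OF M form_smooth[OF B basis_forms[OF \<beta>] Z]]) auto
        then show ?thesis by (simp add: smooth_functions_restrict[OF M])
      qed
      obtain R where R: "R \<in> sections B" "\<And>z \<kappa>. pointwise_functional B z \<kappa> \<Longrightarrow>
          \<kappa> R = (\<Sum>\<beta>\<in>?I. (\<lambda>z\<in>points (base B). - (\<psi> z * \<Theta> \<beta> [Z] z)) z * \<kappa> (S \<beta>))"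
        using lincomb_section[OF B, of ?I "\<lambda>\<beta>. \<lambda>z\<in>points (base B). - (\<psi> z * \<Theta> \<beta> [Z] z)" S] sm S(1) by blast
      define Q where "Q = sec_add B (sec_scale B \<psi> Z) R"
      have \<psi>Z: "sec_scale B \<psi> Z \<in> sections B" by (rule sec_scale_in_sections[OF B \<psi>(1) Z])
      have Qs: "Q \<in> sections B" unfolding Q_def by (rule sec_add_sections[OF B \<psi>Z R(1)])
      have Q: "\<kappa> Q = \<psi> z * (\<kappa> Z - (\<Sum>\<beta>\<in>?I. \<Theta> \<beta> [Z] z * \<kappa> (S \<beta>)))"
        if "z \<in> points (base B)" "pointwise_functional B z \<kappa>" for z \<kappa>
        unfolding Q_def using R(2)[OF that(2)] that(1) pointwise_functionalD[OF that(2)] \<psi>Z R(1) Z \<psi>(1)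
        by (simp add: sum_negf sum_distrib_left algebra_simps)
      have "\<Theta> \<alpha> [Q] z = 0" if \<alpha>: "\<alpha> \<in> ?I" and z: "z \<in> points (base B)" for \<alpha> z
      proof (cases "z \<in> O'")
        case True
        have "(\<Sum>\<beta>\<in>?I. \<Theta> \<beta> [Z] z * \<Theta> \<alpha> [S \<beta>] z) = (\<Sum>\<beta>\<in>?I. if \<beta> = \<alpha> then \<Theta> \<beta> [Z] z else 0)"
          by (intro sum.cong refl) (use S(2)[OF True \<alpha>] in auto)
        also have "\<dots> = \<Theta> \<alpha> [Z] z" using \<alpha> by simp
        finally show ?thesis using Q[OF z pointwise_functional_form[OF B basis_forms[OF \<alpha>] z]] by simp
      next
        case False
        then have "\<psi> z = 0" using \<psi>(7,8) z by blast
        then show ?thesis using Q[OF z pointwise_functional_form[OF B basis_forms[OF \<alpha>] z]] by simp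
      qed
      then have "Q \<in> sections_in B E" by (rule basis_detects[OF Qs])
      then show ?thesis using Q[OF yM] \<psi>1 by auto
    qed
    obtain Q where Q: "Q \<in> sections_in B E"
      "\<And>\<kappa>. pointwise_functional B y \<kappa> \<Longrightarrow> \<kappa> Q = \<kappa> Z - (\<Sum>\<beta>\<in>?I. \<Theta> \<beta> [Z] y * \<kappa> (S \<beta>))"
      using proj[OF Z] by blast
    obtain R where R: "R \<in> sections_in B E"
      "\<And>\<kappa>. pointwise_functional B y \<kappa> \<Longrightarrow> \<kappa> R = \<kappa> W - (\<Sum>\<beta>\<in>?I. \<Theta> \<beta> [W] y * \<kappa> (S \<beta>))"
      using proj[OF W] by blast
    let ?d = "dform (\<Theta> \<alpha>)"
    note dp = dform_pointwise[OF p basis_forms[OF \<alpha>] _ yM] and sk = dform_skew[OF basis_forms[OF \<alpha>] _ _ yM]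
    \<comment> \<open>Involutivity is applied to the projections of \<open>Z\<close> and
      \<open>W\<close>; the rest of the computation expands the resulting equation.\<close>
    have "br Q R \<in> sections_in B E" using inv Q(1) R(1) unfolding involutive_def by blast
    then have QR: "?d Q R y = 0"
      using dform_sections_in[OF \<alpha> Q(1) R(1) yM] basis_zero[OF _ \<alpha>] yM by simp
    \<comment> \<open>\<open>dform_pointwise\<close> gives linearity in the first argument, so the
      second is expanded by way of skew symmetry.\<close>
    have right: "?d X R y = ?d X W y - (\<Sum>\<gamma>\<in>?I. \<Theta> \<gamma> [W] y * ?d X (S \<gamma>) y)" if X: "X \<in> sections B" for X
    proof -
      have "?d X R y = - ?d R X y" by (rule sk[OF X sections_in_sections[OF R(1)]])
      also have "\<dots> = - ?d W X y + (\<Sum>\<gamma>\<in>?I. \<Theta> \<gamma> [W] y * ?d (S \<gamma>) X y)" using R(2)[OF dp[OF X]] by simp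
      also have "\<dots> = ?d X W y + (\<Sum>\<gamma>\<in>?I. - (\<Theta> \<gamma> [W] y * ?d X (S \<gamma>) y))"
        using sk[OF W X] sk[OF S(1) X] by simp
      finally show ?thesis by (simp add: sum_negf)
    qed
    have "0 = ?d Z R y - (\<Sum>\<beta>\<in>?I. \<Theta> \<beta> [Z] y * ?d (S \<beta>) R y)"
      using Q(2)[OF dp[OF sections_in_sections[OF R(1)]]] QR by simp
    also have "\<dots> = ?d Z W y - (\<Sum>\<gamma>\<in>?I. \<Theta> \<gamma> [W] y * ?d Z (S \<gamma>) y) -
        (\<Sum>\<beta>\<in>?I. \<Theta> \<beta> [Z] y * (?d (S \<beta>) W y - (\<Sum>\<gamma>\<in>?I. \<Theta> \<gamma> [W] y * ?d (S \<beta>) (S \<gamma>) y)))"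
      using right[OF Z] right[OF S(1)] by simp
    also have "(\<Sum>\<beta>\<in>?I. \<Theta> \<beta> [Z] y * (?d (S \<beta>) W y - (\<Sum>\<gamma>\<in>?I. \<Theta> \<gamma> [W] y * ?d (S \<beta>) (S \<gamma>) y))) =
       - (\<Sum>\<beta>\<in>?I. ?d W (S \<beta>) y * \<Theta> \<beta> [Z] y) - (\<Sum>\<beta>\<in>?I. \<Sum>\<gamma>\<in>?I. \<Theta> \<beta> [Z] y * \<Theta> \<gamma> [W] y * ?d (S \<beta>) (S \<gamma>) y)"
      unfolding sum_negf[symmetric] sum_subtractf[symmetric]
    proof (intro sum.cong refl)
      fix \<beta> assume "\<beta> \<in> ?I"
      then have "?d (S \<beta>) W y = - ?d W (S \<beta>) y" by (rule sk[OF S(1) W])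
      then show "\<Theta> \<beta> [Z] y * (?d (S \<beta>) W y - (\<Sum>\<gamma>\<in>?I. \<Theta> \<gamma> [W] y * ?d (S \<beta>) (S \<gamma>) y)) =
         - (?d W (S \<beta>) y * \<Theta> \<beta> [Z] y) - (\<Sum>\<gamma>\<in>?I. \<Theta> \<beta> [Z] y * \<Theta> \<gamma> [W] y * ?d (S \<beta>) (S \<gamma>) y)"
        by (simp add: right_diff_distrib sum_distrib_left mult.assoc)
    qed
    also have "(\<Sum>\<gamma>\<in>?I. \<Theta> \<gamma> [W] y * ?d Z (S \<gamma>) y) = (\<Sum>\<gamma>\<in>?I. ?d Z (S \<gamma>) y * \<Theta> \<gamma> [W] y)"
      by (simp add: mult.commute)
    finally have "?d Z W y = (\<Sum>\<gamma>\<in>?I. ?d Z (S \<gamma>) y * \<Theta> \<gamma> [W] y) - (\<Sum>\<beta>\<in>?I. ?d W (S \<beta>) y * \<Theta> \<beta> [Z] y)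
        - (\<Sum>\<beta>\<in>?I. \<Sum>\<gamma>\<in>?I. \<Theta> \<beta> [Z] y * \<Theta> \<gamma> [W] y * ?d (S \<beta>) (S \<gamma>) y)" by linarith
    also have "\<dots> = (\<Sum>\<beta>\<in>?I. F \<alpha> \<beta> Z y * \<Theta> \<beta> [W] y - F \<alpha> \<beta> W y * \<Theta> \<beta> [Z] y)"
      unfolding F_def
      by (rule skew_double_sum[symmetric, where m = "\<lambda>\<beta> \<gamma>. ?d (S \<beta>) (S \<gamma>) y"]) (rule sk[OF S(1) S(1)])
    finally show ?thesis .
  qed
  show thesis
  proof (rule that[OF O' forms])
    fix y Z W \<alpha> assume *: "y \<in> O'" "Z \<in> sections B" "W \<in> sections B" "\<alpha> \<in> ?I"
    have "y \<in> points (base B)" using *(1) mtop_subset[OF M O'(1)] by blast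
    then show "dform (\<Theta> \<alpha>) Z W y = (\<Sum>\<beta>\<in>?I. one_form B (F \<alpha> \<beta>) [Z] y * \<Theta> \<beta> [W] y - one_form B (F \<alpha> \<beta>) [W] y * \<Theta> \<beta> [Z] y)"
      using eq[OF *] * by (simp add: one_form_apply)
  qed
qed

lemma involutive_global:
  assumes inv: "involutive B br E"
  obtains \<Omega> where "\<And>\<alpha> \<beta>. \<alpha> \<in> {r+1..p} \<Longrightarrow> \<beta> \<in> {r+1..p} \<Longrightarrow> \<Omega> \<alpha> \<beta> \<in> forms B 1"
    "\<And>y Z W \<alpha>. y \<in> points (base B) \<Longrightarrow> Z \<in> sections B \<Longrightarrow> W \<in> sections B \<Longrightarrow> \<alpha> \<in> {r+1..p} \<Longrightarrow>
      dform (\<Theta> \<alpha>) Z W y = wedge_sum (\<Omega> \<alpha>) Z W y"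
proof (cases "r < p")
  \<comment> \<open>The index set is empty and there is no equation to satisfy. For
    \<open>r < p\<close> the rank is positive, as the local construction requires.\<close>
  case False
  then show thesis using that[of "\<lambda>\<alpha> \<beta>. form_zero B 1"] by auto
next
  case True
  let ?I = "{r+1..p}"
  note M = manifold_base
  define eq where "eq \<Omega> y \<longleftrightarrow> (\<forall>Z\<in>sections B. \<forall>W\<in>sections B. \<forall>\<alpha>\<in>?I.
      dform (\<Theta> \<alpha>) Z W y = wedge_sum (\<Omega> \<alpha>) Z W y)" for \<Omega> y
  \<comment> \<open>\<open>P\<close> asks for a whole family of forms, so that a single partition of
    unity serves all pairs of indices.\<close>
  define P where "P O' \<longleftrightarrow> (\<exists>\<Omega>. (\<forall>\<alpha>\<in>?I. \<forall>\<beta>\<in>?I. \<Omega> \<alpha> \<beta> \<in> forms B 1) \<and> (\<forall>y\<in>O'. eq \<Omega> y))" for O'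
  have P0: "P {}" unfolding P_def using form_zero_in_forms[OF B, of 1] by (intro exI[of _ "\<lambda>\<alpha> \<beta>. form_zero B 1"]) simp
  have cover: "\<forall>x\<in>points (base B). \<exists>V. openin (mtop (base B)) V \<and> x \<in> V \<and> P V"
  proof
    fix x assume x: "x \<in> points (base B)"
    obtain O' \<Omega> where "openin (mtop (base B)) O'" "x \<in> O'"
      "\<And>\<alpha> \<beta>. \<alpha> \<in> ?I \<Longrightarrow> \<beta> \<in> ?I \<Longrightarrow> \<Omega> \<alpha> \<beta> \<in> forms B 1"
      "\<And>y Z W \<alpha>. y \<in> O' \<Longrightarrow> Z \<in> sections B \<Longrightarrow> W \<in> sections B \<Longrightarrow> \<alpha> \<in> ?I \<Longrightarrow>
        dform (\<Theta> \<alpha>) Z W y = wedge_sum (\<Omega> \<alpha>) Z W y"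
      using involutive_local[OF inv x True] by blast
    moreover from this have "P O'" unfolding P_def eq_def by (intro exI[of _ \<Omega>] conjI ballI)
    ultimately show "\<exists>V. openin (mtop (base B)) V \<and> x \<in> V \<and> P V" by blast
  qed
  obtain g :: "nat \<Rightarrow> 'b \<Rightarrow> real" and V where g: "\<forall>n. g n \<in> smooth_functions (base B)" "\<forall>n. P (V n)"
    "\<forall>n. \<forall>x\<in>points (base B). g n x \<noteq> 0 \<longrightarrow> x \<in> V n"
    "\<forall>x\<in>points (base B). \<exists>A m. openin (mtop (base B)) A \<and> x \<in> A \<and>
       (\<forall>y\<in>A. (\<forall>n>m. g n y = 0) \<and> (\<Sum>n\<le>m. g n y) = 1)"
    using partition_of_unity[OF M P0 cover] by (elim exE conjE)
  obtain \<Omega> where \<Omega>: "\<And>n \<alpha> \<beta>. \<alpha> \<in> ?I \<Longrightarrow> \<beta> \<in> ?I \<Longrightarrow> \<Omega> n \<alpha> \<beta> \<in> forms B 1" "\<And>n y. y \<in> V n \<Longrightarrow> eq (\<Omega> n) y"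
    using g(2) unfolding P_def by metis
  define \<Xi> where "\<Xi> \<alpha> \<beta> = one_form B (\<lambda>Z x. \<Sum>n | g n x \<noteq> 0. g n x * \<Omega> n \<alpha> \<beta> [Z] x)" for \<alpha> \<beta>
  show thesis
  proof (rule that[of \<Xi>])
    fix \<alpha> \<beta> assume "\<alpha> \<in> ?I" "\<beta> \<in> ?I"
    then show "\<Xi> \<alpha> \<beta> \<in> forms B 1" unfolding \<Xi>_def
    proof (intro glue_one_forms[OF B spec[OF g(1)] \<Omega>(1)])
      fix x assume "x \<in> points (base B)"
      from bspec[OF g(4) this] show "\<exists>A m. openin (mtop (base B)) A \<and> x \<in> A \<and> (\<forall>y\<in>A. \<forall>n>m. g n y = 0)" by blast
    qed
  next
    fix y Z W \<alpha> assume y: "y \<in> points (base B)" and s: "Z \<in> sections B" "W \<in> sections B" and \<alpha>: "\<alpha> \<in> ?I"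
    let ?N = "{n. g n y \<noteq> 0}"
    obtain m where m: "\<And>n. n > m \<Longrightarrow> g n y = 0" "(\<Sum>n\<le>m. g n y) = 1" using bspec[OF g(4) y] mtop_subset by blast
    have "(\<Sum>n\<le>m. g n y) = (\<Sum>n\<in>?N. g n y)"
      using m(1) by (intro sum.mono_neutral_right) (auto simp: not_less[symmetric])
    \<comment> \<open>As the weights sum to 1, the left side is its own weighted average.\<close>
    then have "dform (\<Theta> \<alpha>) Z W y = (\<Sum>n\<in>?N. g n y * dform (\<Theta> \<alpha>) Z W y)"
      using m(2) by (simp add: sum_distrib_right[symmetric])
    also have "\<dots> = (\<Sum>n\<in>?N. g n y * wedge_sum (\<Omega> n \<alpha>) Z W y)"
    proof (intro sum.cong refl)
      fix n assume "n \<in> ?N"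
      then have "eq (\<Omega> n) y" using g(3) y \<Omega>(2) by blast
      then have "dform (\<Theta> \<alpha>) Z W y = wedge_sum (\<Omega> n \<alpha>) Z W y"
        unfolding eq_def using s \<alpha> by blast
      then show "g n y * dform (\<Theta> \<alpha>) Z W y = g n y * wedge_sum (\<Omega> n \<alpha>) Z W y"
        by (rule arg_cong)
    qed
    also have "\<dots> = (\<Sum>\<beta>\<in>?I. \<Sum>n\<in>?N. g n y * (\<Omega> n \<alpha> \<beta> [Z] y * \<Theta> \<beta> [W] y - \<Omega> n \<alpha> \<beta> [W] y * \<Theta> \<beta> [Z] y))"
      unfolding sum_distrib_left by (rule sum.swap)
    also have "\<dots> = (\<Sum>\<beta>\<in>?I. \<Xi> \<alpha> \<beta> [Z] y * \<Theta> \<beta> [W] y - \<Xi> \<alpha> \<beta> [W] y * \<Theta> \<beta> [Z] y)"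
      using y by (simp add: \<Xi>_def one_form_apply s sum_distrib_right sum_subtractf right_diff_distrib mult.assoc)
    finally show "dform (\<Theta> \<alpha>) Z W y = (\<Sum>\<beta>\<in>?I. \<Xi> \<alpha> \<beta> [Z] y * \<Theta> \<beta> [W] y - \<Xi> \<alpha> \<beta> [W] y * \<Theta> \<beta> [Z] y)" .
  qed
qed

text \<open>Both forms are restricted to pairs of sections and to points of the base, so equality as
  functions on lists amounts to equality of these values.\<close>

lemma ext_diff_eq_iff:
  "ext_diff B a br 1 \<theta> = form_sum B 2 I (\<lambda>\<beta>. wedge B 1 1 (\<Omega> \<beta>) (\<Theta> \<beta>)) \<longleftrightarrow>
   (\<forall>Z\<in>sections B. \<forall>W\<in>sections B. \<forall>y\<in>points (base B).
      dform \<theta> Z W y = (\<Sum>\<beta>\<in>I. \<Omega> \<beta> [Z] y * \<Theta> \<beta> [W] y - \<Omega> \<beta> [W] y * \<Theta> \<beta> [Z] y))"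
  (is "?l = ?r \<longleftrightarrow> ?R")
proof
  have l: "?l [Z, W] y = dform \<theta> Z W y"
    and r: "?r [Z, W] y = (\<Sum>\<beta>\<in>I. \<Omega> \<beta> [Z] y * \<Theta> \<beta> [W] y - \<Omega> \<beta> [W] y * \<Theta> \<beta> [Z] y)"
    if "Z \<in> sections B" "W \<in> sections B" "y \<in> points (base B)" for Z W y
  proof -
    have "[Z, W] \<in> tuples B 2" using that by (simp add: tuples_2)
    then show "?r [Z, W] y = (\<Sum>\<beta>\<in>I. \<Omega> \<beta> [Z] y * \<Theta> \<beta> [W] y - \<Omega> \<beta> [W] y * \<Theta> \<beta> [Z] y)"
      using that(3) by (simp add: form_sum_def wedge_1_1[OF that] del: One_nat_def)
    show "?l [Z, W] y = dform \<theta> Z W y" unfolding ext_diff_1[OF that] by (simp add: dform_def)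
  qed
  show ?R if eq: "?l = ?r"
  proof (intro ballI)
    fix Z W y assume *: "Z \<in> sections B" "W \<in> sections B" "y \<in> points (base B)"
    show "dform \<theta> Z W y = (\<Sum>\<beta>\<in>I. \<Omega> \<beta> [Z] y * \<Theta> \<beta> [W] y - \<Omega> \<beta> [W] y * \<Theta> \<beta> [Z] y)"
      using l[OF *] r[OF *] eq by simp
  qed
  show "?l = ?r" if R: ?R
  proof (intro ext)
    fix Zs y
    show "?l Zs y = ?r Zs y"
    proof (cases "Zs \<in> tuples B 2 \<and> y \<in> points (base B)")
      case True
      then obtain Z W where "Z \<in> sections B" "W \<in> sections B" "Zs = [Z, W]" unfolding tuples_2 by blast
      then show ?thesis using l r R True by simp
    next
      case False
      moreover have "Suc 1 = 2" by simp
      ultimately show ?thesis by (auto simp: ext_diff_def form_sum_def restrict_def simp del: One_nat_def)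
    qed
  qed
qed

text \<open>Membership in the ideal holds for any one-forms \<Omega>, since each product has a
  factor \<Theta>_\<beta> from the annihilator; the substance of the equivalence lies in the
  equation for the differential.\<close>

theorem involutive_iff_structure_forms:
  "involutive B br E \<longleftrightarrow>
    (\<exists>\<Omega> :: nat \<Rightarrow> nat \<Rightarrow> ('e, 'b) form.
       (\<forall>\<alpha>\<in>{r+1..p}. \<forall>\<beta>\<in>{r+1..p}. \<Omega> \<alpha> \<beta> \<in> forms B 1) \<and>
       (\<forall>\<alpha>\<in>{r+1..p}.
          ext_diff B a br 1 (\<Theta> \<alpha>) = form_sum B 2 {r+1..p} (\<lambda>\<beta>. wedge B 1 1 (\<Omega> \<alpha> \<beta>) (\<Theta> \<beta>)) \<and>
          homogeneous B 2 (form_sum B 2 {r+1..p} (\<lambda>\<beta>. wedge B 1 1 (\<Omega> \<alpha> \<beta>) (\<Theta> \<beta>)))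
            \<in> Idl\<^bsub>exterior_algebra B\<^esub> (homogeneous B 1 ` annihilator_sections B E)))"
  (is "_ \<longleftrightarrow> ?R")
proof
  assume "involutive B br E"
  then obtain \<Omega> where \<Omega>: "\<And>\<alpha> \<beta>. \<alpha> \<in> {r+1..p} \<Longrightarrow> \<beta> \<in> {r+1..p} \<Longrightarrow> \<Omega> \<alpha> \<beta> \<in> forms B 1"
    "\<And>y Z W \<alpha>. y \<in> points (base B) \<Longrightarrow> Z \<in> sections B \<Longrightarrow> W \<in> sections B \<Longrightarrow> \<alpha> \<in> {r+1..p} \<Longrightarrow>
      dform (\<Theta> \<alpha>) Z W y = wedge_sum (\<Omega> \<alpha>) Z W y"
    using involutive_global by blast
  show ?R
  proof (intro exI[of _ \<Omega>] conjI ballI \<Omega>(1))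
    fix \<alpha> assume \<alpha>: "\<alpha> \<in> {r+1..p}"
    show "ext_diff B a br 1 (\<Theta> \<alpha>) = form_sum B 2 {r+1..p} (\<lambda>\<beta>. wedge B 1 1 (\<Omega> \<alpha> \<beta>) (\<Theta> \<beta>))"
      unfolding ext_diff_eq_iff using \<Omega>(2) \<alpha> by blast
    show "homogeneous B 2 (form_sum B 2 {r+1..p} (\<lambda>\<beta>. wedge B 1 1 (\<Omega> \<alpha> \<beta>) (\<Theta> \<beta>)))
        \<in> Idl\<^bsub>exterior_algebra B\<^esub> (homogeneous B 1 ` annihilator_sections B E)"
      by (rule sum_wedge_in_genideal[OF B finite_atLeastAtMost \<Omega>(1)[OF \<alpha>] basis_annihilator])
  qed
next
  assume ?R
  then obtain \<Omega> :: "nat \<Rightarrow> nat \<Rightarrow> ('e, 'b) form" where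
    "\<And>\<alpha>. \<alpha> \<in> {r+1..p} \<Longrightarrow> ext_diff B a br 1 (\<Theta> \<alpha>) = form_sum B 2 {r+1..p} (\<lambda>\<beta>. wedge B 1 1 (\<Omega> \<alpha> \<beta>) (\<Theta> \<beta>))"
    by blast
  then have \<Omega>: "dform (\<Theta> \<alpha>) Z W y = wedge_sum (\<Omega> \<alpha>) Z W y"
    if "\<alpha> \<in> {r+1..p}" "Z \<in> sections B" "W \<in> sections B" "y \<in> points (base B)" for \<alpha> Z W y
    unfolding ext_diff_eq_iff using that by blast
  show "involutive B br E" unfolding involutive_def
  proof (intro ballI, rule basis_detects)
    fix S T assume *: "S \<in> sections_in B E" "T \<in> sections_in B E"
    show "br S T \<in> sections B" by (intro br_closed sections_in_sections *)
  next
    fix S T \<alpha> x assume *: "S \<in> sections_in B E" "T \<in> sections_in B E" "\<alpha> \<in> {r+1..p}" "x \<in> points (base B)"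
    have "\<Theta> \<alpha> [br S T] x = - dform (\<Theta> \<alpha>) S T x" using dform_sections_in[OF *(3,1,2,4)] by simp
    \<comment> \<open>Each summand contains the value of some \<Theta>_\<beta> on \<open>S\<close>
      or on \<open>T\<close>, which is 0.\<close>
    also have "\<dots> = 0"
      using \<Omega>[OF *(3) sections_in_sections[OF *(1)] sections_in_sections[OF *(2)] *(4)] *(4)
        basis_zero[OF *(1)] basis_zero[OF *(2)] by simp
    finally show "\<Theta> \<alpha> [br S T] x = 0" .
  qed
qed

end

end

section \<open>The pull-back Lie algebroid\<close>

lemma pullback_simps [simp]:
  "base (pullback_bundle M h F) = M" "frank (pullback_bundle M h F) = frank F"
  "bproj (pullback_bundle M h F) = fst" "fzero (pullback_bundle M h F) x = (x, fzero F (h x))"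
  "fadd (pullback_bundle M h F) (x, e) (y, e') = (x, fadd F e e')"
  "fscale (pullback_bundle M h F) c (x, e) = (x, fscale F c e)"
  by (simp_all add: pullback_bundle_def)

lemma fibre_pullback: "x \<in> points M \<Longrightarrow> fibre (pullback_bundle M h F) x = Pair x ` fibre F (h x)"
  by (auto simp: fibre_def pullback_bundle_def)

lemma trivs_pullback:
  "(U, \<tau>) \<in> trivs (pullback_bundle M h F) \<longleftrightarrow>
    (\<exists>V \<sigma>. (V, \<sigma>) \<in> trivs F \<and> U = {x \<in> points M. h x \<in> V} \<and> \<tau> = (\<lambda>(x, e). \<sigma> e))"
  unfolding pullback_bundle_def by (auto simp: image_iff intro!: bexI[rotated])

lemma trivs_pullbackE:
  assumes "c \<in> trivs (pullback_bundle M h F)"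
  obtains V \<sigma> where "(V, \<sigma>) \<in> trivs F" "c = ({x \<in> points M. h x \<in> V}, \<lambda>(x, e). \<sigma> e)"
  using assms by (auto simp: pullback_bundle_def)

text \<open>The transition coefficients of the pull-back are the old ones composed with
  \<open>h\<close>.\<close>

lemma smooth_transition_pullback:
  assumes M: "smooth_manifold M" and N: "smooth_manifold (base F)" and h: "smooth_map M (base F) h"
    and o: "openin (mtop (base F)) (U \<inter> V)" and st: "smooth_transition F U \<sigma> V \<tau>"
  shows "smooth_transition (pullback_bundle M h F)
    {x \<in> points M. h x \<in> U} (\<lambda>(x, e). \<sigma> e) {x \<in> points M. h x \<in> V} (\<lambda>(x, e). \<tau> e)"
proof -
  obtain g where g: "\<And>i j. i < frank F \<Longrightarrow> j < frank F \<Longrightarrow> smooth_fun_on (base F) (U \<inter> V) (g i j)"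
    "\<And>x e i. x \<in> U \<inter> V \<Longrightarrow> e \<in> fibre F x \<Longrightarrow> i < frank F \<Longrightarrow> \<tau> e i = (\<Sum>j<frank F. g i j x * \<sigma> e j)"
    using st unfolding smooth_transition_def by blast
  have eq: "{x \<in> points M. h x \<in> U} \<inter> {x \<in> points M. h x \<in> V} = {x \<in> points M. h x \<in> U \<inter> V}" by blast
  show ?thesis unfolding smooth_transition_def eq pullback_simps
  proof (intro exI[of _ "\<lambda>i j x. g i j (h x)"] conjI allI impI ballI)
    fix i j assume "i < frank F" "j < frank F"
    then show "smooth_fun_on M {x \<in> points M. h x \<in> U \<inter> V} (\<lambda>x. g i j (h x))"
      by (intro smooth_fun_on_compose(2)[OF M N h o] g(1))
  next
    fix x e i assume x: "x \<in> {x \<in> points M. h x \<in> U \<inter> V}" and e: "e \<in> fibre (pullback_bundle M h F) x" and i: "i < frank F"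
    have "e \<in> Pair x ` fibre F (h x)" using e x fibre_pullback[of x M h F] by simp
    then show "(case e of (x, e) \<Rightarrow> \<tau> e) i = (\<Sum>j<frank F. g i j (h x) * (case e of (x, e) \<Rightarrow> \<sigma> e) j)"
      using x i g(2) by auto
  qed
qed

context generalized_lie_algebroid
begin

abbreviation "N \<equiv> base F"
abbreviation "hF \<equiv> pullback_bundle M h F"
abbreviation "h_inv \<equiv> inv_into (points M) h"
abbreviation "eta_inv \<equiv> inv_into (points N) \<eta>"
text \<open>To obtain a tangent vector at \<open>x\<close>, \<rho> must be applied over
  \<open>eta_inv x\<close>; the pulled-back section has its value for that fibre at the preimage of
  \<open>eta_inv x\<close> under \<open>h\<close>.\<close>

abbreviation "shift x \<equiv> h_inv (eta_inv x)"

lemma manifold_N: "smooth_manifold N"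
  by (rule vbundle_manifold[OF bundle_F])

lemma h_maps:
  shows "x \<in> points M \<Longrightarrow> h x \<in> points N" "y \<in> points N \<Longrightarrow> h_inv y \<in> points M"
    "x \<in> points M \<Longrightarrow> h_inv (h x) = x" "y \<in> points N \<Longrightarrow> h (h_inv y) = y"
    and h_smooth: "smooth_map M N h" "smooth_map N M h_inv"
  using diffeo_h unfolding diffeomorphism_def
  by (auto simp: bij_betw_def inv_into_into f_inv_into_f)

lemma eta_maps:
  "y \<in> points N \<Longrightarrow> \<eta> y \<in> points M" "x \<in> points M \<Longrightarrow> eta_inv x \<in> points N"
  "y \<in> points N \<Longrightarrow> eta_inv (\<eta> y) = y" "x \<in> points M \<Longrightarrow> \<eta> (eta_inv x) = x"
  using diffeo_eta unfolding diffeomorphism_def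
  by (auto simp: bij_betw_def inv_into_into f_inv_into_f)

text \<open>The Leibniz rule of \<open>F\<close> has coefficients on \<open>N\<close>, so
  coefficients on \<open>M\<close> are carried over by the inverse of \<open>h\<close>.\<close>

lemma smooth_functions_push:
  assumes "f \<in> smooth_functions M"
  shows "(\<lambda>y\<in>points N. f (h_inv y)) \<in> smooth_functions N"
proof -
  have "{y \<in> points N. h_inv y \<in> points M} = points N" using h_maps(2) by blast
  with smooth_fun_on_compose(2)[OF manifold_N manifold_M h_smooth(2) openin_points[OF manifold_M]
      smooth_functionsD[OF manifold_M assms subset_refl]]
  show ?thesis by (simp add: smooth_functions_restrict[OF manifold_N])
qed

lemma local_triv_pullback:
  assumes V: "(V, \<tau>) \<in> trivs F"
  shows "local_triv hF {x \<in> points M. h x \<in> V} (\<lambda>(x, e). \<tau> e)"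
  unfolding local_triv_def pullback_simps
proof (intro conjI ballI)
  note lt = triv_local_triv[OF bundle_F V]
  note o = local_triv_open[OF bundle_F lt]
  show "openin (mtop M) {x \<in> points M. h x \<in> V}"
    by (rule smooth_fun_on_compose(1)[OF manifold_M manifold_N h_smooth(1) o smooth_fun_on_const[OF manifold_N]])
  fix x assume x: "x \<in> {x \<in> points M. h x \<in> V}"
  then have fib: "fibre hF x = Pair x ` fibre F (h x)" and hx: "h x \<in> V" by (auto simp: fibre_pullback)
  note lin = local_triv_linear[OF bundle_F lt hx]
  show "bij_betw (\<lambda>(x, e). \<tau> e) (fibre hF x) (topspace (Euclidean_space (frank F)))"
    unfolding fib using local_triv_bij[OF bundle_F lt hx]
    by (auto simp: bij_betw_def inj_on_def image_image)
  show "\<forall>i. (case (x, fzero F (h x)) of (x, e) \<Rightarrow> \<tau> e) i = 0" using lin(1) by simp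
  show "\<forall>i. (case fadd hF e e' of (x, e) \<Rightarrow> \<tau> e) i = (case e of (x, e) \<Rightarrow> \<tau> e) i + (case e' of (x, e) \<Rightarrow> \<tau> e) i"
    if "e \<in> fibre hF x" "e' \<in> fibre hF x" for e e'
    using that lin(2) unfolding fib by auto
  show "\<forall>c i. (case fscale hF c e of (x, e) \<Rightarrow> \<tau> e) i = c * (case e of (x, e) \<Rightarrow> \<tau> e) i"
    if "e \<in> fibre hF x" for e
    using that lin(3) unfolding fib by auto
next
  note lt = triv_local_triv[OF bundle_F V]
  fix c assume "c \<in> trivs hF"
  then obtain U \<sigma> where U: "(U, \<sigma>) \<in> trivs F" "c = ({x \<in> points M. h x \<in> U}, \<lambda>(x, e). \<sigma> e)"
    by (rule trivs_pullbackE)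
  have "openin (mtop N) U" "openin (mtop N) V"
    using local_triv_open[OF bundle_F] lt triv_local_triv[OF bundle_F U(1)] by auto
  then have o: "openin (mtop N) (U \<inter> V)" "openin (mtop N) (V \<inter> U)" by auto
  note pb = smooth_transition_pullback[OF manifold_M manifold_N h_smooth(1)]
  show "case c of (U, \<sigma>) \<Rightarrow>
      smooth_transition hF U \<sigma> {x \<in> points M. h x \<in> V} (\<lambda>(x, e). \<tau> e) \<and>
      smooth_transition hF {x \<in> points M. h x \<in> V} (\<lambda>(x, e). \<tau> e) U \<sigma>"
    unfolding U(2) prod.case
    using pb[OF o(1) local_triv_transition(1)[OF bundle_F lt U(1)]]
      pb[OF o(2) local_triv_transition(2)[OF bundle_F lt U(1)]] by blast
qed

lemma vector_bundle_pullback: "vector_bundle hF"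
  unfolding vector_bundle_def pullback_simps
proof (intro conjI ballI manifold_M)
  show "fst \<in> tot hF \<rightarrow> points M" by (auto simp: pullback_bundle_def)
  show "points M = (\<Union>(U, \<tau>)\<in>trivs hF. U)"
  proof
    show "points M \<subseteq> (\<Union>(U, \<tau>)\<in>trivs hF. U)"
    proof
      fix x assume x: "x \<in> points M"
      obtain U \<tau> where "(U, \<tau>) \<in> trivs F" "h x \<in> U" using triv_cover[OF bundle_F h_maps(1)[OF x]] by blast
      then have "({x \<in> points M. h x \<in> U}, \<lambda>(x, e). \<tau> e) \<in> trivs hF" "x \<in> {x \<in> points M. h x \<in> U}"
        using x trivs_pullback by blast+
      then show "x \<in> (\<Union>(U, \<tau>)\<in>trivs hF. U)" by blast
    qed
  qed (auto simp: trivs_pullback)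
  show "case c of (U, \<tau>) \<Rightarrow> local_triv hF U \<tau>" if "c \<in> trivs hF" for c
    using that by (rule trivs_pullbackE) (simp add: local_triv_pullback)
  fix x assume x: "x \<in> points M"
  note fc = fibre_closed[OF bundle_F h_maps(1)[OF x]] and fib = fibre_pullback[OF x]
  show "(x, fzero F (h x)) \<in> fibre hF x" using fc(1) unfolding fib by blast
  show "fadd hF e e' \<in> fibre hF x" if "e \<in> fibre hF x" "e' \<in> fibre hF x" for e e'
    using that fc(2) unfolding fib by auto
  show "\<forall>c. fscale hF c e \<in> fibre hF x" if "e \<in> fibre hF x" for e
    using that fc(3) unfolding fib by auto
qed

section \<open>Sections of the pull-back bundle\<close>

lemma section_pair:
  assumes "Z \<in> sections hF" "x \<in> points M"
  obtains e where "Z x = (x, e)" "e \<in> fibre F (h x)"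
proof -
  have "Z x \<in> Pair x ` fibre F (h x)"
    using section_in_fibre[OF vector_bundle_pullback assms(1), of x] assms(2) unfolding fibre_pullback[OF assms(2)] by simp
  then show thesis using that by blast
qed

lemma snd_section: "Z \<in> sections hF \<Longrightarrow> x \<in> points M \<Longrightarrow> Z x = (x, snd (Z x)) \<and> snd (Z x) \<in> fibre F (h x)"
  by (erule (1) section_pair) simp

lemma pull_sec_sections:
  assumes z: "z \<in> sections F"
  shows "pull_sec M h z \<in> sections hF"
  unfolding sections_iff[OF vector_bundle_pullback] pullback_simps
proof (intro conjI ballI)
  show "pull_sec M h z \<in> extensional (points M)" by (simp add: pull_sec_def)
  show "pull_sec M h z x \<in> fibre hF x" if x: "x \<in> points M" for x
    using x section_in_fibre[OF bundle_F z h_maps(1)[OF x]] by (simp add: pull_sec_def fibre_pullback)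
  fix c assume "c \<in> trivs hF"
  then obtain V \<tau> where V: "(V, \<tau>) \<in> trivs F" "c = ({x \<in> points M. h x \<in> V}, \<lambda>(x, e). \<tau> e)"
    by (rule trivs_pullbackE)
  note lt = triv_local_triv[OF bundle_F V(1)]
  note cmp = smooth_fun_on_compose[OF manifold_M manifold_N h_smooth(1) local_triv_open[OF bundle_F lt]]
  have "smooth_fun_on M {x \<in> points M. h x \<in> V} (\<lambda>x. (case pull_sec M h z x of (x, e) \<Rightarrow> \<tau> e) i)" if i: "i < frank F" for i
    by (rule smooth_fun_on_cong[OF manifold_M cmp(1) _ cmp(2)])
      (use section_component_smooth[OF bundle_F z lt i] in \<open>auto simp: pull_sec_def\<close>)
  then show "case c of (U, \<tau>) \<Rightarrow> \<forall>i<frank F. smooth_fun_on M U (\<lambda>x. \<tau> (pull_sec M h z x) i)"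
    unfolding V(2) by simp
qed

lemma unpull_sections:
  assumes Z: "Z \<in> sections hF"
  shows "unpull M h F Z \<in> sections F"
  unfolding sections_iff[OF bundle_F]
proof (intro conjI ballI)
  show "unpull M h F Z \<in> extensional (points N)" by (simp add: unpull_def)
  show "unpull M h F Z y \<in> fibre F y" if y: "y \<in> points N" for y
    using y snd_section[OF Z h_maps(2)[OF y]] h_maps(4)[OF y] by (simp add: unpull_def)
  fix c assume c: "c \<in> trivs F"
  obtain V \<tau> where V: "c = (V, \<tau>)" by (cases c)
  note lt = triv_local_triv[OF bundle_F c[unfolded V]] and ltp = local_triv_pullback[OF c[unfolded V]]
  let ?V = "{x \<in> points M. h x \<in> V}"
  have Vsub: "V \<subseteq> points N" by (rule local_triv_subset[OF bundle_F lt])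
  have eq: "{y \<in> points N. h_inv y \<in> ?V} = V" using Vsub h_maps(2,4) by auto
  have "openin (mtop M) ?V" using local_triv_open[OF vector_bundle_pullback ltp] by simp
  note cmp = smooth_fun_on_compose[OF manifold_N manifold_M h_smooth(2) this]
  have "smooth_fun_on N V (\<lambda>y. \<tau> (unpull M h F Z y) i)" if i: "i < frank F" for i
  proof -
    have "smooth_fun_on M ?V (\<lambda>x. (case Z x of (x, e) \<Rightarrow> \<tau> e) i)"
      using section_component_smooth[OF vector_bundle_pullback Z ltp] i by simp
    from cmp(2)[OF this] have "smooth_fun_on N V (\<lambda>y. (case Z (h_inv y) of (x, e) \<Rightarrow> \<tau> e) i)" unfolding eq .
    then show ?thesis
      by (rule smooth_fun_on_cong[OF manifold_N local_triv_open[OF bundle_F lt], rotated])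
        (use Vsub in \<open>auto simp: unpull_def case_prod_beta\<close>)
  qed
  then show "case c of (U, \<tau>) \<Rightarrow> \<forall>i<frank F. smooth_fun_on N U (\<lambda>x. \<tau> (unpull M h F Z x) i)"
    unfolding V by simp
qed

lemma pull_unpull: "Z \<in> sections hF \<Longrightarrow> pull_sec M h (unpull M h F Z) = Z"
  using snd_section[of Z] sections_iff[OF vector_bundle_pullback, of Z]
  by (intro extensionalityI[of _ "points M"]) (auto simp: pull_sec_def unpull_def h_maps)

lemma unpull_ops:
  assumes "Z \<in> sections hF"
  shows "W \<in> sections hF \<Longrightarrow> unpull M h F (sec_add hF Z W) = sec_add F (unpull M h F Z) (unpull M h F W)"
    and "unpull M h F (sec_scale hF f Z) = sec_scale F (\<lambda>y\<in>points N. f (h_inv y)) (unpull M h F Z)"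
proof -
  show "unpull M h F (sec_add hF Z W) = sec_add F (unpull M h F Z) (unpull M h F W)" if W: "W \<in> sections hF"
  proof (intro extensionalityI[of _ "points N"])
    fix y assume y: "y \<in> points N"
    obtain e where e: "Z (h_inv y) = (h_inv y, e)" using section_pair[OF assms h_maps(2)[OF y]] by blast
    obtain e' where e': "W (h_inv y) = (h_inv y, e')" using section_pair[OF W h_maps(2)[OF y]] by blast
    show "unpull M h F (sec_add hF Z W) y = sec_add F (unpull M h F Z) (unpull M h F W) y"
      using y e e' by (simp add: unpull_def sec_add_def h_maps)
  qed (simp_all add: unpull_def sec_add_def)
  show "unpull M h F (sec_scale hF f Z) = sec_scale F (\<lambda>y\<in>points N. f (h_inv y)) (unpull M h F Z)"
  proof (intro extensionalityI[of _ "points N"])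
    fix y assume y: "y \<in> points N"
    obtain e where e: "Z (h_inv y) = (h_inv y, e)" using section_pair[OF assms h_maps(2)[OF y]] by blast
    show "unpull M h F (sec_scale hF f Z) y = sec_scale F (\<lambda>y\<in>points N. f (h_inv y)) (unpull M h F Z) y"
      using y e by (simp add: unpull_def sec_scale_def h_maps)
  qed (simp_all add: unpull_def sec_scale_def)
qed

lemma pull_sec_ops:
  "pull_sec M h (sec_add F z w) = sec_add hF (pull_sec M h z) (pull_sec M h w)"
  "pull_sec M h (sec_scale F f z) = sec_scale hF (\<lambda>x. f (h x)) (pull_sec M h z)"
  "pull_sec M h (sec_zero F) = sec_zero hF"
  by (auto simp: pull_sec_def sec_add_def sec_scale_def sec_zero_def h_maps fun_eq_iff)

section \<open>The anchor of the pull-back algebroid\<close>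

lemma shift_closed: "x \<in> points M \<Longrightarrow> shift x \<in> points M"
  by (simp add: eta_maps h_maps)

lemma rho_fibre:
  assumes "x \<in> points M" "e \<in> fibre F (eta_inv x)"
  obtains v where "\<rho> e = (x, v)" "v \<in> tangent_space M x"
proof -
  have e: "e \<in> tot F" "bproj F e = eta_inv x" using assms(2) by (auto simp: fibre_def)
  have "smooth_map (total_space F) (total_space (tangent_bundle M)) \<rho>"
    and proj: "\<forall>e\<in>tot F. bproj (tangent_bundle M) (\<rho> e) = \<eta> (bproj F e)"
    using morphism_rho unfolding vb_morphism_def by blast+
  then have "\<rho> e \<in> tot (tangent_bundle M)" using e(1) unfolding smooth_map_def total_space_def by auto
  moreover have "fst (\<rho> e) = x" using proj e eta_maps(4)[OF assms(1)] by (simp add: tangent_bundle_def)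
  ultimately show thesis using that[of "snd (\<rho> e)"] by (cases "\<rho> e") (auto simp: tangent_bundle_def)
qed

lemma pb_anchor_apply:
  assumes "Z \<in> sections hF" "x \<in> points M"
  shows "vf_apply M (pb_anchor M h \<eta> F \<rho> Z) f x = snd (\<rho> (snd (Z (shift x)))) f"
    and "snd (Z (shift x)) \<in> fibre F (eta_inv x)"
proof -
  show "vf_apply M (pb_anchor M h \<eta> F \<rho> Z) f x = snd (\<rho> (snd (Z (shift x)))) f"
    using assms(2) eta_maps(2) by (simp add: vf_apply_def pb_anchor_def sec_map_def unpull_def)
  show "snd (Z (shift x)) \<in> fibre F (eta_inv x)"
    using snd_section[OF assms(1) shift_closed[OF assms(2)]] h_maps(4) eta_maps(2)[OF assms(2)] by simp
qed

lemma pb_anchor_derivation: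
  assumes "Z \<in> sections hF" "x \<in> points M"
  obtains v where "v \<in> tangent_space M x" "\<And>f. vf_apply M (pb_anchor M h \<eta> F \<rho> Z) f x = v f"
proof -
  obtain v where "\<rho> (snd (Z (shift x))) = (x, v)" "v \<in> tangent_space M x"
    by (rule rho_fibre[OF assms(2) pb_anchor_apply(2)[OF assms]])
  then show thesis using that[of v] pb_anchor_apply(1)[OF assms] by simp
qed

lemma tangent_local:
  assumes "v \<in> tangent_space M x" "openin (mtop M) A" "x \<in> A" "\<And>y. y \<in> A \<Longrightarrow> f y = g y"
  shows "v f = v g"
proof -
  have "\<forall>f g A. openin (mtop M) A \<longrightarrow> x \<in> A \<longrightarrow> (\<forall>y\<in>A. f y = g y) \<longrightarrow> v f = v g"
    using assms(1) unfolding tangent_space_def mem_Collect_eq by (elim conjE)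
  then show ?thesis using assms(2-4) by meson
qed

lemma tangent_derivation:
  assumes "v \<in> tangent_space M x" "smooth_near M x f" "smooth_near M x g"
  shows "v (\<lambda>x. f x + g x) = v f + v g" "v (\<lambda>x. f x * g x) = v f * g x + f x * v g"
proof -
  have "\<forall>f g. smooth_near M x f \<longrightarrow> smooth_near M x g \<longrightarrow>
      v (\<lambda>x. f x + g x) = v f + v g \<and> v (\<lambda>x. f x * g x) = v f * g x + f x * v g"
    using assms(1) unfolding tangent_space_def mem_Collect_eq by (elim conjE)
  then show "v (\<lambda>x. f x + g x) = v f + v g" "v (\<lambda>x. f x * g x) = v f * g x + f x * v g"
    using assms(2,3) by simp_all
qed

text \<open>The two anchors are related by \<open>h\<close>. The inverse of
  \<open>h \<circ> \<eta>\<close> sends \<open>h x\<close> to \<open>eta_inv x\<close>, so both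
  apply \<rho> to the same vector, and Th undoes the transport of \<open>f\<close> to
  \<open>N\<close>.\<close>

lemma anchor_N_eq_pb_anchor:
  assumes Z: "Z \<in> sections hF" and f: "f \<in> smooth_functions M" and x: "x \<in> points M"
  shows "vf_apply N (anchor_N M h \<eta> F \<rho> (unpull M h F Z)) (\<lambda>y\<in>points N. f (h_inv y)) (h x) =
    vf_apply M (pb_anchor M h \<eta> F \<rho> Z) f x"
proof -
  let ?g = "\<lambda>y\<in>points N. f (h_inv y)"
  have "inj_on (h \<circ> \<eta>) (points N)"
  proof (rule inj_onI)
    fix a b assume ab: "a \<in> points N" "b \<in> points N" and eq: "(h \<circ> \<eta>) a = (h \<circ> \<eta>) b"
    have "\<eta> a = \<eta> b" using h_maps(3)[OF eta_maps(1)] ab eq unfolding comp_apply by metis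
    then show "a = b" using eta_maps(3) ab by metis
  qed
  then have inv: "inv_into (points N) (h \<circ> \<eta>) (h x) = eta_inv x"
    by (rule inv_into_f_eq) (simp_all add: eta_maps x)
  obtain v where v: "\<rho> (snd (Z (shift x))) = (x, v)" "v \<in> tangent_space M x"
    by (rule rho_fibre[OF x pb_anchor_apply(2)[OF Z x]])
  \<comment> \<open>\<open>tangent_map\<close> gives 0 on functions that are not smooth near the
    point, so smoothness decides which branch is taken.\<close>
  have near: "smooth_near N (h x) ?g"
    by (rule smooth_near_smooth_function[OF manifold_N smooth_functions_push[OF f] h_maps(1)[OF x]])
  have "vf_apply N (anchor_N M h \<eta> F \<rho> (unpull M h F Z)) ?g (h x) = v (\<lambda>z. ?g (h z))"
    using x near v(1) by (simp add: vf_apply_def anchor_N_def sec_map_def inv h_maps eta_maps unpull_def tangent_map_def)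
  also have "\<dots> = v f"
    by (rule tangent_local[OF v(2) openin_points[OF manifold_M] x]) (simp add: h_maps)
  finally show ?thesis using pb_anchor_apply(1)[OF Z x] v(1) by simp
qed

text \<open>The bracket laws are carried along the bijection of sections and the Leibniz rule along
  \<open>anchor_N_eq_pb_anchor\<close>. The laws of the anchor hold pointwise, because \<rho> is
  fibrewise linear with derivations as values.\<close>

lemma anchored_bracket_pullback:
  "anchored_bracket hF (pb_anchor M h \<eta> F \<rho>) (pb_bracket M h F br) (\<lambda>x. shift x)"
proof (unfold_locales, unfold pullback_simps)
  let ?u = "unpull M h F" and ?br = "pb_bracket M h F br"
  note us = unpull_sections and ps = pull_sec_sections
  have brF: "u \<in> sections F \<Longrightarrow> v \<in> sections F \<Longrightarrow> br u v \<in> sections F"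
    "u \<in> sections F \<Longrightarrow> v \<in> sections F \<Longrightarrow> w \<in> sections F \<Longrightarrow> br (sec_add F u v) w = sec_add F (br u w) (br v w)"
    "u \<in> sections F \<Longrightarrow> v \<in> sections F \<Longrightarrow> w \<in> sections F \<Longrightarrow> br w (sec_add F u v) = sec_add F (br w u) (br w v)"
    "u \<in> sections F \<Longrightarrow> br u u = sec_zero F" for u v w
    using lie_algebra unfolding real_lie_bracket_def by blast+
  show "vector_bundle hF" by (rule vector_bundle_pullback)
  fix Z W assume s: "Z \<in> sections hF" "W \<in> sections hF"
  show "?br Z W \<in> sections hF" unfolding pb_bracket_def by (intro ps brF us s)
  fix Z' assume s': "Z' \<in> sections hF"
  show "?br (sec_add hF Z Z') W = sec_add hF (?br Z W) (?br Z' W)"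
    "?br W (sec_add hF Z Z') = sec_add hF (?br W Z) (?br W Z')"
    by (simp_all add: pb_bracket_def unpull_ops s s' us brF pull_sec_ops)
next
  fix Z assume s: "Z \<in> sections hF"
  show "pb_bracket M h F br Z Z = sec_zero hF"
    using lie_algebra unpull_sections[OF s] unfolding real_lie_bracket_def pb_bracket_def
    by (simp add: pull_sec_ops)
next
  fix Z W f assume s: "Z \<in> sections hF" "W \<in> sections hF" and f: "f \<in> smooth_functions M"
  let ?u = "unpull M h F" and ?f = "\<lambda>y\<in>points N. f (h_inv y)"
  have "pb_bracket M h F br Z (sec_scale hF f W) =
     sec_add hF (sec_scale hF (\<lambda>x. ?f (h x)) (pb_bracket M h F br Z W))
       (sec_scale hF (\<lambda>x. vf_apply N (anchor_N M h \<eta> F \<rho> (?u Z)) ?f (h x)) W)"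
    unfolding pb_bracket_def unpull_ops(2)[OF s(2)]
      leibniz[OF unpull_sections[OF s(1)] unpull_sections[OF s(2)] smooth_functions_push[OF f]]
    by (simp add: pull_sec_ops pull_unpull[OF s(2)])
  also have "sec_scale hF (\<lambda>x. ?f (h x)) (pb_bracket M h F br Z W) = sec_scale hF f (pb_bracket M h F br Z W)"
    by (auto simp: sec_scale_def h_maps fun_eq_iff)
  also have "sec_scale hF (\<lambda>x. vf_apply N (anchor_N M h \<eta> F \<rho> (?u Z)) ?f (h x)) W =
     sec_scale hF (vf_apply M (pb_anchor M h \<eta> F \<rho> Z) f) W"
    using anchor_N_eq_pb_anchor[OF s(1) f] by (simp add: sec_scale_def cong: restrict_cong)
  finally show "pb_bracket M h F br Z (sec_scale hF f W) =
     sec_add hF (sec_scale hF f (pb_bracket M h F br Z W))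
       (sec_scale hF (vf_apply M (pb_anchor M h \<eta> F \<rho> Z) f) W)" .
next
  show "shift x \<in> points M" if "x \<in> points M" for x by (rule shift_closed[OF that])
next
  let ?a = "pb_anchor M h \<eta> F \<rho>"
  fix Z W x f assume s: "Z \<in> sections hF" "W \<in> sections hF" and x: "x \<in> points M"
  have add: "\<rho> (fadd F e e') = fadd (tangent_bundle M) (\<rho> e) (\<rho> e')"
    if "e \<in> fibre F (eta_inv x)" "e' \<in> fibre F (eta_inv x)" for e e'
    using morphism_rho eta_maps(2)[OF x] that unfolding vb_morphism_def by blast
  obtain e where e: "Z (shift x) = (shift x, e)" using section_pair[OF s(1) shift_closed[OF x]] by blast
  obtain e' where e': "W (shift x) = (shift x, e')" using section_pair[OF s(2) shift_closed[OF x]] by blast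
  have "snd (sec_add hF Z W (shift x)) = fadd F (snd (Z (shift x))) (snd (W (shift x)))"
    using shift_closed[OF x] e e' by (simp add: sec_add_def)
  then show "vf_apply M (?a (sec_add hF Z W)) f x = vf_apply M (?a Z) f x + vf_apply M (?a W) f x"
    using pb_anchor_apply[OF s(1) x] pb_anchor_apply[OF s(2) x]
      pb_anchor_apply(1)[OF sec_add_sections[OF vector_bundle_pullback s] x] add
    by (simp add: tangent_bundle_def case_prod_beta)
next
  let ?a = "pb_anchor M h \<eta> F \<rho>"
  fix Z g x f assume s: "Z \<in> sections hF" and g: "g \<in> smooth_functions M" and x: "x \<in> points M"
  have scale: "\<rho> (fscale F c e) = fscale (tangent_bundle M) c (\<rho> e)" if "e \<in> fibre F (eta_inv x)" for e c
    using morphism_rho that unfolding vb_morphism_def fibre_def by blast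
  have gZ: "sec_scale hF g Z \<in> sections hF"
    using sec_scale_in_sections[OF vector_bundle_pullback] s g by simp
  obtain e where "Z (shift x) = (shift x, e)" using section_pair[OF s shift_closed[OF x]] by blast
  \<comment> \<open>The scalar is evaluated where the anchor reads the section, which produces
    \<open>g (shift x)\<close> instead of \<open>g x\<close>.\<close>
  then have "snd (sec_scale hF g Z (shift x)) = fscale F (g (shift x)) (snd (Z (shift x)))"
    using shift_closed[OF x] by (simp add: sec_scale_def)
  then show "vf_apply M (?a (sec_scale hF g Z)) f x = g (shift x) * vf_apply M (?a Z) f x"
    using pb_anchor_apply[OF s x] pb_anchor_apply(1)[OF gZ x] scale
    by (simp add: tangent_bundle_def case_prod_beta)
next
  let ?a = "pb_anchor M h \<eta> F \<rho>"
  fix Z f g x assume s: "Z \<in> sections hF" and f: "f \<in> smooth_functions M" and g: "g \<in> smooth_functions M"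
    and x: "x \<in> points M"
  obtain v where v: "v \<in> tangent_space M x" "\<And>f. vf_apply M (?a Z) f x = v f"
    using pb_anchor_derivation[OF s x] by blast
  note near = smooth_near_smooth_function[OF manifold_M _ x]
  \<comment> \<open>The functions of the locale are extensional, whereas the derivation laws speak
    of unrestricted sums and products; locality of tangent vectors reconciles them.\<close>
  have "v (\<lambda>x\<in>points M. f x + g x) = v (\<lambda>x. f x + g x)" "v (\<lambda>x\<in>points M. f x * g x) = v (\<lambda>x. f x * g x)"
    by (rule tangent_local[OF v(1) openin_points[OF manifold_M] x]; simp)+
  moreover have "v (\<lambda>x. f x + g x) = v f + v g" "v (\<lambda>x. f x * g x) = v f * g x + f x * v g"
    by (rule tangent_derivation[OF v(1) near[OF f] near[OF g]])+
  ultimately show "vf_apply M (?a Z) (\<lambda>x\<in>points M. f x + g x) x = vf_apply M (?a Z) f x + vf_apply M (?a Z) g x"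
    "vf_apply M (?a Z) (\<lambda>x\<in>points M. f x * g x) x = vf_apply M (?a Z) f x * g x + f x * vf_apply M (?a Z) g x"
    unfolding v(2) by simp_all
next
  fix Z A x and f g :: "'m \<Rightarrow> real"
  assume s: "Z \<in> sections hF" and A: "openin (mtop M) A" "x \<in> A" "\<And>y. y \<in> A \<Longrightarrow> f y = g y"
  have x: "x \<in> points M" using A mtop_subset[OF manifold_M] by blast
  obtain v where v: "v \<in> tangent_space M x" "\<And>f. vf_apply M (pb_anchor M h \<eta> F \<rho> Z) f x = v f"
    using pb_anchor_derivation[OF s x] by blast
  show "vf_apply M (pb_anchor M h \<eta> F \<rho> Z) f x = vf_apply M (pb_anchor M h \<eta> F \<rho> Z) g x"
    unfolding v(2) by (rule tangent_local[OF v(1) A])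
qed

end

theorem theorem4p10:
  fixes M :: "'m manifold" and h :: "'m \<Rightarrow> 'n" and \<eta> :: "'n \<Rightarrow> 'm"
    and F :: "('f, 'n) vbundle"
    and br :: "('n \<Rightarrow> 'f) \<Rightarrow> ('n \<Rightarrow> 'f) \<Rightarrow> 'n \<Rightarrow> 'f"
    and \<rho> :: "'f \<Rightarrow> 'm \<times> 'm deriv"
    and p r :: nat and E :: "('m \<times> 'f) set"
    and \<Theta> :: "nat \<Rightarrow> ('m \<times> 'f, 'm) form"
  defines "hF \<equiv> pullback_bundle M h F"
    and "brh \<equiv> pb_bracket M h F br"
    and "d \<equiv> ext_diff (pullback_bundle M h F) (pb_anchor M h \<eta> F \<rho>) (pb_bracket M h F br)"
  assumes "generalized_lie_algebroid M h \<eta> F br \<rho>"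
    and "frank F = p"
    and "interior_differential_system M h F r E"
    and "module_basis hF 1 (annihilator_sections hF E) {r+1..p} \<Theta>"
  shows "involutive hF brh E \<longleftrightarrow>
    (\<exists>\<Omega> :: nat \<Rightarrow> nat \<Rightarrow> ('m \<times> 'f, 'm) form.
       (\<forall>\<alpha>\<in>{r+1..p}. \<forall>\<beta>\<in>{r+1..p}. \<Omega> \<alpha> \<beta> \<in> forms hF 1) \<and>
       (\<forall>\<alpha>\<in>{r+1..p}.
          d 1 (\<Theta> \<alpha>) = form_sum hF 2 {r+1..p} (\<lambda>\<beta>. wedge hF 1 1 (\<Omega> \<alpha> \<beta>) (\<Theta> \<beta>)) \<and>
          homogeneous hF 2 (form_sum hF 2 {r+1..p} (\<lambda>\<beta>. wedge hF 1 1 (\<Omega> \<alpha> \<beta>) (\<Theta> \<beta>)))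
            \<in> Idl\<^bsub>exterior_algebra hF\<^esub> (homogeneous hF 1 ` annihilator_sections hF E)))"
proof -
  have "frank (pullback_bundle M h F) = p" using assms(5) by simp
  moreover have "subbundle (pullback_bundle M h F) r E"
    using assms(6) unfolding interior_differential_system_def .
  ultimately show ?thesis
    using anchored_bracket.involutive_iff_structure_forms
      [OF generalized_lie_algebroid.anchored_bracket_pullback[OF assms(4)]] assms(7)
    unfolding hF_def brh_def d_def by blast
qed

end
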